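(* Let $\Phi:T\times\mathbb{R}^n\times\mathbb{R}^q\rightrightarrows\mathbb{R}^m$ be a set-valued normal integrand, let $G:\mathbb{R}^q\rightrightarrows\mathbb{R}^m$ be a closed-graph multifunction, and let $S:\mathbb{R}^n\rightrightarrows\mathbb{R}^q$ be $$S(x):=\{z\in\mathbb{R}^q:\ 0\in\mathrm{E}_\Phi(x,z)+G(z)\}.$$ Let $(\bar x,\bar z)\in\operatorname{gph}S$, suppose that $\Phi_t$ is single-valued and integrably locally Lipschitzian around $(\bar x,\bar z)$, and denote $\bar y:=\mathrm{E}_\Phi(\bar x,\bar z)$. Assume the qualification condition $$\Big[y^*\in\mathbb{R}^m,\ 0\in\operatorname{proj}_{\mathbb{R}^n}\Big(\int_T\partial\langle y^*,\Phi_t\rangle(\bar x,\bar z)\,\mu(dt)\Big)\Big]\Longrightarrow y^*=0.$$ Then for every $z^*\in\mathbb{R}^q$ and $x^*\in D^*S(\bar x,\bar z)(z^* )$ there exists $y^*\in\mathbb{R}^m$ such that $$\begin{pmatrix}x^*\\ -z^*\end{pmatrix}\in\int_T\partial\langle y^*,\Phi_t\rangle(\bar x,\bar z)\,\mu(dt)+\begin{pmatrix}0\\ D^*G(\bar z,-\bar y)(y^* )\end{pmatrix}.$$ Furthermore: (i) $S$ is Lipschitz-like around $(\bar x,\bar z)$ if the partial adjoint generalized equation $$0\in\operatorname{proj}_{\mathbb{R}^q}\Big(\int_T\partial\langle y^*,\Phi_t\rangle(\bar x,\bar z)\,\mu(dt)\Big)+D^*G(\bar z,-\bar y)(y^* )$$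 admits only the trivial solution $y^*=0$. (ii) $S$ is metrically regular around $(\bar x,\bar z)$ if $G$ is Lipschitz-like around $(\bar z,-\bar y)$.
   Context: $(T,\mathcal{A},\mu)$ is a complete finite measure space. Set-valued normal integrand: each $\Phi_t:=\Phi(t,\cdot,\cdot)$ has closed graph and $\operatorname{gph}\Phi\in\mathcal{A}\otimes\mathcal{B}(\mathbb{R}^n\times\mathbb{R}^q\times\mathbb{R}^m)$. $\mathrm{E}_\Phi(x,z):=\int_T\Phi_t(x,z)\,\mu(dt)$; integrals of multifunctions are Aumann integrals (sets of integrals of integrable a.e. selections). "$\Phi_t$ is single-valued and integrably locally Lipschitzian around $(\bar x,\bar z)$" means: there are $\eta>0$, $\ell\in L^1(T,\mathbb{R})$ and $\hat T\in\mathcal{A}$ with $\mu(T\setminus\hat T)=0$ such that for all $t\in\hat T$, $\Phi_t$ is single-valued on the closed ball $\mathbb{B}_\eta(\bar x,\bar z)$ and $\|\Phi_t(u)-\Phi_t(u')\|\le\ell(t)\|u-u'\|$ for all $u,u'\in\mathbb{B}_\eta(\bar x,\bar z)$. Normal cones: for $C\subseteq\mathbb{R}^d$ and $x\in C$, $\hat N(x;C):=\{x^*:\limsup_{u\to x,\,u\in C}\langle x^*,u-x\rangle/\|u-x\|\le0\}$ (empty if $x\notin C$), and $N(x;C)$ is the set of all limits of sequences $x_k^*\in\hat N(x_k;C)$ with $x_k\to x$. Coderivative: $D^*M(x,y)(y^* ):=\{x^*:(x^*,-y^* )\in N((x,y);\operatorname{gph}M)\}$ for $(x,y)\in\operatorname{gph}M$.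 Subdifferential: $\partial f(u):=\{u^*:(u^*,-1)\in N((u,f(u));\operatorname{epi}f)\}$, and $\langle y^*,\Phi_t\rangle(\cdot):=\langle y^*,\Phi_t(\cdot)\rangle$ as a function of $(x,z)$ near $(\bar x,\bar z)$. $\operatorname{proj}_{\mathbb{R}^n}$ and $\operatorname{proj}_{\mathbb{R}^q}$ are the projections of $\mathbb{R}^n\times\mathbb{R}^q$ on its factors. $F$ is Lipschitz-like around $(x,z)\in\operatorname{gph}F$ if there exist $\ell\ge0$ and neighborhoods $U$ of $x$, $V$ of $z$ with $F(u)\cap V\subseteq F(v)+\ell\|u-v\|\mathbb{B}$ for all $u,v\in U$ ($\mathbb{B}$ the closed unit ball). $F$ is metrically regular around $(x,z)\in\operatorname{gph}F$ if there exist $\kappa\ge0$ and neighborhoods $U$ of $x$, $V$ of $z$ with $\operatorname{dist}(u;F^{-1}(v))\le\kappa\operatorname{dist}(v;F(u))$ for all $u\in U$, $v\in V$. *)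

theory Defs
  imports "HOL-Analysis.Analysis"
begin

text \<open>A multifunction from \<open>'a\<close> to \<open>'b\<close> is a function \<open>'a \<Rightarrow> 'b set\<close>; dual vectors are
  identified with vectors through the inner product. Sums of sets are Minkowski sums
  (\<^theory>\<open>HOL-Library.Set_Algebras\<close>).\<close>

definition gph :: "('a \<Rightarrow> 'b set) \<Rightarrow> ('a \<times> 'b) set" where
  "gph F = {(x, y). y \<in> F x}"

text \<open>The filter \<open>at x within C\<close> excludes \<open>x\<close> itself; if \<open>x\<close> is an isolated point of \<open>C\<close>, the
  upper limit is \<open>-\<infinity>\<close> and the cone is the whole space.\<close>

definition regular_normal_cone :: "'a::euclidean_space \<Rightarrow> 'a set \<Rightarrow> 'a set" where
  "regular_normal_cone x C =
     (if x \<in> C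
      then {v. Limsup (at x within C) (\<lambda>u. ereal (v \<bullet> (u - x) / norm (u - x))) \<le> 0}
      else {})"

definition normal_cone :: "'a::euclidean_space \<Rightarrow> 'a set \<Rightarrow> 'a set" where
  "normal_cone x C =
     {v. \<exists>xs vs. (\<forall>k::nat. vs k \<in> regular_normal_cone (xs k) C) \<and>
                 xs \<longlonglongrightarrow> x \<and> vs \<longlonglongrightarrow> v}"

definition coderivative ::
    "('a::euclidean_space \<Rightarrow> 'b::euclidean_space set) \<Rightarrow> 'a \<Rightarrow> 'b \<Rightarrow> 'b \<Rightarrow> 'a set" where
  "coderivative F x y w = {v. (v, - w) \<in> normal_cone (x, y) (gph F)}"

definition subdifferential :: "('a::euclidean_space \<Rightarrow> real) \<Rightarrow> 'a \<Rightarrow> 'a set" where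
  "subdifferential f u = {v. (v, - 1) \<in> normal_cone (u, f u) (epigraph UNIV f)}"

definition lipschitz_like ::
    "('a::euclidean_space \<Rightarrow> 'b::euclidean_space set) \<Rightarrow> 'a \<Rightarrow> 'b \<Rightarrow> bool" where
  "lipschitz_like F x z \<longleftrightarrow>
     (\<exists>l\<ge>0. \<exists>U V. open U \<and> x \<in> U \<and> open V \<and> z \<in> V \<and>
        (\<forall>u\<in>U. \<forall>v\<in>U. F u \<inter> V \<subseteq> F v + (\<lambda>b. (l * norm (u - v)) *\<^sub>R b) ` cball 0 1))"

text \<open>The distance to a set, with value \<open>\<infinity>\<close> for the empty set (\<^const>\<open>infdist\<close> would give 0).\<close>

definition dist_to_set :: "'a::metric_space \<Rightarrow> 'a set \<Rightarrow> ereal" where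
  "dist_to_set x C = (INF y\<in>C. ereal (dist x y))"

text \<open>In \<^typ>\<open>ereal\<close>, \<open>0 * \<infinity> = 0\<close>. This convention does not matter here, since \<open>\<kappa>\<close> may be
  enlarged.\<close>

definition metrically_regular ::
    "('a::euclidean_space \<Rightarrow> 'b::euclidean_space set) \<Rightarrow> 'a \<Rightarrow> 'b \<Rightarrow> bool" where
  "metrically_regular F x z \<longleftrightarrow>
     (\<exists>\<kappa>\<ge>0. \<exists>U V. open U \<and> x \<in> U \<and> open V \<and> z \<in> V \<and>
        (\<forall>u\<in>U. \<forall>v\<in>V. dist_to_set u {u'. v \<in> F u'} \<le> ereal \<kappa> * dist_to_set v (F u)))"

definition aumann_integral ::
    "'t measure \<Rightarrow> ('t \<Rightarrow> 'a::euclidean_space set) \<Rightarrow> 'a set" where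
  "aumann_integral M F =
     {integral\<^sup>L M f | f. integrable M f \<and> (AE t in M. f t \<in> F t)}"

definition normal_integrand ::
    "'t measure \<Rightarrow> ('t \<Rightarrow> 'a::euclidean_space \<Rightarrow> 'b::euclidean_space set) \<Rightarrow> bool" where
  "normal_integrand M \<Phi> \<longleftrightarrow>
     (\<forall>t\<in>space M. closed (gph (\<Phi> t))) \<and>
     {(t, u, y). t \<in> space M \<and> y \<in> \<Phi> t u} \<in> sets (M \<Otimes>\<^sub>M borel)"

definition expected_map ::
    "'t measure \<Rightarrow> ('t \<Rightarrow> 'a \<Rightarrow> 'b::euclidean_space set) \<Rightarrow> 'a \<Rightarrow> 'b set" where
  "expected_map M \<Phi> u = aumann_integral M (\<lambda>t. \<Phi> t u)"

definition single_valued_integrably_lipschitz ::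
    "'t measure \<Rightarrow> ('t \<Rightarrow> 'a::euclidean_space \<Rightarrow> 'b::euclidean_space set) \<Rightarrow> 'a \<Rightarrow> bool" where
  "single_valued_integrably_lipschitz M \<Phi> u0 \<longleftrightarrow>
     (\<exists>\<eta>>0. \<exists>l :: 't \<Rightarrow> real. integrable M l \<and>
        (\<exists>T'\<in>sets M. emeasure M (space M - T') = 0 \<and>
           (\<forall>t\<in>T'. (\<forall>u\<in>cball u0 \<eta>. is_singleton (\<Phi> t u)) \<and>
              (\<forall>u\<in>cball u0 \<eta>. \<forall>u'\<in>cball u0 \<eta>.
                 norm (the_elem (\<Phi> t u) - the_elem (\<Phi> t u')) \<le> l t * norm (u - u')))))"

text \<open>The scalarization is meaningful only where \<open>F\<close> is single-valued. If this is so near \<open>u\<close>, then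
  the unspecified values elsewhere do not affect the subdifferential at \<open>u\<close>.\<close>

definition scalarization ::
    "'b::euclidean_space \<Rightarrow> ('a \<Rightarrow> 'b set) \<Rightarrow> 'a \<Rightarrow> real" where
  "scalarization w F u = w \<bullet> the_elem (F u)"

definition solution_map ::
    "'t measure \<Rightarrow> ('t \<Rightarrow> 'a \<times> 'b \<Rightarrow> 'c::euclidean_space set) \<Rightarrow> ('b \<Rightarrow> 'c set) \<Rightarrow> 'a \<Rightarrow> 'b set" where
  "solution_map M \<Phi> G x = {z. 0 \<in> expected_map M \<Phi> (x, z) + G z}"

definition subdifferential_integral ::
    "'t measure \<Rightarrow> ('t \<Rightarrow> 'a::euclidean_space \<Rightarrow> 'b::euclidean_space set) \<Rightarrow> 'b \<Rightarrow> 'a \<Rightarrow> 'a set" where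
  "subdifferential_integral M \<Phi> w u =
     aumann_integral M (\<lambda>t. subdifferential (scalarization w (\<Phi> t)) u)"

end

theory Submission
  imports Defs "HOL-Library.Diagonal_Subsequence"
begin

text \<open>
  Near the reference point the integrand is a Lipschitz function \<open>\<phi> t u\<close> of \<open>u = (x, z)\<close>. Its
  integral \<open>E\<close> is Lipschitz as well, and the graph of \<open>S\<close> is locally the set of all \<open>u\<close> with
  \<open>- E u \<in> G (snd u)\<close>, the preimage of the graph of \<open>G\<close> under a Lipschitz map. Three ideas carry
  the proof.

  \<^bold>\<open>Multipliers by penalization.\<close> Let \<open>v\<close> be a regular normal to this preimage at \<open>u0\<close>. Minimize
  over \<open>u\<close> near \<open>u0\<close> and over \<open>(z', y')\<close> in the graph of \<open>G\<close> the sum of \<open>- v \<bullet> (u - u0)\<close>, of small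
  terms that keep the minimizer near \<open>u0\<close>, and of \<open>j\<close> times the squared residuals of \<open>z = z'\<close> and
  \<open>E u + y' = 0\<close>. The minimizers tend to \<open>u0\<close> as \<open>j\<close> grows. Stationarity in \<open>(z', y')\<close> gives a normal
  \<open>(\<zeta>, - w)\<close> to the graph of \<open>G\<close>, and stationarity in \<open>u\<close> says that \<open>v - (0, \<zeta>)\<close> is almost a regular
  subgradient of \<open>w \<bullet> E\<close> (\<open>normal_to_composite_preimage\<close>). If the multipliers \<open>w\<close> stay bounded along
  a sequence of regular normals, a limit gives the inclusion for \<open>D*S\<close>. If they do not, normalizing
  them makes \<open>v\<close> disappear, and the limit violates the qualification condition
  (\<open>normal_to_solution_graph\<close>).

  \<^bold>\<open>Subgradients of an integral.\<close> The limit requires that limits of almost regular subgradients of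
  \<open>w \<bullet> E\<close> lie in the Aumann integral of the subdifferentials of \<open>w \<bullet> \<phi> t\<close>
  (\<open>limiting_subgradient_of_integral\<close>). Replacing each integrand by its Moreau envelope decouples the
  problem: a minimizer of the perturbed integral of the envelopes yields measurable functions
  \<open>v t\<close>, bounded by an integrable function, whose values are proximal subgradients of the integrands
  at nearby points and whose integral is almost the given vector. It remains to pass to the limit
  under the integral sign, which is Fatou's lemma for vector-valued functions (\<open>fatou_euclidean\<close>):
  the limit of the integrals is the integral of a selection of pointwise cluster points. On the atoms
  of the measure a subsequence converges. Off the atoms Lyapunov's theorem makes the set of integrals
  of selections convex. The limit lies in its closure by the scalar Fatou lemma, and it lies in the
  set itself: otherwise a supporting hyperplane would produce a direction in which a further
  subsequence converges, while the subsequence was chosen to converge in as many directions as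
  possible.

  \<^bold>\<open>Measurability.\<close> The hypotheses give only a measurable graph of \<open>\<phi>\<close>. The projection theorem for
  complete finite measures (\<open>measurable_projection\<close>) turns this into measurability of
  \<open>\<lambda>t. \<phi> t u\<close>. Its proof represents measurable sets of the product by Suslin schemes of rectangles.

  The stability statements follow from Mordukhovich's criterion
  (\<open>lipschitz_like_if_coderivative_zero\<close>), applied to \<open>S\<close> in (i) and to its inverse in (ii). In (i) the
  inclusion and the hypothesis give \<open>w = 0\<close>, and the subdifferential of the zero function is trivial.
  In (ii) the qualification condition gives \<open>w = 0\<close>, and \<open>D*G(0) = {0}\<close> because \<open>G\<close> is Lipschitz-like.
\<close>

section \<open>Measurable projection\<close>

text \<open>The Suslin operation. A scheme is usually indexed by finite sequences; here the index is an
  infinite sequence of which the \<open>n\<close>-th set sees only the first \<open>n\<close> entries. This avoids lists when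
  schemes are combined.\<close>

definition suslin_scheme :: "'a set set \<Rightarrow> (nat \<Rightarrow> (nat \<Rightarrow> nat) \<Rightarrow> 'a set) \<Rightarrow> 'a set \<Rightarrow> bool" where
  "suslin_scheme P R H \<longleftrightarrow> (\<forall>n \<sigma>. R n \<sigma> \<in> P) \<and>
     (\<forall>n \<sigma> \<tau>. (\<forall>i<n. \<sigma> i = \<tau> i) \<longrightarrow> R n \<sigma> = R n \<tau>) \<and> H = {p. \<exists>\<sigma>. \<forall>n. p \<in> R n \<sigma>}"

definition suslin_over :: "'a set set \<Rightarrow> 'a set \<Rightarrow> bool" where
  "suslin_over P H \<longleftrightarrow> (\<exists>R. suslin_scheme P R H)"

lemma suslin_overI:
  fixes R :: "nat \<Rightarrow> (nat \<Rightarrow> nat) \<Rightarrow> 'a set"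
  assumes "\<And>n \<sigma>. R n \<sigma> \<in> P" "\<And>n \<sigma> \<tau>. (\<And>i. i < n \<Longrightarrow> \<sigma> i = \<tau> i) \<Longrightarrow> R n \<sigma> = R n \<tau>"
    and "\<And>p. p \<in> H \<longleftrightarrow> (\<exists>\<sigma>. \<forall>n. p \<in> R n \<sigma>)"
  shows "suslin_over P H"
  unfolding suslin_over_def suslin_scheme_def
proof (intro exI[of _ R] conjI allI impI)
  show "H = {p. \<exists>\<sigma>. \<forall>n. p \<in> R n \<sigma>}" using assms(3) by blast
qed (use assms(1) in blast, rule assms(2), blast)

lemma suslin_schemeD:
  assumes "suslin_scheme P R H"
  shows "R n \<sigma> \<in> P" and "(\<And>i. i < n \<Longrightarrow> \<sigma> i = \<tau> i) \<Longrightarrow> R n \<sigma> = R n \<tau>"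
    and "p \<in> H \<longleftrightarrow> (\<exists>\<sigma>. \<forall>n. p \<in> R n \<sigma>)"
  using assms unfolding suslin_scheme_def by simp_all

lemma suslin_over_base: "A \<in> P \<Longrightarrow> suslin_over P A"
  by (rule suslin_overI[where R = "\<lambda>_ _. A"]) auto

text \<open>The first entry of the combined sequence selects the set of the union. The level \<open>0\<close> sees no
  entry, so a largest set \<open>W\<close> of the paving is needed there.\<close>

lemma suslin_over_UN:
  fixes H :: "nat \<Rightarrow> 'a set"
  assumes H: "\<And>k. suslin_over P (H k)" and W: "W \<in> P" "\<Union>P \<subseteq> W"
  shows "suslin_over P (\<Union>k. H k)"
proof -
  obtain R where R: "\<And>k. suslin_scheme P (R k) (H k)"
    using H unfolding suslin_over_def by metis
  note RP = suslin_schemeD(1)[OF R] and Rdep = suslin_schemeD(2)[OF R] and RH = suslin_schemeD(3)[OF R]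
  define R' where "R' n \<sigma> = (case n of 0 \<Rightarrow> W | Suc m \<Rightarrow> R (\<sigma> 0) m (\<lambda>i. \<sigma> (Suc i)))"
    for n :: nat and \<sigma> :: "nat \<Rightarrow> nat"
  show ?thesis
  proof (rule suslin_overI[where R = R'])
    show "R' n \<sigma> \<in> P" for n \<sigma>
      using RP W by (auto simp: R'_def split: nat.split)
    show "R' n \<sigma> = R' n \<tau>" if "\<And>i. i < n \<Longrightarrow> \<sigma> i = \<tau> i" for n \<sigma> \<tau>
    proof (cases n)
      case (Suc m)
      then have "\<sigma> 0 = \<tau> 0" "\<And>i. i < m \<Longrightarrow> \<sigma> (Suc i) = \<tau> (Suc i)" using that by auto
      then show ?thesis by (simp add: R'_def Suc) (rule Rdep, simp)
    qed (simp add: R'_def)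
    show "p \<in> (\<Union>k. H k) \<longleftrightarrow> (\<exists>\<sigma>. \<forall>n. p \<in> R' n \<sigma>)" for p
    proof
      assume "p \<in> (\<Union>k. H k)"
      then obtain k \<sigma> where \<sigma>: "\<And>n. p \<in> R k n \<sigma>" using RH by blast
      have "p \<in> R' n (case_nat k \<sigma>)" for n
        using \<sigma> RP[of k 0 \<sigma>] W by (cases n) (auto simp: R'_def)
      then show "\<exists>\<sigma>. \<forall>n. p \<in> R' n \<sigma>" by blast
    next
      assume "\<exists>\<sigma>. \<forall>n. p \<in> R' n \<sigma>"
      then obtain \<sigma> where "\<And>n. p \<in> R' n \<sigma>" by blast
      from this[of "Suc _"] have "\<And>n. p \<in> R (\<sigma> 0) n (\<lambda>i. \<sigma> (Suc i))" by (simp add: R'_def)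
      then show "p \<in> (\<Union>k. H k)" using RH by blast
    qed
  qed
qed

lemma prod_encode_strict_mono: "i < j \<Longrightarrow> prod_encode (k, i) < prod_encode (k, j)"
proof (induction j)
  case (Suc j)
  have "prod_encode (k, j) < prod_encode (k, Suc j)" by (simp add: prod_encode_def)
  with Suc show ?case by (metis less_Suc_eq order.strict_trans)
qed simp

text \<open>The sequences that witness membership in the sets \<open>H k\<close> are merged into one by a pairing
  function. The monotonicity of the pairing ensures that the level with code \<open>(k, j)\<close> sees the first
  \<open>j\<close> entries of the \<open>k\<close>-th sequence.\<close>

lemma suslin_over_INT:
  fixes H :: "nat \<Rightarrow> 'a set"
  assumes H: "\<And>k. suslin_over P (H k)"
  shows "suslin_over P (\<Inter>k. H k)"
proof -
  obtain R where R: "\<And>k. suslin_scheme P (R k) (H k)"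
    using H unfolding suslin_over_def by metis
  note RP = suslin_schemeD(1)[OF R] and Rdep = suslin_schemeD(2)[OF R] and RH = suslin_schemeD(3)[OF R]
  define R' where "R' n \<sigma> = (case prod_decode n of (k, j) \<Rightarrow> R k j (\<lambda>i. \<sigma> (prod_encode (k, i))))"
    for n :: nat and \<sigma> :: "nat \<Rightarrow> nat"
  show ?thesis
  proof (rule suslin_overI[where R = R'])
    show "R' n \<sigma> \<in> P" for n \<sigma>
      using RP by (auto simp: R'_def split: prod.split)
    show "R' n \<sigma> = R' n \<tau>" if *: "\<And>i. i < n \<Longrightarrow> \<sigma> i = \<tau> i" for n \<sigma> \<tau>
    proof -
      obtain k j where kj: "n = prod_encode (k, j)" by (metis prod_decode_inverse surj_pair)
      have "\<sigma> (prod_encode (k, i)) = \<tau> (prod_encode (k, i))" if "i < j" for i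
        using * kj prod_encode_strict_mono that by blast
      then show ?thesis by (simp add: R'_def kj) (rule Rdep, simp)
    qed
    show "p \<in> (\<Inter>k. H k) \<longleftrightarrow> (\<exists>\<sigma>. \<forall>n. p \<in> R' n \<sigma>)" for p
    proof
      assume "p \<in> (\<Inter>k. H k)"
      then have "\<forall>k. \<exists>\<sigma>. \<forall>n. p \<in> R k n \<sigma>" using RH by blast
      then obtain s where s: "\<And>k n. p \<in> R k n (s k)" by metis
      have "p \<in> R' n (\<lambda>i. case prod_decode i of (k, j) \<Rightarrow> s k j)" for n
        using s by (auto simp: R'_def split: prod.split)
      then show "\<exists>\<sigma>. \<forall>n. p \<in> R' n \<sigma>" by blast
    next
      assume "\<exists>\<sigma>. \<forall>n. p \<in> R' n \<sigma>"
      then obtain \<sigma> where \<sigma>: "\<And>n. p \<in> R' n \<sigma>" by blast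
      have "p \<in> R k j (\<lambda>i. \<sigma> (prod_encode (k, i)))" for k j
        using \<sigma>[of "prod_encode (k, j)"] by (simp add: R'_def)
      then show "p \<in> (\<Inter>k. H k)" using RH by blast
    qed
  qed
qed

text \<open>An intersection of measurable supersets whose measures approach the infimum.\<close>

lemma (in finite_measure) measurable_hull:
  assumes "E \<subseteq> space M"
  shows "\<exists>B\<in>sets M. E \<subseteq> B \<and> (\<forall>C\<in>sets M. E \<subseteq> C \<longrightarrow> measure M (B - C) = 0)"
proof -
  define V where "V = {measure M B | B. B \<in> sets M \<and> E \<subseteq> B}"
  have V: "V \<noteq> {}" "bdd_below V" using assms by (auto simp: V_def bdd_below_def intro!: exI[of _ 0])
  have "\<forall>n. \<exists>B. B \<in> sets M \<and> E \<subseteq> B \<and> measure M B < Inf V + 1 / Suc n"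
  proof
    fix n
    have "Inf V < Inf V + 1 / Suc n" by simp
    then obtain v where "v \<in> V" "v < Inf V + 1 / Suc n" using V cInf_less_iff by blast
    then show "\<exists>B. B \<in> sets M \<and> E \<subseteq> B \<and> measure M B < Inf V + 1 / Suc n"
      by (auto simp: V_def)
  qed
  then obtain B where B: "\<And>n. B n \<in> sets M" "\<And>n. E \<subseteq> B n" 
    "\<And>n. measure M (B n) < Inf V + 1 / Suc n" by metis
  define D where "D = (\<Inter>n. B n)"
  have D: "D \<in> sets M" "E \<subseteq> D" using B by (auto simp: D_def)
  have Dle: "measure M D \<le> Inf V"
  proof (rule field_le_epsilon)
    fix e :: real assume "e > 0"
    then obtain n where n: "1 / Suc n < e" using nat_approx_posE by blast
    have "measure M D \<le> measure M (B n)"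
      using B by (intro finite_measure_mono) (auto simp: D_def)
    then show "measure M D \<le> Inf V + e" using B(3)[of n] n by linarith
  qed
  show ?thesis
  proof (intro bexI[of _ D] conjI ballI impI)
    fix C assume C: "C \<in> sets M" "E \<subseteq> C"
    have "measure M (D \<inter> C) \<in> V" using C D by (auto simp: V_def)
    then have "measure M D \<le> measure M (D \<inter> C)" using Dle V cInf_lower by fastforce
    moreover have "measure M (D - C) = measure M D - measure M (D \<inter> C)"
      using C D finite_measure_Diff'[of D C] by simp
    ultimately show "measure M (D - C) = 0"
      using measure_nonneg[of M "D - C"] by linarith
  qed (use D in auto)
qed

text \<open>Marczewski's theorem. Let \<open>E n \<sigma>\<close> be the set of points that have a witness beginning with the
  first \<open>n\<close> entries of \<open>\<sigma>\<close>; it is the union over \<open>k\<close> of the sets one level deeper. Replacing each of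
  them by a measurable hull \<open>B n \<sigma>\<close> breaks this identity only on a null set, and there are only
  countably many such sets because \<open>B n \<sigma>\<close> depends on finitely many entries. Outside the union of
  these null sets, a point of \<open>B 0 \<sigma>\<close> can be followed level by level to a witness. Thus the set differs
  from its hull by a null set, and completeness applies.\<close>

lemma suslin_over_sets:
  assumes "complete_measure M" "finite_measure M" and S: "suslin_over (sets M) H"
  shows "H \<in> sets M"
proof -
  interpret complete_measure M by fact
  interpret finite_measure M by fact
  obtain R where sch: "suslin_scheme (sets M) R H"
    using S unfolding suslin_over_def by blast
  note R = suslin_schemeD(1)[OF sch] and Rdep = suslin_schemeD(2)[OF sch] and HR = suslin_schemeD(3)[OF sch]
  define E where "E n \<sigma> = {p. \<exists>\<tau>. (\<forall>i<n. \<tau> i = \<sigma> i) \<and> (\<forall>k. p \<in> R k \<tau>)}"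
    for n :: nat and \<sigma> :: "nat \<Rightarrow> nat"
  have E_sp: "E n \<sigma> \<subseteq> space M" for n \<sigma>
  proof
    fix p assume "p \<in> E n \<sigma>"
    then obtain \<tau> where "p \<in> R 0 \<tau>" by (auto simp: E_def)
    then show "p \<in> space M" using R sets.sets_into_space by blast
  qed
  define is_hull where "is_hull X B \<longleftrightarrow> B \<in> sets M \<and> X \<subseteq> B \<and> (\<forall>C\<in>sets M. X \<subseteq> C \<longrightarrow> measure M (B - C) = 0)"
    for X B
  define mhull where "mhull X = (SOME B. is_hull X B)" for X
  have "is_hull X (mhull X)" if X: "X \<subseteq> space M" for X
  proof -
    have "\<exists>B. is_hull X B" using measurable_hull[OF X] by (auto simp: is_hull_def)
    then show ?thesis unfolding mhull_def by (rule someI_ex)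
  qed
  then have hull: "mhull X \<in> sets M" "X \<subseteq> mhull X"
    "C \<in> sets M \<Longrightarrow> X \<subseteq> C \<Longrightarrow> measure M (mhull X - C) = 0" if "X \<subseteq> space M" for X C
    using that by (simp_all add: is_hull_def)
  \<comment> \<open>intersecting with \<open>R n \<sigma>\<close> makes every branch through the hulls a witness\<close>
  define B where "B n \<sigma> = mhull (E n \<sigma>) \<inter> R n \<sigma>" for n \<sigma>
  have E_R: "E n \<sigma> \<subseteq> R n \<sigma>" for n \<sigma>
  proof
    fix p assume "p \<in> E n \<sigma>"
    then obtain \<tau> where "\<forall>i<n. \<tau> i = \<sigma> i" "p \<in> R n \<tau>" by (auto simp: E_def)
    then show "p \<in> R n \<sigma>" using Rdep[of n \<tau> \<sigma>] by simp
  qed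
  have B: "B n \<sigma> \<in> sets M" "E n \<sigma> \<subseteq> B n \<sigma>" for n \<sigma>
    using hull[OF E_sp] R E_R by (auto simp: B_def)
  have Bhull: "measure M (B n \<sigma> - C) = 0" if "C \<in> sets M" "E n \<sigma> \<subseteq> C" for n \<sigma> C
  proof -
    have "measure M (B n \<sigma> - C) \<le> measure M (mhull (E n \<sigma>) - C)"
      using hull[OF E_sp] that by (intro finite_measure_mono) (auto simp: B_def)
    then show ?thesis using hull(3)[OF E_sp that] by (simp add: measure_le_0_iff)
  qed
  have Bdep: "B n \<sigma> = B n \<tau>" if "\<And>i. i < n \<Longrightarrow> \<sigma> i = \<tau> i" for n \<sigma> \<tau>
  proof -
    have "E n \<sigma> = E n \<tau>" using that by (auto simp: E_def)
    then show ?thesis using Rdep that unfolding B_def by metis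
  qed
  define Nul where "Nul n \<sigma> = B n \<sigma> - (\<Union>k. B (Suc n) (\<sigma>(n := k)))" for n \<sigma>
  have Nul: "Nul n \<sigma> \<in> null_sets M" for n \<sigma>
  proof -
    have "E n \<sigma> \<subseteq> (\<Union>k. E (Suc n) (\<sigma>(n := k)))"
    proof
      fix p assume "p \<in> E n \<sigma>"
      then obtain \<tau> where "\<forall>i<n. \<tau> i = \<sigma> i" "\<forall>k. p \<in> R k \<tau>" by (auto simp: E_def)
      then have "p \<in> E (Suc n) (\<sigma>(n := \<tau> n))" by (auto simp: E_def less_Suc_eq)
      then show "p \<in> (\<Union>k. E (Suc n) (\<sigma>(n := k)))" by blast
    qed
    also have "\<dots> \<subseteq> (\<Union>k. B (Suc n) (\<sigma>(n := k)))" using B by blast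
    finally have "measure M (Nul n \<sigma>) = 0" unfolding Nul_def using B by (intro Bhull) auto
    moreover have "Nul n \<sigma> \<in> sets M" unfolding Nul_def using B by auto
    ultimately show ?thesis by (simp add: emeasure_eq_measure null_setsI)
  qed
  \<comment> \<open>a finite prefix, continued by zeros, stands for all sequences that begin with it\<close>
  define pad where "pad s i = (if i < length s then s ! i else 0)" for s :: "nat list" and i
  define N where "N = (\<Union>s. Nul (length s) (pad s))"
  have N: "N \<in> null_sets M" unfolding N_def using Nul by (intro null_sets_UN') auto
  have NulN: "Nul n \<sigma> \<subseteq> N" for n \<sigma>
  proof -
    let ?s = "map \<sigma> [0..<n]"
    have "pad ?s i = \<sigma> i" if "i < n" for i using that by (simp add: pad_def)
    then have "B n (pad ?s) = B n \<sigma>" "B (Suc n) ((pad ?s)(n := k)) = B (Suc n) (\<sigma>(n := k))" for k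
      by (auto intro!: Bdep)
    then have "Nul n \<sigma> = Nul (length ?s) (pad ?s)" by (simp add: Nul_def)
    then show ?thesis unfolding N_def by blast
  qed
  let ?o = "\<lambda>_. 0 :: nat"
  have HE: "H = E 0 ?o" by (rule set_eqI) (simp add: HR E_def)
  have "B 0 ?o - N \<subseteq> H"
  proof
    fix p assume p: "p \<in> B 0 ?o - N"
    \<comment> \<open>outside \<open>N\<close> a branch never gets stuck\<close>
    have step: "\<exists>k. p \<in> B (Suc n) (\<sigma>(n := k))" if "p \<in> B n \<sigma>" for n \<sigma>
      using that p NulN[of n \<sigma>] by (auto simp: Nul_def)
    then obtain c where c: "\<And>n \<sigma>. p \<in> B n \<sigma> \<Longrightarrow> p \<in> B (Suc n) (\<sigma>(n := c n \<sigma>))" by metis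
    define g where "g = rec_nat ?o (\<lambda>n \<sigma>. \<sigma>(n := c n \<sigma>))"
    have g0: "g 0 = ?o" and gS: "g (Suc n) = (g n)(n := c n (g n))" for n by (auto simp: g_def)
    have pg: "p \<in> B n (g n)" for n
    proof (induction n)
      case 0 then show ?case using p by (simp add: g0)
    next
      case (Suc n) then show ?case unfolding gS by (rule c)
    qed
    have stab: "i < n \<Longrightarrow> g n i = g (Suc i) i" for n i
      by (induction n) (auto simp: gS less_Suc_eq)
    have "p \<in> R n (\<lambda>i. g (Suc i) i)" for n
    proof -
      have "B n (g n) = B n (\<lambda>i. g (Suc i) i)" by (rule Bdep) (rule stab)
      then have "p \<in> B n (\<lambda>i. g (Suc i) i)" using pg[of n] by (simp only:)
      then show ?thesis by (simp add: B_def)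
    qed
    then show "p \<in> H" unfolding HR by blast
  qed
  then have "B 0 ?o - H \<subseteq> N" by blast
  then have "B 0 ?o - H \<in> null_sets M" using N complete2 by blast
  then have "B 0 ?o - (B 0 ?o - H) \<in> sets M" using B(1)[of 0 ?o] by (metis null_setsD2 sets.Diff)
  moreover have "B 0 ?o - (B 0 ?o - H) = H" using B HE by blast
  ultimately show ?thesis by simp
qed

definition closed_rectangles :: "'t measure \<Rightarrow> ('t \<times> 'a::topological_space) set set" where
  "closed_rectangles M = {A \<times> C | A C. A \<in> sets M \<and> closed C}"

text \<open>The sets that are Suslin together with their complement form a sigma-algebra. It contains the
  rectangles with open second side, because open sets are countable unions of closed ones.\<close>

lemma suslin_over_pair_sets:
  fixes H :: "('t \<times> 'a::euclidean_space) set"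
  assumes "H \<in> sets (M \<Otimes>\<^sub>M borel)"
  shows "suslin_over (closed_rectangles M) H"
proof -
  let ?W = "space M \<times> (UNIV :: 'a set)"
  let ?P = "closed_rectangles M :: ('t \<times> 'a) set set"
  have W: "?W \<in> ?P" "\<Union>?P \<subseteq> ?W"
    by (auto simp: closed_rectangles_def dest: sets.sets_into_space)
  define K where "K = {H. H \<subseteq> ?W \<and> suslin_over ?P H \<and> suslin_over ?P (?W - H)}"
  have K_compl: "?W - H \<in> K" if "H \<in> K" for H
    using that by (auto simp: K_def double_diff)
  have K_UN: "(\<Union>k. F k) \<in> K" if "\<And>k :: nat. F k \<in> K" for F
  proof -
    have "?W - (\<Union>k. F k) = (\<Inter>k. ?W - F k)" by auto
    moreover have "suslin_over ?P (\<Union>k. F k)"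
      by (rule suslin_over_UN[OF _ W]) (use that in \<open>simp add: K_def\<close>)
    moreover have "suslin_over ?P (\<Inter>k. ?W - F k)"
      by (rule suslin_over_INT) (use that in \<open>simp add: K_def\<close>)
    moreover have "(\<Union>k. F k) \<subseteq> ?W" using that by (simp add: K_def UN_least)
    ultimately show ?thesis by (simp add: K_def)
  qed
  have empty: "{} \<in> ?P" by (auto simp: closed_rectangles_def)
  have two: "suslin_over ?P (X \<union> Y)" if "suslin_over ?P X" "suslin_over ?P Y" for X Y
  proof -
    have "X \<union> Y = (\<Union>k::nat. if k = 0 then X else Y)"
      by (auto split: if_splits)
    moreover have "suslin_over ?P (\<Union>k::nat. if k = 0 then X else Y)"
      by (rule suslin_over_UN[OF _ W]) (use that in simp)
    ultimately show ?thesis by simp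
  qed
  have open_rect: "suslin_over ?P (A \<times> U)" if A: "A \<in> sets M" and U: "open U" for A and U :: "'a set"
  proof -
    obtain D :: "nat \<Rightarrow> 'a set" where D: "\<And>n. closed (D n)" "U = (\<Union>n. D n)"
    proof -
      show ?thesis
      proof (cases "U = {}")
        case True then show ?thesis using that[of "\<lambda>_. {}"] by simp
      next
        case False
        obtain F where F: "countable F" "\<And>X. X \<in> F \<Longrightarrow> \<exists>a b. X = cbox a b" "\<Union>F = U"
          using open_countable_Union_open_cbox[OF U] by metis
        with False have "F \<noteq> {}" by auto
        then have "range (from_nat_into F) = F" using F(1) by (rule range_from_nat_into)
        then show ?thesis using that[of "from_nat_into F"] F by (metis closed_cbox rangeI)
      qed
    qed
    have "A \<times> U = (\<Union>n. A \<times> D n)" using D by auto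
    moreover have "suslin_over ?P (\<Union>n. A \<times> D n)"
      by (rule suslin_over_UN[OF _ W], rule suslin_over_base) (use D A in \<open>auto simp: closed_rectangles_def\<close>)
    ultimately show ?thesis by simp
  qed
  have gen: "A \<times> B \<in> K" if A: "A \<in> sets M" and B: "B \<in> sets borel" for A and B :: "'a set"
  proof -
    from B have "B \<in> sigma_sets UNIV (Collect open)" by (simp add: borel_def)
    then show ?thesis
    proof (induction B rule: sigma_sets.induct)
      case (Basic U)
      have "?W - A \<times> U = (space M - A) \<times> UNIV \<union> A \<times> (- U)" using sets.sets_into_space[OF A] by auto
      moreover have "suslin_over ?P ((space M - A) \<times> UNIV)" "suslin_over ?P (A \<times> (- U))"
        using A Basic by (auto intro!: suslin_over_base simp: closed_rectangles_def)
      ultimately show ?case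
        using Basic two open_rect[OF A] sets.sets_into_space[OF A] by (auto simp: K_def)
    next
      case Empty
      show ?case using suslin_over_base[OF empty] suslin_over_base[OF W(1)] by (simp add: K_def)
    next
      case (Compl B)
      have A0: "suslin_over ?P ((space M - A) \<times> UNIV)" 
        using A by (auto intro!: suslin_over_base simp: closed_rectangles_def)
      have *: "A \<times> (UNIV - B) = (\<Inter>k::nat. if k = 0 then A \<times> UNIV else ?W - A \<times> B)"
        "?W - A \<times> (UNIV - B) = (space M - A) \<times> UNIV \<union> A \<times> B"
        using sets.sets_into_space[OF A] by (auto split: if_splits)
      have "suslin_over ?P (A \<times> (UNIV - B))" unfolding *
        using Compl A by (intro suslin_over_INT) (auto simp: K_def intro!: suslin_over_base simp: closed_rectangles_def)
      moreover have "suslin_over ?P (?W - A \<times> (UNIV - B))"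
        unfolding *(2) by (rule two[OF A0]) (use Compl in \<open>simp add: K_def\<close>)
      ultimately show ?case using sets.sets_into_space[OF A] by (auto simp: K_def)
    next
      case (Union F)
      have "A \<times> \<Union> (range F) = (\<Union>k. A \<times> F k)" by auto
      then show ?case using K_UN Union by simp
    qed
  qed
  from assms have "H \<in> sigma_sets ?W {a \<times> b |a b. a \<in> sets M \<and> b \<in> sets borel}"
    by (simp add: sets_pair_measure)
  then have "H \<in> K"
  proof (induction H rule: sigma_sets.induct)
    case (Basic a) then show ?case using gen by auto
  next
    case Empty show ?case using gen[of "{}" "{}"] by simp
  next
    case (Compl a) then show ?case using K_compl by simp
  next
    case (Union a) then show ?case using K_UN by simp
  qed
  then show ?thesis by (simp add: K_def)
qed

text \<open>A scheme of rectangles \<open>A n \<sigma> \<times> C n \<sigma>\<close> projects to a scheme of measurable sets. After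
  intersecting with a ball, the sides \<open>C n \<sigma>\<close> are compact, so a common point of all of them exists as
  soon as every finite intersection is nonempty. The second coordinate is therefore eliminated by
  discarding \<open>A n \<sigma>\<close> whenever the sides up to \<open>C n \<sigma>\<close> have no common point in the ball.\<close>

lemma measurable_projection:
  fixes H :: "('t \<times> 'a::euclidean_space) set"
  assumes M: "complete_measure M" "finite_measure M" and H: "H \<in> sets (M \<Otimes>\<^sub>M borel)"
  shows "fst ` H \<in> sets M"
proof -
  obtain R where sch: "suslin_scheme (closed_rectangles M) R H"
    using suslin_over_pair_sets[OF H] unfolding suslin_over_def by blast
  note R = suslin_schemeD(1)[OF sch] and Rdep = suslin_schemeD(2)[OF sch] and HR = suslin_schemeD(3)[OF sch]
  have "\<forall>X :: ('t \<times> 'a) set. \<exists>A C. X \<in> closed_rectangles M \<longrightarrow> A \<in> sets M \<and> closed C \<and> X = A \<times> C"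
    by (auto simp: closed_rectangles_def)
  then obtain a c where ac: "\<And>X :: ('t \<times> 'a) set. X \<in> closed_rectangles M \<Longrightarrow> a X \<in> sets M \<and> closed (c X) \<and> X = a X \<times> c X"
    by metis
  define A where "A n \<sigma> = a (R n \<sigma>)" for n \<sigma>
  define C where "C n \<sigma> = c (R n \<sigma>)" for n \<sigma>
  have AC: "A n \<sigma> \<in> sets M" "closed (C n \<sigma>)" "R n \<sigma> = A n \<sigma> \<times> C n \<sigma>" for n \<sigma>
    using ac[OF R] by (auto simp: A_def C_def)
  have dep: "A n \<sigma> = A n \<tau>" "C n \<sigma> = C n \<tau>" if "\<And>i. i < n \<Longrightarrow> \<sigma> i = \<tau> i" for n \<sigma> \<tau>
    using Rdep[OF that] by (auto simp: A_def C_def)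
  define F where "F N n \<sigma> = (\<Inter>i\<le>n. C i \<sigma>) \<inter> cball 0 (real N)" for N n \<sigma>
  define A' where "A' N n \<sigma> = (if F N n \<sigma> \<noteq> {} then A n \<sigma> else {})" for N n \<sigma>
  have proj: "suslin_over (sets M) {t. \<exists>y\<in>cball 0 (real N). (t, y) \<in> H}" for N :: nat
  proof (rule suslin_overI[where R = "A' N"])
    show "A' N n \<sigma> \<in> sets M" for n \<sigma> using AC by (auto simp: A'_def)
    show "A' N n \<sigma> = A' N n \<tau>" if "\<And>i. i < n \<Longrightarrow> \<sigma> i = \<tau> i" for n \<sigma> \<tau>
    proof -
      have "C i \<sigma> = C i \<tau>" if "i \<le> n" for i using \<open>\<And>i. i < n \<Longrightarrow> \<sigma> i = \<tau> i\<close> that by (intro dep) auto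
      then have "F N n \<sigma> = F N n \<tau>" by (simp add: F_def)
      then show ?thesis using dep[OF that] by (simp add: A'_def)
    qed
    show "t \<in> {t. \<exists>y\<in>cball 0 (real N). (t, y) \<in> H} \<longleftrightarrow> (\<exists>\<sigma>. \<forall>n. t \<in> A' N n \<sigma>)" for t
    proof
      assume "t \<in> {t. \<exists>y\<in>cball 0 (real N). (t, y) \<in> H}"
      then obtain y \<sigma> where y: "y \<in> cball 0 (real N)" "\<And>n. (t, y) \<in> R n \<sigma>" using HR by blast
      then have "y \<in> F N n \<sigma>" "t \<in> A n \<sigma>" for n using AC(3) by (auto simp: F_def)
      then have "t \<in> A' N n \<sigma>" for n by (auto simp: A'_def)
      then show "\<exists>\<sigma>. \<forall>n. t \<in> A' N n \<sigma>" by blast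
    next
      assume "\<exists>\<sigma>. \<forall>n. t \<in> A' N n \<sigma>"
      then obtain \<sigma> where "\<And>n. t \<in> A' N n \<sigma>" by blast
      then have t: "F N n \<sigma> \<noteq> {}" "t \<in> A n \<sigma>" for n unfolding A'_def by (metis empty_iff)+
      have "\<Inter>(range (\<lambda>n. F N n \<sigma>)) \<noteq> {}"
      proof (rule compact_nest)
        show "compact (F N n \<sigma>)" for n unfolding F_def
          using AC(2) by (intro closed_Int_compact closed_INT) auto
        show "m \<le> n \<Longrightarrow> F N n \<sigma> \<subseteq> F N m \<sigma>" for m n by (auto simp: F_def)
      qed (rule t)
      then obtain y where "\<And>n. y \<in> F N n \<sigma>" by blast
      then have "y \<in> cball 0 (real N)" "\<And>n. y \<in> C n \<sigma>" by (auto simp: F_def)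
      then show "t \<in> {t. \<exists>y\<in>cball 0 (real N). (t, y) \<in> H}"
        using t AC(3) HR by blast
    qed
  qed
  have "fst ` H = (\<Union>N::nat. {t. \<exists>y\<in>cball 0 (real N). (t, y) \<in> H})"
    using real_arch_simple by (force simp: image_iff)
  then show ?thesis using suslin_over_sets[OF M proj] by auto
qed

lemma measurable_if_graph_measurable:
  fixes f :: "'t \<Rightarrow> 'a::euclidean_space"
  assumes M: "complete_measure M" "finite_measure M"
    and f: "{(t, y). t \<in> space M \<and> y = f t} \<in> sets (M \<Otimes>\<^sub>M borel)"
  shows "f \<in> borel_measurable M"
proof (rule measurableI)
  fix B :: "'a set" assume B: "B \<in> sets borel"
  have "f -` B \<inter> space M = fst ` ({(t, y). t \<in> space M \<and> y = f t} \<inter> (space M \<times> B))"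
    by (force simp: image_iff)
  moreover have "\<dots> \<in> sets M"
    using B f by (intro measurable_projection[OF M] sets.Int) auto
  ultimately show "f -` B \<inter> space M \<in> sets M" by simp
qed simp

section \<open>Lyapunov's convexity theorem and atoms\<close>

context finite_measure begin

definition atom_free :: "'a set \<Rightarrow> bool" where
  "atom_free B \<longleftrightarrow> B \<in> sets M \<and>
     (\<forall>A\<in>sets M. A \<subseteq> B \<longrightarrow> 0 < measure M A \<longrightarrow>
        (\<exists>C\<in>sets M. C \<subseteq> A \<and> 0 < measure M C \<and> measure M C < measure M A))"

lemma atom_free_subset: "atom_free B \<Longrightarrow> A \<in> sets M \<Longrightarrow> A \<subseteq> B \<Longrightarrow> atom_free A"
  unfolding atom_free_def by blast

text \<open>Of the two parts of a splitting, one has at most half the measure; iterate.\<close>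

lemma atom_free_small_subset:
  assumes B: "atom_free B" and pos: "0 < measure M B" and "0 < e"
  shows "\<exists>C\<in>sets M. C \<subseteq> B \<and> 0 < measure M C \<and> measure M C < e"
proof -
  have "\<exists>C\<in>sets M. C \<subseteq> B \<and> 0 < measure M C \<and> measure M C \<le> measure M B / 2 ^ n" for n
  proof (induction n)
    case 0
    show ?case using B pos by (auto simp: atom_free_def)
  next
    case (Suc n)
    then obtain C where C: "C \<in> sets M" "C \<subseteq> B" "0 < measure M C" "measure M C \<le> measure M B / 2 ^ n"
      by blast
    then obtain D where D: "D \<in> sets M" "D \<subseteq> C" "0 < measure M D" "measure M D < measure M C"
      using B unfolding atom_free_def by blast
    have "measure M (C - D) = measure M C - measure M D" using C D by (intro finite_measure_Diff) auto
    then have "measure M D \<le> measure M C / 2 \<or> measure M (C - D) \<le> measure M C / 2"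
      "0 < measure M (C - D)" using D by (auto simp: field_simps)
    moreover have "measure M C / 2 \<le> measure M B / 2 ^ Suc n" using C(4) by simp
    ultimately show ?case using C D by (metis Diff_subset dual_order.trans sets.Diff)
  qed
  moreover obtain n where "measure M B / 2 ^ n < e"
  proof -
    have "(\<lambda>n. measure M B * (1/2) ^ n) \<longlonglongrightarrow> measure M B * 0"
      by (intro tendsto_mult LIMSEQ_power_zero) auto
    then have "\<forall>\<^sub>F n in sequentially. measure M B * (1/2) ^ n < e"
      using \<open>0 < e\<close> by (intro order_tendstoD(2)) auto
    then show ?thesis using that by (auto simp: power_one_over eventually_sequentially field_simps)
  qed
  ultimately show ?thesis by (meson order.strict_trans1)
qed

text \<open>Sierpinski's theorem. A greedy exhaustion cannot stop below the level \<open>r\<close>: a set of small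
  positive measure in the remainder would have been a candidate at every stage, while the measures of
  the sets that were added tend to \<open>0\<close>.\<close>

lemma atom_free_intermediate:
  assumes B: "atom_free B" and r: "0 \<le> r" "r \<le> measure M B"
  shows "\<exists>A\<in>sets M. A \<subseteq> B \<and> measure M A = r"
proof -
  define feas where "feas X D \<longleftrightarrow> D \<in> sets M \<and> D \<subseteq> B - X \<and> measure M X + measure M D \<le> r" for X D
  \<comment> \<open>the supremum over feasible sets need not be attained, half of it is\<close>
  have "\<exists>D. measure M X \<le> r \<longrightarrow> feas X D \<and> (\<forall>C. feas X C \<longrightarrow> measure M C \<le> 2 * measure M D)" for X
  proof (cases "measure M X \<le> r")
    case True
    define V where "V = {measure M D | D. feas X D}"
    have e: "feas X {}" using True by (simp add: feas_def)
    then have V: "V \<noteq> {}" "bdd_above V" by (auto simp: V_def bdd_above_def intro!: exI[of _ "measure M (space M)"] bounded_measure)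
    have le: "measure M C \<le> Sup V" if "feas X C" for C
      using that V by (intro cSup_upper) (auto simp: V_def)
    show ?thesis
    proof (cases "Sup V \<le> 0")
      case True
      then show ?thesis using e le by (intro exI[of _ "{}"]) force
    next
      case False
      then have "Sup V / 2 < Sup V" by simp
      then obtain v where "v \<in> V" "Sup V / 2 < v" using V less_cSup_iff by blast
      then obtain D where "feas X D" "Sup V / 2 < measure M D" by (auto simp: V_def)
      then show ?thesis using le by (intro exI[of _ D]) force
    qed
  qed auto
  then obtain d where d: "\<And>X. measure M X \<le> r \<Longrightarrow> feas X (d X)"
    "\<And>X C. measure M X \<le> r \<Longrightarrow> feas X C \<Longrightarrow> measure M C \<le> 2 * measure M (d X)" by metis
  define A where "A = rec_nat {} (\<lambda>_ X. X \<union> d X)"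
  have A0: "A 0 = {}" and AS: "A (Suc n) = A n \<union> d (A n)" for n by (auto simp: A_def)
  have A: "A n \<in> sets M \<and> A n \<subseteq> B \<and> measure M (A n) \<le> r" for n
  proof (induction n)
    case 0 then show ?case using r by (simp add: A0)
  next
    case (Suc n)
    then have f: "feas (A n) (d (A n))" using d by blast
    then have "measure M (A n \<union> d (A n)) = measure M (A n) + measure M (d (A n))"
      using Suc by (intro finite_measure_Union) (auto simp: feas_def)
    then show ?case using f Suc by (auto simp: AS feas_def)
  qed
  have step: "measure M (A (Suc n)) = measure M (A n) + measure M (d (A n))" for n
    using A[of n] d(1)[of "A n"] unfolding AS by (intro finite_measure_Union) (auto simp: feas_def)
  have inc: "incseq A" by (rule incseq_SucI) (auto simp: AS)
  define U where "U = (\<Union>n. A n)"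
  have U: "U \<in> sets M" "U \<subseteq> B" using A by (auto simp: U_def)
  have lim: "(\<lambda>n. measure M (A n)) \<longlonglongrightarrow> measure M U"
    unfolding U_def using A inc by (intro finite_Lim_measure_incseq) auto
  have Ule: "measure M U \<le> r" using lim A by (intro LIMSEQ_le_const2[OF lim]) auto
  have "measure M U = r"
  proof (rule ccontr)
    assume "measure M U \<noteq> r"
    then have lt: "measure M U < r" using Ule by simp
    have "measure M (B - U) = measure M B - measure M U" 
      using U B by (intro finite_measure_Diff) (auto simp: atom_free_def)
    then have "0 < measure M (B - U)" using lt r by simp
    moreover have "atom_free (B - U)" using B U by (intro atom_free_subset[OF B]) (auto simp: atom_free_def)
    ultimately obtain C where C: "C \<in> sets M" "C \<subseteq> B - U" "0 < measure M C" "measure M C < r - measure M U"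
      using atom_free_small_subset[of "B - U" "r - measure M U"] lt by auto
    have "measure M C \<le> 2 * measure M (d (A n))" for n
    proof (rule d(2))
      have "measure M (A n) \<le> measure M U" using U A by (intro finite_measure_mono) (auto simp: U_def)
      then show "feas (A n) C" using C by (auto simp: feas_def U_def)
    qed (use A in auto)
    moreover have "(\<lambda>n. measure M (d (A n))) \<longlonglongrightarrow> measure M U - measure M U"
      using tendsto_diff[OF LIMSEQ_Suc[OF lim] lim] step by simp
    then have "(\<lambda>n. 2 * measure M (d (A n))) \<longlonglongrightarrow> 2 * 0" by (intro tendsto_mult) auto
    ultimately have "measure M C \<le> 2 * 0" by (metis LIMSEQ_le_const)
    then show False using C by simp
  qed
  then show ?thesis using U by blast
qed

lemma set_integrable_of_integrable:
  fixes f :: "'a \<Rightarrow> 'b::{banach, second_countable_topology}"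
  shows "integrable M f \<Longrightarrow> A \<in> sets M \<Longrightarrow> set_integrable M A f"
  unfolding set_integrable_def by (rule integrable_mult_indicator)

lemma set_integral_Diff:
  fixes f :: "'a \<Rightarrow> 'b::{banach, second_countable_topology}"
  assumes "integrable M f" "A \<in> sets M" "B \<in> sets M" "A \<subseteq> B"
  shows "(LINT x:B - A|M. f x) = (LINT x:B|M. f x) - (LINT x:A|M. f x)"
proof -
  have "(LINT x:A \<union> (B - A)|M. f x) = (LINT x:A|M. f x) + (LINT x:B - A|M. f x)"
    using assms by (intro set_integral_Un set_integrable_of_integrable) auto
  moreover have "A \<union> (B - A) = B" using assms by auto
  ultimately show ?thesis by simp
qed

text \<open>Truncate \<open>\<bar>f\<bar>\<close> at a level \<open>n\<close> with small remainder.\<close>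

lemma set_integral_abs_continuous:
  fixes f :: "'a \<Rightarrow> real"
  assumes f: "integrable M f" and "0 < e"
  shows "\<exists>d>0. \<forall>A\<in>sets M. measure M A < d \<longrightarrow> \<bar>LINT x:A|M. f x\<bar> < e"
proof -
  have [measurable]: "f \<in> borel_measurable M" using f by simp
  have "(\<lambda>n. LINT x|M. \<bar>f x\<bar> - min \<bar>f x\<bar> (real n)) \<longlonglongrightarrow> (LINT x|M. 0)"
  proof (rule integral_dominated_convergence[where w = "\<lambda>x. \<bar>f x\<bar>"])
    show "AE x in M. (\<lambda>n. \<bar>f x\<bar> - min \<bar>f x\<bar> (real n)) \<longlonglongrightarrow> 0"
    proof (rule AE_I2)
      fix x
      obtain N where "\<bar>f x\<bar> \<le> real N" using real_arch_simple by blast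
      then have "\<forall>n\<ge>N. \<bar>f x\<bar> - min \<bar>f x\<bar> (real n) = 0" by auto
      then show "(\<lambda>n. \<bar>f x\<bar> - min \<bar>f x\<bar> (real n)) \<longlonglongrightarrow> 0"
        by (intro tendsto_eventually) (auto simp: eventually_sequentially)
    qed
  qed (use f in auto)
  then have "\<forall>\<^sub>F n in sequentially. (LINT x|M. \<bar>f x\<bar> - min \<bar>f x\<bar> (real n)) < e / 2"
    using \<open>0 < e\<close> by (intro order_tendstoD(2)) auto
  then obtain n where n: "(LINT x|M. \<bar>f x\<bar> - min \<bar>f x\<bar> (real n)) < e / 2"
    by (auto simp: eventually_sequentially)
  define h where "h x = \<bar>f x\<bar> - min \<bar>f x\<bar> (real n)" for x
  have h: "integrable M h" unfolding h_def using f by auto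
  show ?thesis
  proof (intro exI[of _ "e / 2 / (real n + 1)"] conjI ballI impI)
    fix A assume A: "A \<in> sets M" "measure M A < e / 2 / (real n + 1)"
    have iA: "integrable M (\<lambda>x. real n * indicator A x)"
      using A by (intro integrable_mult_right integrable_real_indicator) (auto simp: less_top[symmetric])
    have "\<bar>LINT x:A|M. f x\<bar> \<le> (LINT x:A|M. \<bar>f x\<bar>)"
      unfolding set_lebesgue_integral_def
      by (rule order_trans[OF integral_abs_bound]) (simp add: abs_mult)
    also have "\<dots> \<le> (LINT x|M. h x + real n * indicator A x)"
      unfolding set_lebesgue_integral_def
      using f A h iA by (intro integral_mono integrable_mult_indicator integrable_abs Bochner_Integration.integrable_add)
          (auto simp: h_def indicator_def)
    also have "\<dots> = (LINT x|M. h x) + real n * measure M A"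
      using h A iA by (subst Bochner_Integration.integral_add) auto
    also have "\<dots> < e / 2 + e / 2"
    proof -
      have "real n * measure M A \<le> (real n + 1) * measure M A" by (simp add: mult_right_mono)
      also have "\<dots> \<le> e / 2" using A(2) by (simp add: field_simps)
      finally show ?thesis using n h_def by simp
    qed
    finally show "\<bar>LINT x:A|M. f x\<bar> < e" by simp
  qed (use \<open>0 < e\<close> in auto)
qed

text \<open>Halving the gaps repeatedly gives sets indexed by dyadic numbers; unions of these fill in the
  real indices.\<close>

lemma halving_imp_chain:
  fixes F :: "('a \<Rightarrow> real) set"
  assumes F: "\<And>f. f \<in> F \<Longrightarrow> integrable M f"
    and half: "\<And>A. A \<in> sets M \<Longrightarrow> A \<subseteq> B \<Longrightarrow>
      \<exists>C\<in>sets M. C \<subseteq> A \<and> (\<forall>f\<in>F. (LINT x:C|M. f x) = (LINT x:A|M. f x) / 2)"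
    and A: "A \<in> sets M" "A \<subseteq> B"
  shows "\<exists>c. (\<forall>r. c r \<in> sets M \<and> c r \<subseteq> A) \<and> mono c \<and>
    (\<forall>r\<in>{0..1}. \<forall>f\<in>F. (LINT x:c r|M. f x) = r * (LINT x:A|M. f x))"
proof -
  let ?I = "\<lambda>f X. LINT x:X|M. f x"
  have "\<forall>X. \<exists>C. X \<in> sets M \<and> X \<subseteq> B \<longrightarrow> C \<in> sets M \<and> C \<subseteq> X \<and> (\<forall>f\<in>F. ?I f C = ?I f X / 2)"
    using half by blast
  then obtain h where h: "\<And>X. X \<in> sets M \<and> X \<subseteq> B \<longrightarrow> h X \<in> sets M \<and> h X \<subseteq> X \<and> (\<forall>f\<in>F. ?I f (h X) = ?I f X / 2)"
    by (elim choice[THEN exE]) blast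
  \<comment> \<open>\<open>D n k\<close> has index \<open>k / 2 ^ n\<close>\<close>
  define D :: "nat \<Rightarrow> nat \<Rightarrow> 'a set" where "D = rec_nat (\<lambda>k. if k = 0 then {} else A)
    (\<lambda>n Dn k. if even k then Dn (k div 2) else Dn (k div 2) \<union> h (Dn (k div 2 + 1) - Dn (k div 2)))"
  have D0: "D 0 k = (if k = 0 then {} else A)" for k :: nat by (simp add: D_def)
  have DS: "D (Suc n) k = (if even k then D n (k div 2) else D n (k div 2) \<union> h (D n (k div 2 + 1) - D n (k div 2)))"
    for n k by (simp add: D_def)
  have DA: "D n k \<in> sets M \<and> D n k \<subseteq> A \<and> D n k \<subseteq> D n (Suc k)" for n k
  proof (induction n arbitrary: k)
    case 0 then show ?case using A by (auto simp: D0)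
  next
    case (Suc n)
    let ?j = "k div 2"
    let ?X = "D n (?j + 1) - D n ?j"
    have X: "h ?X \<in> sets M \<and> h ?X \<subseteq> ?X"
      using h[of ?X] Suc[of ?j] Suc[of "?j + 1"] A by auto
    show ?case
    proof (cases "even k")
      case True
      then have "Suc k div 2 = ?j" by simp
      then show ?thesis using True Suc[of ?j] by (auto simp: DS)
    next
      case False
      then have "Suc k div 2 = ?j + 1" by simp
      then show ?thesis using False Suc[of ?j] Suc[of "?j + 1"] X by (auto simp: DS)
    qed
  qed
  have Dmono: "D n j \<subseteq> D n k" if "j \<le> k" for n j k
    using that by (rule lift_Suc_mono_le[of "D n", rotated]) (use DA in auto)
  have DI: "?I f (D n k) = real k / 2 ^ n * ?I f A" if "f \<in> F" "k \<le> 2 ^ n" for n k f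
    using that(2)
  proof (induction n arbitrary: k)
    case 0 then show ?case by (cases k) (auto simp: D0 set_lebesgue_integral_def)
  next
    case (Suc n)
    let ?j = "k div 2"
    show ?case
    proof (cases "even k")
      case True
      then show ?thesis using Suc.IH[of ?j] Suc.prems by (auto simp: DS elim!: evenE)
    next
      case False
      then obtain j where j: "k = 2 * j + 1" by (auto elim: oddE)
      then have j': "j + 1 \<le> 2 ^ n" using Suc.prems by simp
      let ?X = "D n (j + 1) - D n j"
      have X: "h ?X \<in> sets M" "h ?X \<subseteq> ?X" "?I f (h ?X) = ?I f ?X / 2"
        using h[of ?X] DA[of n j] DA[of n "j + 1"] A that(1) by auto
      have "?I f (D (Suc n) k) = ?I f (D n j \<union> h ?X)" using j by (simp add: DS)
      also have "\<dots> = ?I f (D n j) + ?I f (h ?X)"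
        using X DA F that(1) by (intro set_integral_Un set_integrable_of_integrable) auto
      also have "?I f ?X = ?I f (D n (j + 1)) - ?I f (D n j)"
        using DA F that(1) by (intro set_integral_Diff) auto
      then have "?I f (h ?X) = (?I f (D n (j + 1)) - ?I f (D n j)) / 2" using X by simp
      finally show ?thesis using Suc.IH[of j] Suc.IH[of "j + 1"] j' j by (simp add: field_simps)
    qed
  qed
  define c where "c r = (\<Union>n. D n (nat \<lfloor>r * 2 ^ n\<rfloor>))" for r :: real
  have inc: "incseq (\<lambda>n. D n (nat \<lfloor>r * 2 ^ n\<rfloor>))" for r :: real
  proof (rule incseq_SucI)
    fix n
    have "2 * nat \<lfloor>r * 2 ^ n\<rfloor> \<le> nat \<lfloor>r * 2 ^ Suc n\<rfloor>"
    proof (cases "r * 2 ^ n < 0")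
      case False
      then have "0 \<le> \<lfloor>r * 2 ^ n\<rfloor>" by simp
      have "2 * \<lfloor>r * 2 ^ n\<rfloor> \<le> \<lfloor>r * 2 ^ Suc n\<rfloor>"
        by (simp add: le_floor_iff)
      then show ?thesis using \<open>0 \<le> \<lfloor>r * 2 ^ n\<rfloor>\<close> by linarith
    qed auto
    moreover have "D n (nat \<lfloor>r * 2 ^ n\<rfloor>) = D (Suc n) (2 * nat \<lfloor>r * 2 ^ n\<rfloor>)" by (simp add: DS)
    ultimately show "D n (nat \<lfloor>r * 2 ^ n\<rfloor>) \<subseteq> D (Suc n) (nat \<lfloor>r * 2 ^ Suc n\<rfloor>)"
      using Dmono by metis
  qed
  show ?thesis
  proof (intro exI[of _ c] conjI allI ballI)
    show "c r \<in> sets M" "c r \<subseteq> A" for r using DA by (auto simp: c_def)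
    show "mono c"
    proof (rule monoI)
      fix r s :: real assume "r \<le> s"
      then have "nat \<lfloor>r * 2 ^ n\<rfloor> \<le> nat \<lfloor>s * 2 ^ n\<rfloor>" for n
        by (intro nat_mono floor_mono mult_right_mono) auto
      then show "c r \<subseteq> c s" using Dmono unfolding c_def by (intro UN_mono) auto
    qed
    fix r f assume r: "r \<in> {0..1::real}" and f: "f \<in> F"
    have "(\<lambda>n. ?I f (D n (nat \<lfloor>r * 2 ^ n\<rfloor>))) \<longlonglongrightarrow> ?I f (c r)"
      unfolding c_def using inc DA F[OF f]
      by (intro set_integral_cont_up set_integrable_of_integrable) auto
    moreover have "?I f (D n (nat \<lfloor>r * 2 ^ n\<rfloor>)) = real (nat \<lfloor>r * 2 ^ n\<rfloor>) / 2 ^ n * ?I f A" for n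
    proof (rule DI[OF f])
      have "r * 2 ^ n \<le> 1 * 2 ^ n" using r by (intro mult_right_mono) auto
      then have "r * 2 ^ n < 2 ^ n + 1" by linarith
      then have "\<lfloor>r * 2 ^ n\<rfloor> \<le> 2 ^ n" by (simp add: floor_le_iff)
      then show "nat \<lfloor>r * 2 ^ n\<rfloor> \<le> 2 ^ n" by (simp add: nat_le_iff)
    qed
    moreover have "(\<lambda>n. real (nat \<lfloor>r * 2 ^ n\<rfloor>) / 2 ^ n * ?I f A) \<longlonglongrightarrow> r * ?I f A"
    proof (intro tendsto_mult tendsto_const)
      show "(\<lambda>n. real (nat \<lfloor>r * 2 ^ n\<rfloor>) / 2 ^ n) \<longlonglongrightarrow> r"
      proof (rule real_tendsto_sandwich[of "\<lambda>n. r - (1/2) ^ n" _ _ "\<lambda>_. r"])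
        have "(\<lambda>n. r - (1/2) ^ n) \<longlonglongrightarrow> r - 0" by (intro tendsto_intros LIMSEQ_power_zero) auto
        then show "(\<lambda>n. r - (1/2) ^ n) \<longlonglongrightarrow> r" by simp
        have *: "real (nat \<lfloor>r * 2 ^ n\<rfloor>) = of_int \<lfloor>r * 2 ^ n\<rfloor>" for n using r by simp
        have "real (nat \<lfloor>r * 2 ^ n\<rfloor>) \<le> r * 2 ^ n" "r * 2 ^ n - 1 \<le> real (nat \<lfloor>r * 2 ^ n\<rfloor>)" for n
          unfolding * by linarith+
        then have "(r * 2 ^ n - 1) / 2 ^ n \<le> real (nat \<lfloor>r * 2 ^ n\<rfloor>) / 2 ^ n"
          "real (nat \<lfloor>r * 2 ^ n\<rfloor>) / 2 ^ n \<le> r * 2 ^ n / 2 ^ n" for n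
          by (intro divide_right_mono; simp)+
        then show "\<forall>\<^sub>F n in sequentially. r - (1/2) ^ n \<le> real (nat \<lfloor>r * 2 ^ n\<rfloor>) / 2 ^ n"
          "\<forall>\<^sub>F n in sequentially. real (nat \<lfloor>r * 2 ^ n\<rfloor>) / 2 ^ n \<le> r"
          by (simp_all add: diff_divide_distrib power_one_over)
      qed auto
    qed
    ultimately show "?I f (c r) = r * ?I f A" using LIMSEQ_unique by simp
  qed
qed

text \<open>Induction on the number of functions, by the intermediate value theorem (the idea of D. A. Ross).
  Let \<open>c\<close> be a chain for the functions treated so far. The window \<open>c (s + 1/2) - c s\<close> halves their
  integrals for every \<open>s\<close>. The integral of the new function \<open>g\<close> over the window depends continuously on
  \<open>s\<close>, and its values at \<open>s = 0\<close> and \<open>s = 1/2\<close> add up to the integral over the whole set, so half of it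
  is attained. The constant function is carried along since the continuity in \<open>s\<close> comes from the
  measures of the sets in the chain.\<close>

lemma lyapunov_halving:
  fixes F :: "('a \<Rightarrow> real) set"
  assumes B: "atom_free B" and "finite F" and F: "\<And>f. f \<in> F \<Longrightarrow> integrable M f"
    and A: "A \<in> sets M" "A \<subseteq> B"
  shows "\<exists>C\<in>sets M. C \<subseteq> A \<and>
     (\<forall>f\<in>insert (\<lambda>_. 1) F. (LINT x:C|M. f x) = (LINT x:A|M. f x) / 2)"
  using \<open>finite F\<close> F A
proof (induction F arbitrary: A rule: finite_induct)
  case empty
  have "(LINT x:X|M. (1::real)) = measure M X" if "X \<in> sets M" for X
    using that by (simp add: set_lebesgue_integral_def)
  then show ?case
    using atom_free_intermediate[OF atom_free_subset[OF B empty(2,3)], of "measure M A / 2"] empty by auto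
next
  case (insert g F)
  let ?I = "\<lambda>f X. LINT x:X|M. f x"
  let ?F = "insert (\<lambda>_. 1) F"
  have F: "integrable M f" if "f \<in> ?F" for f using insert.prems that by auto
  have g: "integrable M g" using insert.prems by auto
  obtain c where c: "\<And>r. c r \<in> sets M" "\<And>r. c r \<subseteq> A" and cm: "mono c"
    and cI: "\<And>r f. r \<in> {0..1} \<Longrightarrow> f \<in> ?F \<Longrightarrow> ?I f (c r) = r * ?I f A"
  proof -
    have "\<exists>C\<in>sets M. C \<subseteq> X \<and> (\<forall>f\<in>?F. ?I f C = ?I f X / 2)" if "X \<in> sets M" "X \<subseteq> B" for X
      using insert.prems(1) that by (intro insert.IH) auto
    from halving_imp_chain[of ?F B A, OF F this insert.prems(2,3)] show ?thesis using that by blast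
  qed
  have m: "?I (\<lambda>_. 1) X = measure M X" if "X \<in> sets M" for X
    using that by (simp add: set_lebesgue_integral_def)
  have cmeas: "measure M (c r) = r * measure M A" if "r \<in> {0..1}" for r
    using cI[OF that, of "\<lambda>_. 1"] c insert.prems by (simp add: m)
  have null: "?I g X = 0" if "X \<in> sets M" "measure M X = 0" for X
  proof -
    have "X \<in> null_sets M" using that by (auto simp: emeasure_eq_measure)
    then have "AE x in M. x \<notin> X" by (rule AE_not_in)
    then have "AE x in M. indicator X x *\<^sub>R g x = 0" by eventually_elim simp
    then show ?thesis unfolding set_lebesgue_integral_def by (rule integral_eq_zero_AE)
  qed
  have Ig0: "?I g (c 0) = 0" using c cmeas[of 0] by (intro null) auto
  have Ig1: "?I g (c 1) = ?I g A"
  proof -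
    have "measure M (A - c 1) = 0"
      using finite_measure_Diff[of A "c 1"] c insert.prems cmeas[of 1] by simp
    then have "?I g (A - c 1) = 0" using c insert.prems by (intro null) auto
    then show ?thesis using set_integral_Diff[OF g, of "c 1" A] c insert.prems by simp
  qed
  have cont: "continuous_on {0..1} (\<lambda>r. ?I g (c r))"
    unfolding continuous_on_iff
  proof (intro ballI allI impI)
    fix r e :: real assume r: "r \<in> {0..1}" and "0 < e"
    obtain d where d: "d > 0" "\<And>X. X \<in> sets M \<Longrightarrow> measure M X < d \<Longrightarrow> \<bar>?I g X\<bar> < e"
      using set_integral_abs_continuous[OF g \<open>0 < e\<close>] by blast
    have main: "\<bar>?I g (c t) - ?I g (c s)\<bar> < e" if "s \<in> {0..1}" "t \<in> {0..1}" "s \<le> t" "(t - s) * measure M A < d" for s t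
    proof -
      have sub: "c s \<subseteq> c t" using cm that by (simp add: monoD)
      have "measure M (c t - c s) = (t - s) * measure M A"
        using finite_measure_Diff[OF c(1) c(1) sub] cmeas that by (simp add: algebra_simps)
      then have "\<bar>?I g (c t - c s)\<bar> < e" using d c that by simp
      then show ?thesis using set_integral_Diff[OF g c(1) c(1) sub] by simp
    qed
    have pos: "0 < measure M A + 1" by (simp add: add_nonneg_pos)
    show "\<exists>d>0. \<forall>s\<in>{0..1}. dist s r < d \<longrightarrow> dist (?I g (c s)) (?I g (c r)) < e"
    proof (intro exI[of _ "d / (measure M A + 1)"] conjI ballI impI)
      fix s assume s: "s \<in> {0..1::real}" "dist s r < d / (measure M A + 1)"
      then have "\<bar>s - r\<bar> * (measure M A + 1) < d" using pos by (simp add: dist_real_def field_simps)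
      then have *: "\<bar>s - r\<bar> * measure M A < d" using abs_ge_zero[of "s - r"] by (simp add: algebra_simps)
      show "dist (?I g (c s)) (?I g (c r)) < e"
        using main[of s r] main[of r s] s r * by (cases "s \<le> r") (auto simp: dist_real_def abs_minus_commute)
    qed (use d pos in auto)
  qed
  define W where "W s = c (s + 1/2) - c s" for s :: real
  have IW: "?I f (W s) = ?I f (c (s + 1/2)) - ?I f (c s)" if "integrable M f" for f :: "'a \<Rightarrow> real" and s
    unfolding W_def using that c cm by (intro set_integral_Diff) (auto simp: monoD)
  have contW: "continuous_on {0..1/2} (\<lambda>s. ?I g (c (s + 1/2)) - ?I g (c s))"
  proof (intro continuous_intros)
    show "continuous_on {0..1/2} (\<lambda>s. ?I g (c (s + 1/2)))"
      by (rule continuous_on_compose2[OF cont, of _ "\<lambda>s. s + 1/2"]) (auto intro!: continuous_intros)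
    show "continuous_on {0..1/2} (\<lambda>s. ?I g (c s))" by (rule continuous_on_subset[OF cont]) auto
  qed
  let ?w = "\<lambda>s. ?I g (c (s + 1/2)) - ?I g (c s)"
  have w: "?w 0 + ?w (1/2) = ?I g A" using Ig0 Ig1 by simp
  have "\<exists>s\<in>{0..1/2}. ?w s = ?I g A / 2"
  proof (cases "?w 0 \<le> ?I g A / 2")
    case True
    then have "\<exists>s\<ge>0. s \<le> 1/2 \<and> ?w s = ?I g A / 2" using w contW by (intro IVT') auto
    then show ?thesis by auto
  next
    case False
    then have "\<exists>s\<ge>0. s \<le> 1/2 \<and> ?w s = ?I g A / 2" using w contW by (intro IVT2') auto
    then show ?thesis by auto
  qed
  then obtain s where s: "s \<in> {0..1/2}" "?w s = ?I g A / 2" by blast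
  show ?case
  proof (intro bexI[of _ "W s"] conjI ballI)
    fix f assume "f \<in> insert (\<lambda>_. 1) (insert g F)"
    then consider "f = g" | "f \<in> ?F" by blast
    then show "?I f (W s) = ?I f A / 2"
    proof cases
      case 1 then show ?thesis using s IW g by simp
    next
      case 2
      then have "?I f (W s) = (s + 1/2) * ?I f A - s * ?I f A" using IW[OF F] cI s by simp
      then show ?thesis by (simp add: algebra_simps)
    qed
  qed (use c in \<open>auto simp: W_def\<close>)
qed

theorem lyapunov:
  fixes f :: "'a \<Rightarrow> 'b::euclidean_space"
  assumes B: "atom_free B" and f: "integrable M f" and r: "r \<in> {0..1}"
  shows "\<exists>C\<in>sets M. C \<subseteq> B \<and> (LINT x:C|M. f x) = r *\<^sub>R (LINT x:B|M. f x)"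
proof -
  let ?F = "insert (\<lambda>_. 1) ((\<lambda>b x. f x \<bullet> b) ` Basis)"
  have B': "B \<in> sets M" using B by (simp add: atom_free_def)
  have int: "g \<in> ?F \<Longrightarrow> integrable M g" for g using f by auto
  obtain c where c: "\<And>r. c r \<in> sets M" "\<And>r. c r \<subseteq> B"
    and cI: "\<And>r g. r \<in> {0..1} \<Longrightarrow> g \<in> ?F \<Longrightarrow> (LINT x:c r|M. g x) = r * (LINT x:B|M. g x)"
  proof -
    have "\<exists>C\<in>sets M. C \<subseteq> A \<and> (\<forall>g\<in>?F. (LINT x:C|M. g x) = (LINT x:A|M. g x) / 2)"
      if "A \<in> sets M" "A \<subseteq> B" for A
      using int that by (intro lyapunov_halving[OF B]) auto
    from halving_imp_chain[of ?F B B, OF int this B' order_refl] show ?thesis using that by blast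
  qed
  have inner: "(LINT x:X|M. f x) \<bullet> b = (LINT x:X|M. f x \<bullet> b)" if "X \<in> sets M" for X b
    unfolding set_lebesgue_integral_def
    using integrable_mult_indicator[OF that f] by (subst integral_inner_left[symmetric]) auto
  show ?thesis
  proof (intro bexI[of _ "c r"] conjI)
    show "(LINT x:c r|M. f x) = r *\<^sub>R (LINT x:B|M. f x)"
    proof (rule euclidean_eqI)
      fix b :: 'b assume "b \<in> Basis"
      then have "(LINT x:c r|M. f x \<bullet> b) = r * (LINT x:B|M. f x \<bullet> b)" by (intro cI[OF r]) auto
      then show "(LINT x:c r|M. f x) \<bullet> b = r *\<^sub>R (LINT x:B|M. f x) \<bullet> b"
        by (simp only: inner[OF c(1)] inner[OF B'] inner_scaleR_left)
    qed
  qed (use c in auto)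
qed

text \<open>Null sets count as atoms, so every countable family of atoms can be written as a sequence.\<close>

definition atom :: "'a set \<Rightarrow> bool" where
  "atom A \<longleftrightarrow> A \<in> sets M \<and> (\<forall>C\<in>sets M. C \<subseteq> A \<longrightarrow> measure M C = 0 \<or> measure M C = measure M A)"

text \<open>Take a countable union of atoms of maximal measure. An atom in the remainder could be added to
  it.\<close>

lemma atomic_decomposition:
  "\<exists>A :: nat \<Rightarrow> 'a set. (\<forall>i. atom (A i)) \<and> atom_free (space M - (\<Union>i. A i))"
proof -
  define V where "V = {measure M (\<Union>i. A i) | A :: nat \<Rightarrow> 'a set. \<forall>i. atom (A i)}"
  have atom_empty: "atom {}" by (simp add: atom_def)
  have "measure M (\<Union>i. {} :: 'a set) \<in> V"
    unfolding V_def mem_Collect_eq by (rule exI[of _ "\<lambda>_. {}"]) (use atom_empty in simp)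
  moreover have "bdd_above V"
    by (auto simp: V_def bdd_above_def intro!: exI[of _ "measure M (space M)"] bounded_measure)
  ultimately have V: "V \<noteq> {}" "bdd_above V" by blast+
  have "\<forall>n. \<exists>A :: nat \<Rightarrow> 'a set. (\<forall>i. atom (A i)) \<and> Sup V - 1 / Suc n < measure M (\<Union>i. A i)"
  proof
    fix n
    have "Sup V - 1 / Suc n < Sup V" by simp
    then obtain v where "v \<in> V" "Sup V - 1 / Suc n < v" using V less_cSup_iff by blast
    then show "\<exists>A :: nat \<Rightarrow> 'a set. (\<forall>i. atom (A i)) \<and> Sup V - 1 / Suc n < measure M (\<Union>i. A i)"
      by (auto simp: V_def)
  qed
  then obtain A :: "nat \<Rightarrow> nat \<Rightarrow> 'a set" where A: "\<And>n i. atom (A n i)"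
    "\<And>n. Sup V - 1 / Suc n < measure M (\<Union>i. A n i)" by metis
  \<comment> \<open>the supremum is attained by joining a maximizing sequence of families\<close>
  define A' where "A' k = (case prod_decode k of (n, i) \<Rightarrow> A n i)" for k
  define U where "U = (\<Union>k. A' k)"
  have A': "atom (A' k)" for k using A by (auto simp: A'_def split: prod.split)
  then have U: "U \<in> sets M" by (auto simp: U_def atom_def)
  have sub: "(\<Union>i. A n i) \<subseteq> U" for n
  proof
    fix x assume "x \<in> (\<Union>i. A n i)"
    then obtain i where "x \<in> A n i" by blast
    then have "x \<in> A' (prod_encode (n, i))" by (simp add: A'_def)
    then show "x \<in> U" by (auto simp: U_def)
  qed
  have "Sup V \<le> measure M U"
  proof (rule field_le_epsilon)
    fix e :: real assume "e > 0"
    then obtain n where n: "1 / Suc n < e" using nat_approx_posE by blast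
    have "measure M (\<Union>i. A n i) \<le> measure M U" using U sub by (intro finite_measure_mono) auto
    then show "Sup V \<le> measure M U + e" using A(2)[of n] n by linarith
  qed
  have "atom_free (space M - U)"
    unfolding atom_free_def
  proof (intro conjI ballI impI)
    fix X assume X: "X \<in> sets M" "X \<subseteq> space M - U" "0 < measure M X"
    show "\<exists>C\<in>sets M. C \<subseteq> X \<and> 0 < measure M C \<and> measure M C < measure M X"
    proof (rule ccontr)
      assume no: "\<not> ?thesis"
      have "atom X" unfolding atom_def
      proof (intro conjI ballI impI)
        fix C assume C: "C \<in> sets M" "C \<subseteq> X"
        then have "measure M C \<le> measure M X" using X by (intro finite_measure_mono)
        moreover have "\<not> (0 < measure M C \<and> measure M C < measure M X)" using no C by blast
        ultimately show "measure M C = 0 \<or> measure M C = measure M X"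
          using measure_nonneg[of M C] by linarith
      qed (rule X)
      then have "measure M (\<Union>k. case_nat X A' k) \<in> V"
        using A' by (auto simp: V_def split: nat.split)
      moreover have "(\<Union>k. case_nat X A' k) = U \<union> X"
        unfolding U_def by (auto split: nat.splits)
      moreover have "measure M (U \<union> X) = measure M U + measure M X"
        using U X by (intro finite_measure_Union) auto
      ultimately show False using cSup_upper[OF _ V(2)] \<open>Sup V \<le> measure M U\<close> X(3) by fastforce
    qed
  qed (use U in auto)
  then show ?thesis using A' U_def by blast
qed

text \<open>The set where a real function exceeds its mean on the atom is null or has full measure in the
  atom, and the latter contradicts the mean value.\<close>

lemma atom_AE_const:
  fixes f :: "'a \<Rightarrow> 'b::euclidean_space"
  assumes A: "atom A" and f: "integrable M f"
  shows "AE x in M. x \<in> A \<longrightarrow> f x = (LINT x:A|M. f x) /\<^sub>R measure M A"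
proof (cases "measure M A = 0")
  case True
  then have "A \<in> null_sets M" using A by (auto simp: atom_def emeasure_eq_measure)
  then have "AE x in M. x \<notin> A" by (rule AE_not_in)
  then show ?thesis by eventually_elim simp
next
  case False
  then have pos: "0 < measure M A" using measure_nonneg[of M A] by linarith
  have A': "A \<in> sets M" using A by (simp add: atom_def)
  have le: "AE x in M. x \<in> A \<longrightarrow> g x \<le> (LINT x:A|M. g x) / measure M A" if g: "integrable M g" for g :: "'a \<Rightarrow> real"
  proof -
    have [measurable]: "g \<in> borel_measurable M" "A \<in> sets M" using g A' by auto
    let ?c = "(LINT x:A|M. g x) / measure M A"
    let ?X = "{x \<in> space M. x \<in> A \<and> ?c < g x}"
    have X: "?X \<in> sets M" by measurable
    have "measure M ?X = 0"
    proof (rule ccontr)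
      assume "measure M ?X \<noteq> 0"
      moreover have "?X \<subseteq> A" by auto
      ultimately have eq: "measure M ?X = measure M A" using A X unfolding atom_def by blast
      have "measure M (A - ?X) = 0"
        using finite_measure_Diff[OF A' X] eq by auto
      then have "A - ?X \<in> null_sets M" using A' X by (auto simp: emeasure_eq_measure)
      then have "AE x in M. x \<notin> A - ?X" by (rule AE_not_in)
      then have AE: "AE x in M. x \<in> A \<longrightarrow> ?c < g x"
        by (rule AE_mp) (use sets.sets_into_space[OF A'] in auto)
      have i: "integrable M (\<lambda>x. indicator A x *\<^sub>R (g x - ?c))"
        using g A' by (intro integrable_mult_indicator) auto
      have "(LINT x|M. indicator A x *\<^sub>R (g x - ?c)) = (LINT x:A|M. g x) - ?c * measure M A"
      proof -
        have "(LINT x:A|M. g x - ?c) = (LINT x:A|M. g x) - (LINT x:A|M. ?c)"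
          using g A' by (intro set_integral_diff set_integrable_of_integrable) auto
        also have "(LINT x:A|M. ?c) = ?c * measure M A" 
          using A' by (simp add: set_lebesgue_integral_def)
        finally show ?thesis by (simp add: set_lebesgue_integral_def)
      qed
      also have "\<dots> = 0" using pos by simp
      finally have zero: "(LINT x|M. indicator A x *\<^sub>R (g x - ?c)) = 0" .
      have "AE x in M. 0 \<le> indicator A x *\<^sub>R (g x - ?c)"
        using AE by eventually_elim (auto simp: indicator_def)
      from integral_nonneg_eq_0_iff_AE[OF i this] zero
      have "AE x in M. indicator A x *\<^sub>R (g x - ?c) = 0" by blast
      with AE have "AE x in M. x \<notin> A" by eventually_elim (auto simp: indicator_def)
      then have "A \<in> null_sets M" using A' AE_iff_null_sets by blast
      then show False using pos by (auto simp: measure_eq_emeasure_eq_ennreal null_setsD1 measure_def)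
    qed
    then have "?X \<in> null_sets M" using X by (auto simp: emeasure_eq_measure)
    then have "AE x in M. x \<notin> ?X" by (rule AE_not_in)
    then show ?thesis by (rule AE_mp) (use sets.sets_into_space[OF A'] in auto)
  qed
  have "AE x in M. \<forall>b\<in>Basis. x \<in> A \<longrightarrow> f x \<bullet> b = ((LINT x:A|M. f x) /\<^sub>R measure M A) \<bullet> b"
  proof (rule AE_finite_allI)
    fix b :: 'b assume "b \<in> Basis"
    have inner: "(LINT x:A|M. f x) \<bullet> b = (LINT x:A|M. f x \<bullet> b)"
      unfolding set_lebesgue_integral_def
      using integrable_mult_indicator[OF A' f] by (subst integral_inner_left[symmetric]) auto
    have uminus: "(LINT x:A|M. - (f x \<bullet> b)) = - (LINT x:A|M. f x \<bullet> b)"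
      using f A' by (intro set_integral_uminus set_integrable_of_integrable) auto
    have "AE x in M. x \<in> A \<longrightarrow> f x \<bullet> b \<le> (LINT x:A|M. f x \<bullet> b) / measure M A" using f by (intro le) auto
    moreover have "AE x in M. x \<in> A \<longrightarrow> - (f x \<bullet> b) \<le> (LINT x:A|M. - (f x \<bullet> b)) / measure M A" using f by (intro le) auto
    ultimately show "AE x in M. x \<in> A \<longrightarrow> f x \<bullet> b = ((LINT x:A|M. f x) /\<^sub>R measure M A) \<bullet> b"
      by eventually_elim (auto simp: inner uminus divide_inverse mult.commute)
  qed simp
  then show ?thesis by eventually_elim (auto intro: euclidean_eqI)
qed

end

section \<open>Fatou's lemma in Euclidean space\<close>

text \<open>The indices only satisfy \<open>j \<le> k j\<close>; this is easier to maintain than strict monotonicity when they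
  are chosen measurably as functions of a parameter.\<close>

definition cluster_points :: "(nat \<Rightarrow> 'a::topological_space) \<Rightarrow> 'a set" where
  "cluster_points s = {x. \<exists>k. (\<forall>j. j \<le> k j) \<and> (\<lambda>j. s (k j)) \<longlonglongrightarrow> x}"

lemma cluster_pointsI: "(\<And>j. j \<le> k j) \<Longrightarrow> (\<lambda>j. s (k j)) \<longlonglongrightarrow> x \<Longrightarrow> x \<in> cluster_points s"
  unfolding cluster_points_def by blast

lemma cluster_points_reindex:
  assumes "x \<in> cluster_points (\<lambda>k. s (r k))" "\<And>j. j \<le> r j"
  shows "x \<in> cluster_points s"
proof -
  obtain k where k: "\<And>j. j \<le> k j" "(\<lambda>j. s (r (k j))) \<longlonglongrightarrow> x"
    using assms(1) by (auto simp: cluster_points_def)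
  then show ?thesis using assms(2) by (intro cluster_pointsI[of "\<lambda>j. r (k j)"]) (auto intro: order_trans)
qed

lemma filterlim_at_top_ge: "(\<And>j. j \<le> k j) \<Longrightarrow> filterlim k at_top sequentially" for k :: "nat \<Rightarrow> nat"
  by (rule filterlim_at_top_mono[OF filterlim_ident]) auto

lemma cluster_points_convergent:
  fixes s :: "nat \<Rightarrow> 'a::t2_space"
  assumes "s \<longlonglongrightarrow> y" "x \<in> cluster_points s"
  shows "x = y"
proof -
  obtain k where k: "\<And>j. j \<le> k j" "(\<lambda>j. s (k j)) \<longlonglongrightarrow> x"
    using assms(2) by (auto simp: cluster_points_def)
  have "(\<lambda>j. s (k j)) \<longlonglongrightarrow> y"
    using assms(1) filterlim_at_top_ge[OF k(1)] by (rule filterlim_compose)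
  then show ?thesis using k LIMSEQ_unique by blast
qed

lemma cluster_points_map:
  fixes s :: "nat \<Rightarrow> 'a::t2_space"
  assumes "x \<in> cluster_points s" "isCont g x"
  shows "g x \<in> cluster_points (\<lambda>k. g (s k))"
  using assms isCont_tendsto_compose unfolding cluster_points_def by blast

lemma cluster_points_norm_le:
  fixes s :: "nat \<Rightarrow> 'a::real_normed_vector"
  assumes "x \<in> cluster_points s" "\<And>k. norm (s k) \<le> c"
  shows "norm x \<le> c"
proof -
  obtain k where k: "(\<lambda>j. s (k j)) \<longlonglongrightarrow> x"
    using assms(1) by (auto simp: cluster_points_def)
  show ?thesis by (rule LIMSEQ_le_const2[OF tendsto_norm[OF k]]) (use assms(2) in auto)
qed

text \<open>The least index at which the sequence is close to its upper limit is a measurable function of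
  \<open>x\<close>.\<close>

lemma random_subsequence_limsup:
  fixes s :: "nat \<Rightarrow> 'a \<Rightarrow> real"
  assumes s [measurable]: "\<And>k. s k \<in> borel_measurable M"
    and bound: "\<And>k x. x \<in> space M \<Longrightarrow> \<bar>s k x\<bar> \<le> c x"
  shows "\<exists>m L. (\<forall>j. m j \<in> M \<rightarrow>\<^sub>M count_space UNIV) \<and> (\<forall>j x. x \<in> space M \<longrightarrow> j \<le> m j x) \<and>
     L \<in> borel_measurable M \<and>
     (\<forall>x\<in>space M. (\<lambda>j. s (m j x) x) \<longlonglongrightarrow> L x \<and> (\<forall>e>0. \<forall>\<^sub>F k in sequentially. s k x < L x + e))"
proof -
  define L where "L x = real_of_ereal (limsup (\<lambda>k. ereal (s k x)))" for x
  have L [measurable]: "L \<in> borel_measurable M" unfolding L_def by measurable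
  have lim: "limsup (\<lambda>k. ereal (s k x)) = ereal (L x)" if "x \<in> space M" for x
  proof -
    have "limsup (\<lambda>k. ereal (s k x)) \<le> ereal (c x)"
      using bound[OF that] by (intro Limsup_bounded) (auto simp: abs_le_iff)
    moreover have "ereal (- c x) \<le> limsup (\<lambda>k. ereal (s k x))"
      using bound[OF that] by (intro le_Limsup) (auto simp: abs_le_iff minus_le_iff)
    ultimately show ?thesis unfolding L_def by (cases "limsup (\<lambda>k. ereal (s k x))") auto
  qed
  have ex: "\<exists>m\<ge>j. \<bar>s m x - L x\<bar> < 1 / Suc j" if "x \<in> space M" for x j
  proof -
    note limx = lim[OF that]
    obtain r :: "nat \<Rightarrow> nat" where r: "strict_mono r" "((\<lambda>k. ereal (s k x)) \<circ> r) \<longlonglongrightarrow> ereal (L x)"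
      using limsup_subseq_lim[of "\<lambda>k. ereal (s k x)"] limx by metis
    then have "(\<lambda>k. s (r k) x) \<longlonglongrightarrow> L x" by (simp add: o_def)
    then have "\<forall>\<^sub>F k in sequentially. dist (s (r k) x) (L x) < 1 / Suc j"
      by (rule tendstoD) simp
    then obtain k where k: "\<And>i. i \<ge> k \<Longrightarrow> dist (s (r i) x) (L x) < 1 / Suc j"
      by (auto simp: eventually_sequentially)
    show ?thesis
      using k[of "max k j"] seq_suble[OF r(1), of "max k j"] by (intro exI[of _ "r (max k j)"]) (auto simp: dist_real_def)
  qed
  define m where "m j x = (LEAST m. j \<le> m \<and> \<bar>s m x - L x\<bar> < 1 / Suc j)" for j x
  have m: "j \<le> m j x" "\<bar>s (m j x) x - L x\<bar> < 1 / Suc j" if "x \<in> space M" for j x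
    using LeastI_ex[OF ex[OF that, of j, unfolded]] unfolding m_def by blast+
  show ?thesis
  proof (intro exI[of _ m] exI[of _ L] conjI allI ballI impI)
    show "m j \<in> M \<rightarrow>\<^sub>M count_space UNIV" for j unfolding m_def by measurable
    show "(\<lambda>j. s (m j x) x) \<longlonglongrightarrow> L x" if "x \<in> space M" for x
    proof (rule LIM_zero_cancel, rule tendsto_rabs_zero_cancel, rule tendsto_sandwich[of "\<lambda>_. 0"])
      show "(\<lambda>j. 1 / real (Suc j)) \<longlonglongrightarrow> 0" by (rule lim_1_over_n[THEN LIMSEQ_Suc])
    qed (use m[OF that] in \<open>auto intro!: always_eventually less_imp_le\<close>)
    show "\<forall>\<^sub>F k in sequentially. s k x < L x + e" if "x \<in> space M" "0 < e" for x e
    proof -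
      have "limsup (\<lambda>k. ereal (s k x)) < ereal (L x + e)" using that lim by simp
      from Limsup_lessD[OF this] show ?thesis by simp
    qed
  qed (use m in auto)
qed

lemma measurable_random_index:
  fixes y :: "nat \<Rightarrow> 'a \<Rightarrow> 'b::topological_space"
  assumes "\<And>k. y k \<in> borel_measurable M" "n \<in> M \<rightarrow>\<^sub>M count_space UNIV"
  shows "(\<lambda>x. y (n x) x) \<in> borel_measurable M"
  using assms by (rule measurable_compose_countable)

text \<open>One coordinate after the other, each time passing to a further measurable subsequence.\<close>

lemma random_subsequence_convergent:
  fixes y :: "nat \<Rightarrow> 'a \<Rightarrow> 'b::euclidean_space"
  assumes y: "\<And>k. y k \<in> borel_measurable M"
    and bound: "\<And>k x. x \<in> space M \<Longrightarrow> norm (y k x) \<le> c x"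
    and "finite B"
  shows "\<exists>n. (\<forall>j. n j \<in> M \<rightarrow>\<^sub>M count_space UNIV) \<and> (\<forall>j x. x \<in> space M \<longrightarrow> j \<le> n j x) \<and>
    (\<forall>x\<in>space M. \<forall>b\<in>B. convergent (\<lambda>j. y (n j x) x \<bullet> b))"
  using \<open>finite B\<close>
proof (induction B)
  case empty
  show ?case by (intro exI[of _ "\<lambda>j x. j"]) auto
next
  case (insert b B)
  from insert.IH obtain n where n0: "\<forall>j. n j \<in> M \<rightarrow>\<^sub>M count_space UNIV" "\<forall>j x. x \<in> space M \<longrightarrow> j \<le> n j x"
    "\<forall>x\<in>space M. \<forall>b\<in>B. convergent (\<lambda>j. y (n j x) x \<bullet> b)" by (elim exE conjE)
  have n: "n j \<in> M \<rightarrow>\<^sub>M count_space UNIV" "x \<in> space M \<Longrightarrow> j \<le> n j x"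
    "x \<in> space M \<Longrightarrow> b' \<in> B \<Longrightarrow> convergent (\<lambda>j. y (n j x) x \<bullet> b')" for j x b'
    using n0 by simp_all
  define s where "s j x = y (n j x) x \<bullet> b" for j x
  have [measurable]: "(\<lambda>x. y (n j x) x) \<in> borel_measurable M" for j
    using y n(1) by (rule measurable_random_index)
  have s: "s j \<in> borel_measurable M" for j unfolding s_def by measurable
  have "\<bar>s j x\<bar> \<le> c x * norm b" if "x \<in> space M" for j x
    unfolding s_def using bound[OF that]
    by (metis Cauchy_Schwarz_ineq2 order_trans mult_right_mono norm_ge_zero)
  from random_subsequence_limsup[of s M "\<lambda>x. c x * norm b", OF s this] obtain m L where
    m: "\<And>j. m j \<in> M \<rightarrow>\<^sub>M count_space UNIV" "\<And>j x. x \<in> space M \<Longrightarrow> j \<le> m j x"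
    and L: "\<And>x. x \<in> space M \<Longrightarrow> (\<lambda>j. s (m j x) x) \<longlonglongrightarrow> L x" by blast
  show ?case
  proof (intro exI[of _ "\<lambda>j x. n (m j x) x"] conjI allI ballI impI)
    show "(\<lambda>x. n (m j x) x) \<in> M \<rightarrow>\<^sub>M count_space UNIV" for j
      using n(1) m(1) by (rule measurable_compose_countable)
    show "j \<le> n (m j x) x" if "x \<in> space M" for j x using n(2) m(2) that order_trans by blast
    fix x b' assume x: "x \<in> space M" and b': "b' \<in> insert b B"
    show "convergent (\<lambda>j. y (n (m j x) x) x \<bullet> b')"
    proof (cases "b' = b")
      case True then show ?thesis using L[OF x] by (auto simp: s_def convergent_def)
    next
      case False
      then obtain l where "(\<lambda>j. y (n j x) x \<bullet> b') \<longlonglongrightarrow> l" using n(3)[OF x] b' by (auto simp: convergent_def)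
      from filterlim_compose[OF this filterlim_at_top_ge[of "\<lambda>j. m j x"]] m(2)[OF x]
      show ?thesis by (auto simp: convergent_def)
    qed
  qed
qed

lemma measurable_cluster_selection:
  fixes y :: "nat \<Rightarrow> 'a \<Rightarrow> 'b::euclidean_space"
  assumes y: "\<And>k. y k \<in> borel_measurable M"
    and bound: "\<And>k x. x \<in> space M \<Longrightarrow> norm (y k x) \<le> c x"
  shows "\<exists>f\<in>borel_measurable M. \<forall>x\<in>space M. f x \<in> cluster_points (\<lambda>k. y k x)"
proof -
  obtain n where n: "\<And>j. n j \<in> M \<rightarrow>\<^sub>M count_space UNIV" "\<And>j x. x \<in> space M \<Longrightarrow> j \<le> n j x"
    "\<And>x b. x \<in> space M \<Longrightarrow> b \<in> Basis \<Longrightarrow> convergent (\<lambda>j. y (n j x) x \<bullet> b)"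
    using random_subsequence_convergent[of y M c, OF y bound finite_Basis] by blast
  define f where "f x = (\<Sum>b\<in>Basis. lim (\<lambda>j. y (n j x) x \<bullet> b) *\<^sub>R b)" for x
  have lim: "(\<lambda>j. y (n j x) x) \<longlonglongrightarrow> f x" if "x \<in> space M" for x
  proof -
    have "(\<lambda>j. \<Sum>b\<in>Basis. (y (n j x) x \<bullet> b) *\<^sub>R b) \<longlonglongrightarrow> f x"
      unfolding f_def using n(3)[OF that]
      by (intro tendsto_sum tendsto_scaleR tendsto_const) (simp add: convergent_LIMSEQ_iff)
    then show ?thesis by (simp add: euclidean_representation)
  qed
  show ?thesis
  proof (intro bexI[of _ f] ballI)
    show "f x \<in> cluster_points (\<lambda>k. y k x)" if "x \<in> space M" for x
      using n(2)[OF that] lim[OF that] by (intro cluster_pointsI[of "\<lambda>j. n j x"]) auto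
    show "f \<in> borel_measurable M"
      by (rule borel_measurable_LIMSEQ_metric[OF measurable_random_index[OF y n(1)] lim])
  qed
qed

text \<open>The positive parts of \<open>s k - L\<close> tend to \<open>0\<close> pointwise and are dominated, hence their integrals
  tend to \<open>0\<close>. If in addition the integrals of \<open>s k\<close> tend to that of \<open>L\<close>, then so do the integrals of
  the negative parts, and convergence in the mean gives a subsequence that converges almost
  everywhere.\<close>

lemma (in finite_measure) fatou_scalar:
  fixes s :: "nat \<Rightarrow> 'a \<Rightarrow> real"
  assumes s [measurable]: "\<And>k. s k \<in> borel_measurable M" and l: "integrable M l"
    and bound: "\<And>k x. x \<in> space M \<Longrightarrow> \<bar>s k x\<bar> \<le> l x"
    and L [measurable]: "L \<in> borel_measurable M"
    and Ll: "\<And>x. x \<in> space M \<Longrightarrow> \<bar>L x\<bar> \<le> l x"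
    and up: "\<And>x e. x \<in> space M \<Longrightarrow> 0 < e \<Longrightarrow> \<forall>\<^sub>F k in sequentially. s k x < L x + e"
    and lim: "(\<lambda>k. LINT x|M. s k x) \<longlonglongrightarrow> V"
  shows "V \<le> (LINT x|M. L x)"
    and "V = (LINT x|M. L x) \<Longrightarrow> \<exists>r. strict_mono r \<and> (AE x in M. (\<lambda>k. s (r k) x) \<longlonglongrightarrow> L x)"
proof -
  have l2: "integrable M (\<lambda>x. 2 * l x)" using l by simp
  have i_s: "integrable M (s k)" for k
    by (rule Bochner_Integration.integrable_bound[OF l]) (use bound in \<open>auto intro!: AE_I2 order_trans[OF bound]\<close>)
  have iL: "integrable M L"
    by (rule Bochner_Integration.integrable_bound[OF l]) (use Ll in \<open>auto intro!: AE_I2 order_trans[OF Ll]\<close>)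
  have pos: "(\<lambda>k. LINT x|M. max 0 (s k x - L x)) \<longlonglongrightarrow> (LINT x|M. 0)"
  proof (rule integral_dominated_convergence[where w = "\<lambda>x. 2 * l x"])
    show "AE x in M. (\<lambda>k. max 0 (s k x - L x)) \<longlonglongrightarrow> 0"
    proof (rule AE_I2, rule tendstoI)
      fix x and e :: real assume "x \<in> space M" "0 < e"
      from up[OF this] show "\<forall>\<^sub>F k in sequentially. dist (max 0 (s k x - L x)) 0 < e"
        by eventually_elim (use \<open>0 < e\<close> in auto)
    qed
    show "AE x in M. norm (max 0 (s k x - L x)) \<le> 2 * l x" for k
    proof (rule AE_I2)
      fix x assume "x \<in> space M"
      then show "norm (max 0 (s k x - L x)) \<le> 2 * l x" using bound[of x k] Ll[of x] by auto
    qed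
  qed (use l2 in auto)
  have i_max: "integrable M (\<lambda>x. max 0 (s k x - L x))" for k
    using i_s iL by (intro integrable_max) auto
  have diff: "(\<lambda>k. LINT x|M. s k x - L x) \<longlonglongrightarrow> V - (LINT x|M. L x)"
    using lim i_s iL by (simp add: tendsto_intros)
  show "V \<le> (LINT x|M. L x)"
  proof -
    have "(LINT x|M. s k x - L x) \<le> (LINT x|M. max 0 (s k x - L x))" for k
      using i_s iL i_max by (intro integral_mono) auto
    then have "V - (LINT x|M. L x) \<le> (LINT x|M. 0)" using diff pos by (intro LIMSEQ_le) auto
    then show ?thesis by simp
  qed
  show "\<exists>r. strict_mono r \<and> (AE x in M. (\<lambda>k. s (r k) x) \<longlonglongrightarrow> L x)" if V: "V = (LINT x|M. L x)"
  proof -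
    have "(LINT x|M. norm (s k x - L x)) = 2 * (LINT x|M. max 0 (s k x - L x)) - (LINT x|M. s k x - L x)" for k
    proof -
      have "(LINT x|M. norm (s k x - L x)) = (LINT x|M. 2 * max 0 (s k x - L x) - (s k x - L x))"
        by (intro Bochner_Integration.integral_cong) (auto simp: max_def)
      also have "\<dots> = (LINT x|M. 2 * max 0 (s k x - L x)) - (LINT x|M. s k x - L x)"
        using i_s iL i_max by (intro Bochner_Integration.integral_diff) auto
      finally show ?thesis by simp
    qed
    moreover have "(\<lambda>k. 2 * (LINT x|M. max 0 (s k x - L x)) - (LINT x|M. s k x - L x)) \<longlonglongrightarrow> 2 * (LINT x|M. 0) - (V - (LINT x|M. L x))"
      by (intro tendsto_intros pos diff)
    ultimately have "(\<lambda>k. LINT x|M. norm (s k x - L x)) \<longlonglongrightarrow> 0" using V by simp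
    from tendsto_L1_AE_subseq[OF _ this] i_s iL
    obtain r :: "nat \<Rightarrow> nat" where r: "strict_mono r" "AE x in M. (\<lambda>k. s (r k) x - L x) \<longlonglongrightarrow> 0" by auto
    from r(2) have "AE x in M. (\<lambda>k. s (r k) x) \<longlonglongrightarrow> L x"
      by eventually_elim (simp add: LIM_zero_iff)
    with r(1) show ?thesis by blast
  qed
qed

text \<open>On an atom each function is almost everywhere constant, so a diagonal subsequence of
  bounded sequences of vectors is enough.\<close>

lemma (in finite_measure) atomic_part_convergent_subsequence:
  fixes v :: "nat \<Rightarrow> 'a \<Rightarrow> 'b::euclidean_space" and A :: "nat \<Rightarrow> 'a set"
  assumes v: "\<And>k. v k \<in> borel_measurable M" and l: "integrable M l"
    and bound: "\<And>k x. x \<in> space M \<Longrightarrow> norm (v k x) \<le> l x"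
    and A: "\<And>i. atom (A i)"
  shows "\<exists>r. strict_mono r \<and> (AE x in M. x \<in> (\<Union>i. A i) \<longrightarrow> convergent (\<lambda>k. v (r k) x))"
proof -
  have iv: "integrable M (v k)" for k
    by (rule Bochner_Integration.integrable_bound[OF l]) (use bound v in \<open>auto intro!: AE_I2 order_trans[OF bound]\<close>)
  define c where "c i k = (LINT x:A i|M. v k x) /\<^sub>R measure M (A i)" for i k
  have AE: "AE x in M. \<forall>i k. x \<in> A i \<longrightarrow> v k x = c i k"
    unfolding AE_all_countable c_def using atom_AE_const[OF A iv] by blast
  have bd: "norm (c i k) \<le> (LINT x|M. l x) / measure M (A i)" for i k
  proof -
    have Ai: "A i \<in> sets M" using A by (simp add: atom_def)
    have "norm (LINT x:A i|M. v k x) \<le> (LINT x|M. norm (indicator (A i) x *\<^sub>R v k x))"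
      unfolding set_lebesgue_integral_def by (rule integral_norm_bound)
    also have "\<dots> \<le> (LINT x|M. l x)"
      using integrable_mult_indicator[OF Ai iv] l
    proof (intro integral_mono integrable_norm)
      fix x assume "x \<in> space M"
      then show "norm (indicator (A i) x *\<^sub>R v k x) \<le> l x"
        using bound[of x k] order_trans[OF norm_ge_zero, of "v k x" "l x"] by (auto simp: indicator_def)
    qed auto
    finally show ?thesis by (simp add: c_def divide_inverse mult.commute[of _ "inverse (measure M (A i))"] mult_left_mono)
  qed
  interpret sub: subseqs "\<lambda>i s. convergent (\<lambda>k. c i (s k))"
  proof
    fix i and s :: "nat \<Rightarrow> nat"
    have "bounded (range (\<lambda>k. c i (s k)))" using bd by (auto simp: bounded_iff)
    then obtain y r where "strict_mono r" "((\<lambda>k. c i (s k)) \<circ> r) \<longlonglongrightarrow> y"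
      using bounded_imp_convergent_subsequence by blast
    then show "\<exists>r'. strict_mono r' \<and> convergent (\<lambda>k. c i ((s \<circ> r') k))"
      by (auto simp: o_def convergent_def)
  qed
  have "convergent (\<lambda>k. c i (sub.diagseq k))" for i
  proof -
    have "convergent (\<lambda>k. c i ((sub.diagseq \<circ> (+) (Suc i)) k))"
    proof (rule sub.diagseq_holds)
      fix r s :: "nat \<Rightarrow> nat" and n assume "strict_mono r" "convergent (\<lambda>k. c n (s k))"
      then show "convergent (\<lambda>k. c n ((s \<circ> r) k))"
        using convergent_subseq_convergent[of "\<lambda>k. c n (s k)" r] by (simp add: o_def)
    qed
    then have "convergent (\<lambda>k. c i (sub.diagseq (k + Suc i)))" by (simp add: o_def add.commute)
    then show ?thesis using convergent_ignore_initial_segment[of "\<lambda>k. c i (sub.diagseq k)" "Suc i"] by blast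
  qed
  note conv = this
  have "AE x in M. x \<in> (\<Union>i. A i) \<longrightarrow> convergent (\<lambda>k. v (sub.diagseq k) x)"
    using AE
  proof eventually_elim
    case (elim x)
    show ?case
    proof
      assume "x \<in> (\<Union>i. A i)"
      then obtain i where "x \<in> A i" by blast
      then have "(\<lambda>k. v (sub.diagseq k) x) = (\<lambda>k. c i (sub.diagseq k))" using elim by auto
      then show "convergent (\<lambda>k. v (sub.diagseq k) x)" using conv by simp
    qed
  qed
  then show ?thesis using sub.subseq_diagseq by blast
qed

text \<open>Fatou's lemma in several dimensions, for dominated sequences. Pass to a subsequence \<open>u\<close> that
  converges on the atoms and for which the space \<open>P\<close> of directions \<open>p\<close> such that \<open>u k x \<bullet> p\<close> converges for
  almost every \<open>x\<close> has the largest dimension. Let \<open>I\<close> be the set of integrals of measurable selections of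
  cluster points of \<open>u\<close>. Two selections agree almost everywhere on the atoms, so Lyapunov's theorem
  makes \<open>I\<close> convex, and the scalar Fatou lemma puts \<open>V\<close> into the closure of \<open>I\<close>. If \<open>V\<close> were not in \<open>I\<close>,
  there would be a hyperplane through \<open>V\<close> supporting \<open>I\<close> but not containing it. Equality then holds in
  the scalar Fatou lemma for its normal \<open>a\<close>, so a further subsequence converges in the direction \<open>a\<close>.
  But \<open>a\<close> is not in \<open>P\<close>, since \<open>I\<close> lies in a level set of every direction in \<open>P\<close>: this contradicts the
  choice of the subsequence.\<close>

theorem (in finite_measure) fatou_euclidean:
  fixes v :: "nat \<Rightarrow> 'a \<Rightarrow> 'b::euclidean_space"
  assumes v: "\<And>k. v k \<in> borel_measurable M" and l: "integrable M l"
    and bound: "\<And>k x. x \<in> space M \<Longrightarrow> norm (v k x) \<le> l x"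
    and lim: "(\<lambda>k. LINT x|M. v k x) \<longlonglongrightarrow> V"
  shows "\<exists>f. integrable M f \<and> (LINT x|M. f x) = V \<and> (\<forall>x\<in>space M. f x \<in> cluster_points (\<lambda>k. v k x))"
proof -
  obtain A :: "nat \<Rightarrow> 'a set" where A: "\<And>i. atom (A i)" "atom_free (space M - (\<Union>i. A i))"
    using atomic_decomposition by blast
  define U where "U = (\<Union>i. A i)"
  define N where "N = space M - U"
  have U: "U \<in> sets M" unfolding U_def using A(1) by (intro sets.countable_UN) (auto simp: atom_def)
  then have N: "N \<in> sets M" by (simp add: N_def)
  define good where "good r \<longleftrightarrow> strict_mono r \<and> (AE x in M. x \<in> U \<longrightarrow> convergent (\<lambda>k. v (r k) x))" for r :: "nat \<Rightarrow> nat"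
  define P where "P r = {p. AE x in M. convergent (\<lambda>k. v (r k) x \<bullet> p)}" for r :: "nat \<Rightarrow> nat"
  have Psub: "subspace (P r)" for r
    unfolding subspace_def P_def
  proof (intro conjI ballI allI; simp add: convergent_const)
    show "AE x in M. convergent (\<lambda>k. v (r k) x \<bullet> (p + q))"
      if "AE x in M. convergent (\<lambda>k. v (r k) x \<bullet> p)" "AE x in M. convergent (\<lambda>k. v (r k) x \<bullet> q)" for p q
      using that by eventually_elim (simp add: inner_add_right convergent_add)
    show "AE x in M. convergent (\<lambda>k. a * (v (r k) x \<bullet> p))"
      if "AE x in M. convergent (\<lambda>k. v (r k) x \<bullet> p)" for a p
      using that by eventually_elim (auto simp: convergent_def intro: tendsto_mult_left)
  qed
  \<comment> \<open>a subsequence that converges in as many directions as possible\<close>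
  obtain r0 where "good r0"
    using atomic_part_convergent_subsequence[of v l A, OF v l bound A(1)] by (auto simp: good_def U_def)
  then obtain r where r: "good r" and rmax: "\<And>r'. good r' \<Longrightarrow> dim (P r') \<le> dim (P r)"
    using ex_has_greatest_nat[of good r0 "\<lambda>r. dim (P r)" "Suc DIM('b)"] dim_subset_UNIV le_imp_less_Suc by blast
  define u where "u k = v (r k)" for k
  have sr: "strict_mono r" and conv: "AE x in M. x \<in> U \<longrightarrow> convergent (\<lambda>k. u k x)"
    using r by (auto simp: good_def u_def)
  have u: "u k \<in> borel_measurable M" for k using v by (simp add: u_def)
  have ub: "norm (u k x) \<le> l x" if "x \<in> space M" for k x using bound[OF that] by (simp add: u_def)
  have ulim: "(\<lambda>k. LINT x|M. u k x) \<longlonglongrightarrow> V"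
    using LIMSEQ_subseq_LIMSEQ[OF lim sr] by (simp add: o_def u_def)
  have iu: "integrable M (u k)" for k
    by (rule Bochner_Integration.integrable_bound[OF l]) (use u in \<open>auto intro!: AE_I2 order_trans[OF ub]\<close>)
  define sel where "sel = {f \<in> borel_measurable M. \<forall>x\<in>space M. f x \<in> cluster_points (\<lambda>k. u k x)}"
  have sel_int: "integrable M f" if "f \<in> sel" for f
  proof (rule Bochner_Integration.integrable_bound[OF l])
    show "AE x in M. norm (f x) \<le> norm (l x)"
    proof (rule AE_I2)
      fix x assume x: "x \<in> space M"
      then have "norm (f x) \<le> l x" using that ub[OF x] by (auto simp: sel_def intro: cluster_points_norm_le)
      then show "norm (f x) \<le> norm (l x)" by simp
    qed
  qed (use that in \<open>auto simp: sel_def\<close>)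
  define I where "I = (\<lambda>f. LINT x|M. f x) ` sel"
  \<comment> \<open>a selection that attains the pointwise upper limit in the direction \<open>p\<close>\<close>
  have supp: "\<exists>f\<in>sel. V \<bullet> p \<le> (LINT x|M. f x) \<bullet> p \<and>
      (V \<bullet> p = (LINT x|M. f x) \<bullet> p \<longrightarrow> (\<exists>r'. strict_mono r' \<and> (AE x in M. convergent (\<lambda>k. u (r' k) x \<bullet> p))))" for p
  proof -
    define s where "s k x = u k x \<bullet> p" for k x
    define l' where "l' x = l x * norm p" for x
    have [measurable]: "u k \<in> borel_measurable M" for k by (rule u)
    have s: "s k \<in> borel_measurable M" for k unfolding s_def by measurable
    have sb: "\<bar>s k x\<bar> \<le> l' x" if "x \<in> space M" for k x
      unfolding s_def l'_def using ub[OF that]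
      by (metis Cauchy_Schwarz_ineq2 order_trans mult_right_mono norm_ge_zero)
    from random_subsequence_limsup[of s M l', OF s sb] obtain m L where
      m: "\<And>j. m j \<in> M \<rightarrow>\<^sub>M count_space UNIV" "\<And>j x. x \<in> space M \<Longrightarrow> j \<le> m j x"
      and L: "L \<in> borel_measurable M" "\<And>x. x \<in> space M \<Longrightarrow> (\<lambda>j. s (m j x) x) \<longlonglongrightarrow> L x"
      and up: "\<And>x e. x \<in> space M \<Longrightarrow> 0 < e \<Longrightarrow> \<forall>\<^sub>F k in sequentially. s k x < L x + e" by blast
    have "norm (u (m j x) x) \<le> l x" if "x \<in> space M" for j x using ub[OF that] .
    from measurable_cluster_selection[of "\<lambda>j x. u (m j x) x" M l, OF measurable_random_index[OF u m(1)] this]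
    obtain f where f: "f \<in> borel_measurable M" "\<And>x. x \<in> space M \<Longrightarrow> f x \<in> cluster_points (\<lambda>j. u (m j x) x)"
      by blast
    have fsel: "f \<in> sel"
      unfolding sel_def
    proof (intro CollectI conjI ballI)
      fix x assume x: "x \<in> space M"
      show "f x \<in> cluster_points (\<lambda>k. u k x)"
        using cluster_points_reindex[of "f x" "\<lambda>k. u k x" "\<lambda>j. m j x", OF f(2)[OF x] m(2)[OF x]] .
    qed (rule f)
    have fL: "f x \<bullet> p = L x" if x: "x \<in> space M" for x
    proof -
      have "f x \<bullet> p \<in> cluster_points (\<lambda>j. s (m j x) x)"
        unfolding s_def by (rule cluster_points_map[OF f(2)[OF x], of "\<lambda>y. y \<bullet> p"]) (auto intro!: continuous_intros)
      then show ?thesis using cluster_points_convergent[OF L(2)[OF x]] by blast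
    qed
    have Lb: "\<bar>L x\<bar> \<le> l' x" if x: "x \<in> space M" for x
      by (rule LIMSEQ_le_const2[OF tendsto_rabs[OF L(2)[OF x]]]) (use sb[OF x] in auto)
    have il': "integrable M l'" unfolding l'_def using l by simp
    have ints: "(LINT x|M. s k x) = (LINT x|M. u k x) \<bullet> p" for k
      unfolding s_def using iu by simp
    have slim: "(\<lambda>k. LINT x|M. s k x) \<longlonglongrightarrow> V \<bullet> p"
      unfolding ints by (intro tendsto_inner ulim tendsto_const)
    have intL: "(LINT x|M. L x) = (LINT x|M. f x) \<bullet> p"
    proof -
      have "(LINT x|M. L x) = (LINT x|M. f x \<bullet> p)" using fL by (intro Bochner_Integration.integral_cong) auto
      then show ?thesis using sel_int[OF fsel] by simp
    qed
    note fs = fatou_scalar[of s l' L "V \<bullet> p", OF s il' sb L(1) Lb up slim]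
    show ?thesis
    proof (intro bexI[of _ f] conjI impI)
      show "V \<bullet> p \<le> (LINT x|M. f x) \<bullet> p" using fs(1) intL by simp
      assume "V \<bullet> p = (LINT x|M. f x) \<bullet> p"
      then obtain r' where "strict_mono r'" "AE x in M. (\<lambda>k. s (r' k) x) \<longlonglongrightarrow> L x" using fs(2) intL by auto
      then show "\<exists>r'. strict_mono r' \<and> (AE x in M. convergent (\<lambda>k. u (r' k) x \<bullet> p))"
        unfolding s_def convergent_def by (intro exI[of _ r'] conjI) (auto elim!: eventually_mono)
    qed (rule fsel)
  qed
  have U_lim: "AE x in M. \<forall>f\<in>sel. \<forall>g\<in>sel. x \<in> U \<longrightarrow> f x = g x"
    using conv AE_space
  proof eventually_elim
    case (elim x)
    show ?case
    proof (intro ballI impI)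
      fix f g assume fg: "f \<in> sel" "g \<in> sel" "x \<in> U"
      then obtain y where "(\<lambda>k. u k x) \<longlonglongrightarrow> y" using elim by (auto simp: convergent_def)
      then show "f x = g x" using fg elim cluster_points_convergent unfolding sel_def by blast
    qed
  qed
  have I_convex: "convex I"
    unfolding convex_alt I_def
  proof (clarify)
    fix f g and a :: real assume f: "f \<in> sel" and g: "g \<in> sel" and a: "0 \<le> a" "a \<le> 1"
    define d where "d x = g x - f x" for x
    have d: "integrable M d" unfolding d_def using sel_int f g by auto
    obtain C where C: "C \<in> sets M" "C \<subseteq> N" "(LINT x:C|M. d x) = a *\<^sub>R (LINT x:N|M. d x)"
      using lyapunov[OF _ d, of N a] A(2) a unfolding N_def U_def by auto
    have "AE x in M. indicator N x *\<^sub>R d x = d x"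
      using U_lim AE_space by eventually_elim (use f g in \<open>auto simp: indicator_def N_def d_def\<close>)
    then have dN: "(LINT x:N|M. d x) = (LINT x|M. d x)"
      unfolding set_lebesgue_integral_def
      using d N by (intro integral_cong_AE) auto
    have [measurable]: "f \<in> borel_measurable M" "g \<in> borel_measurable M" "C \<in> sets M"
      using f g C by (auto simp: sel_def)
    define h where "h x = (if x \<in> C then g x else f x)" for x
    have "h \<in> borel_measurable M" unfolding h_def by measurable
    then have h: "h \<in> sel" using f g by (auto simp: sel_def h_def)
    have "(LINT x|M. h x) = (LINT x|M. f x + indicator C x *\<^sub>R d x)"
      by (intro Bochner_Integration.integral_cong) (auto simp: h_def d_def)
    also have "\<dots> = (LINT x|M. f x) + (LINT x:C|M. d x)"
      unfolding set_lebesgue_integral_def using sel_int[OF f] d C by (intro Bochner_Integration.integral_add integrable_mult_indicator)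
    also have "\<dots> = (LINT x|M. f x) + a *\<^sub>R ((LINT x|M. g x) - (LINT x|M. f x))"
      unfolding C(3) dN unfolding d_def using sel_int f g by simp
    also have "\<dots> = (1 - a) *\<^sub>R (LINT x|M. f x) + a *\<^sub>R (LINT x|M. g x)"
      by (simp add: algebra_simps)
    finally show "(1 - a) *\<^sub>R (LINT x|M. f x) + a *\<^sub>R (LINT x|M. g x) \<in> (\<lambda>f. LINT x|M. f x) ` sel"
      using h by (metis imageI)
  qed
  have Vcl: "V \<in> closure I"
  proof (rule ccontr)
    assume "V \<notin> closure I"
    then obtain a b where ab: "a \<bullet> V < b" "\<And>x. x \<in> closure I \<Longrightarrow> b < a \<bullet> x"
      using separating_hyperplane_closed_point[OF convex_closure[OF I_convex] closed_closure] by blast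
    obtain f where f: "f \<in> sel" "V \<bullet> (- a) \<le> (LINT x|M. f x) \<bullet> (- a)" using supp by blast
    have "(LINT x|M. f x) \<in> I" using f by (auto simp: I_def)
    then have "(LINT x|M. f x) \<in> closure I" using closure_subset by blast
    then show False using ab f by (fastforce simp: inner_commute)
  qed
  have "V \<in> I"
  proof (rule ccontr)
    assume "V \<notin> I"
    then have "V \<notin> rel_interior I" using rel_interior_subset by blast
    then obtain a where a: "\<And>y. y \<in> closure I \<Longrightarrow> a \<bullet> V \<le> a \<bullet> y" "\<And>y. y \<in> rel_interior I \<Longrightarrow> a \<bullet> V < a \<bullet> y"
      using supporting_hyperplane_relative_frontier[OF I_convex Vcl] by metis
    obtain f where f: "f \<in> sel" "V \<bullet> (- a) \<le> (LINT x|M. f x) \<bullet> (- a)"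
      and fr: "V \<bullet> (- a) = (LINT x|M. f x) \<bullet> (- a) \<longrightarrow> (\<exists>r'. strict_mono r' \<and> (AE x in M. convergent (\<lambda>k. u (r' k) x \<bullet> (- a))))"
      using supp[of "- a"] by blast
    have fI: "(LINT x|M. f x) \<in> I" using f by (auto simp: I_def)
    then have "a \<bullet> V \<le> a \<bullet> (LINT x|M. f x)" using a(1) closure_subset by blast
    then have "V \<bullet> (- a) = (LINT x|M. f x) \<bullet> (- a)" using f by (simp add: inner_commute)
    then obtain r' where r': "strict_mono r'" "AE x in M. convergent (\<lambda>k. u (r' k) x \<bullet> (- a))" using fr by blast
    have srr: "strict_mono (r \<circ> r')" using sr r' by (simp add: strict_mono_o)
    have sub: "convergent (\<lambda>k. s (r' k))" if "convergent s" for s :: "nat \<Rightarrow> 'c::metric_space"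
      using convergent_subseq_convergent[OF that r'(1)] by (simp add: o_def)
    have "AE x in M. x \<in> U \<longrightarrow> convergent (\<lambda>k. v ((r \<circ> r') k) x)"
      using conv by eventually_elim (auto simp: u_def intro: sub)
    then have "good (r \<circ> r')" using srr by (simp add: good_def)
    from rmax[OF this] have le: "dim (P (r \<circ> r')) \<le> dim (P r)" .
    have sub2: "P r \<subseteq> P (r \<circ> r')"
    proof
      fix p assume "p \<in> P r"
      then have "AE x in M. convergent (\<lambda>k. v (r k) x \<bullet> p)" by (simp add: P_def)
      then have "AE x in M. convergent (\<lambda>k. v ((r \<circ> r') k) x \<bullet> p)"
        by eventually_elim (drule sub, simp)
      then show "p \<in> P (r \<circ> r')" by (simp add: P_def)
    qed
    have "- a \<in> P (r \<circ> r')" using r' by (simp add: P_def u_def)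
    then have aP': "a \<in> P (r \<circ> r')" using subspace_neg[OF Psub] by force
    have "a \<notin> P r"
    proof
      assume "a \<in> P r"
      then have ca: "AE x in M. convergent (\<lambda>k. u k x \<bullet> a)" by (simp add: P_def u_def)
      have all: "g \<bullet> a = V \<bullet> a" if "g \<in> I" for g
      proof -
        obtain h where h: "h \<in> sel" "g = (LINT x|M. h x)" using \<open>g \<in> I\<close> by (auto simp: I_def)
        have "AE x in M. (\<lambda>k. u k x \<bullet> a) \<longlonglongrightarrow> h x \<bullet> a"
          using ca AE_space
        proof eventually_elim
          case (elim x)
          then obtain y where y: "(\<lambda>k. u k x \<bullet> a) \<longlonglongrightarrow> y" by (auto simp: convergent_def)
          have "h x \<bullet> a \<in> cluster_points (\<lambda>k. u k x \<bullet> a)"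
            using h elim by (intro cluster_points_map[of _ _ "\<lambda>y. y \<bullet> a"]) (auto simp: sel_def intro!: continuous_intros)
          then show ?case using y cluster_points_convergent by blast
        qed
        then have "(\<lambda>k. LINT x|M. u k x \<bullet> a) \<longlonglongrightarrow> (LINT x|M. h x \<bullet> a)"
        proof (rule integral_dominated_convergence[rotated 3, where w = "\<lambda>x. l x * norm a"])
          show "AE x in M. norm (u k x \<bullet> a) \<le> l x * norm a" for k
          proof (rule AE_I2)
            fix x assume "x \<in> space M"
            from ub[OF this, of k] show "norm (u k x \<bullet> a) \<le> l x * norm a"
              by (metis Cauchy_Schwarz_ineq2 order_trans mult_right_mono norm_ge_zero real_norm_def)
          qed
        qed (use u l sel_int[OF h(1)] in auto)
        then have "(\<lambda>k. (LINT x|M. u k x) \<bullet> a) \<longlonglongrightarrow> (LINT x|M. h x) \<bullet> a"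
          using iu sel_int[OF h(1)] by simp
        moreover have "(\<lambda>k. (LINT x|M. u k x) \<bullet> a) \<longlonglongrightarrow> V \<bullet> a"
          by (intro tendsto_inner ulim tendsto_const)
        ultimately show ?thesis using h LIMSEQ_unique by blast
      qed
      have "rel_interior I \<noteq> {}" using fI rel_interior_eq_empty[OF I_convex] by blast
      then obtain y where "y \<in> rel_interior I" by blast
      then show False using a(2) all[of y] rel_interior_subset by (fastforce simp: inner_commute)
    qed
    then have "span (P r) \<subset> span (P (r \<circ> r'))"
    proof -
      have "span (P r) = P r" "span (P (r \<circ> r')) = P (r \<circ> r')"
        using span_eq_iff[THEN iffD2, OF Psub] by blast+
      then show ?thesis using sub2 aP' \<open>a \<notin> P r\<close> by blast
    qed
    from dim_psubset[OF this] le show False by linarith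
  qed
  then obtain f where f: "f \<in> sel" "(LINT x|M. f x) = V" by (auto simp: I_def)
  show ?thesis
  proof (intro exI[of _ f] conjI ballI)
    show "f x \<in> cluster_points (\<lambda>k. v k x)" if "x \<in> space M" for x
    proof (rule cluster_points_reindex)
      show "f x \<in> cluster_points (\<lambda>k. v (r k) x)" using f that by (auto simp: sel_def u_def)
    qed (rule seq_suble[OF sr])
  qed (use f sel_int in auto)
qed

section \<open>Limiting subgradients of integral functionals\<close>

text \<open>The inequality is global rather than local: it comes from the minimization of an envelope over
  the whole space.\<close>

definition proximal_subgradient :: "('a::euclidean_space \<Rightarrow> real) \<Rightarrow> 'a \<Rightarrow> 'a \<Rightarrow> bool" where
  "proximal_subgradient g y v \<longleftrightarrow>
     (\<exists>C. \<forall>u. g y + v \<bullet> (u - y) - C * (norm (u - y))\<^sup>2 \<le> g u)"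

text \<open>The vectors \<open>v\<close> are limiting subgradients if \<open>g\<close> is continuous at \<open>u\<close>.\<close>

definition proximal_limits :: "('a::euclidean_space \<Rightarrow> real) \<Rightarrow> 'a \<Rightarrow> 'a set" where
  "proximal_limits g u =
     {v. \<exists>ys vs. (\<forall>k::nat. proximal_subgradient g (ys k) (vs k)) \<and> ys \<longlonglongrightarrow> u \<and> vs \<longlonglongrightarrow> v}"

text \<open>Test with small multiples of \<open>a\<close>.\<close>

lemma norm_le_if_local_bound:
  fixes a :: "'a::real_inner"
  assumes "0 < r" "0 \<le> b" and bd: "\<And>w. norm w \<le> r \<Longrightarrow> a \<bullet> w \<le> b * norm w + C * (norm w)\<^sup>2"
  shows "norm a \<le> b"
proof (rule field_le_epsilon)
  fix e :: real assume "0 < e"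
  show "norm a \<le> b + e"
  proof (cases "a = 0")
    case True
    then show ?thesis using \<open>0 \<le> b\<close> \<open>0 < e\<close> by simp
  next
    case False
    define s where "s = min r (e / (\<bar>C\<bar> + 1))"
    have s: "0 < s" "s \<le> r" using \<open>0 < r\<close> \<open>0 < e\<close> by (auto simp: s_def)
    have "s \<le> e / (\<bar>C\<bar> + 1)" by (simp add: s_def)
    then have sC: "s * (\<bar>C\<bar> + 1) \<le> e" by (simp add: pos_le_divide_eq)
    let ?w = "(s / norm a) *\<^sub>R a"
    have nw: "norm ?w = s" using False s by simp
    have "a \<bullet> ?w = s * norm a" using False by (simp add: dot_square_norm power2_eq_square)
    then have "s * norm a \<le> b * s + C * s\<^sup>2" using bd[of ?w] nw s by simp
    then have "s * norm a \<le> s * (b + C * s)" by (simp add: algebra_simps power2_eq_square)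
    then have "norm a \<le> b + C * s" using s by simp
    also have "C * s \<le> s * (\<bar>C\<bar> + 1)"
    proof -
      have "C * s \<le> (\<bar>C\<bar> + 1) * s" using s by (intro mult_right_mono) auto
      then show ?thesis by (simp add: mult.commute)
    qed
    finally show ?thesis using sC by simp
  qed
qed


locale lipschitz_integrand = finite_measure M for M :: "'t measure" +
  fixes g :: "'t \<Rightarrow> 'a::euclidean_space \<Rightarrow> real" and l :: "'t \<Rightarrow> real"
  assumes integrable_g: "\<And>u. integrable M (\<lambda>t. g t u)"
    and integrable_l: "integrable M l"
    and l_nonneg: "\<And>t. t \<in> space M \<Longrightarrow> 0 \<le> l t"
    and lipschitz: "\<And>t u u'. t \<in> space M \<Longrightarrow> \<bar>g t u - g t u'\<bar> \<le> l t * norm (u - u')"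
begin

text \<open>The factor \<open>1 + l t\<close> makes the error \<open>(l t)\<^sup>2 / (4 * weight j t)\<close> of the envelope integrable and
  bounds the distance to its minimizers by \<open>1 / j\<close> uniformly in \<open>t\<close>, although \<open>l\<close> need not be bounded.\<close>

definition weight :: "real \<Rightarrow> 't \<Rightarrow> real" where "weight j t = j * (1 + l t)"

definition penalized :: "real \<Rightarrow> 't \<Rightarrow> 'a \<Rightarrow> 'a \<Rightarrow> real" where
  "penalized j t u h = g t (u + h) + weight j t * (norm h)\<^sup>2"

definition dense_seq :: "nat \<Rightarrow> 'a" where
  "dense_seq = (SOME d. closure (range d) = UNIV)"

text \<open>The Moreau envelope of \<open>g t\<close>, with the displacement as the variable. The infimum over a countable
  dense set is visibly measurable in \<open>t\<close>.\<close>

definition envelope :: "real \<Rightarrow> 't \<Rightarrow> 'a \<Rightarrow> real" where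
  "envelope j t u = (INF n. penalized j t u (dense_seq n))"

lemma dense_seq: "closure (range dense_seq) = (UNIV :: 'a set)"
proof -
  obtain T :: "'a set" where T: "countable T" "T \<subseteq> UNIV" "UNIV \<subseteq> closure T"
    using separable[of UNIV] by blast
  then have "T \<noteq> {}" by auto
  then have "range (from_nat_into T) = T" using T(1) by (rule range_from_nat_into)
  then have "closure (range (from_nat_into T)) = (UNIV :: 'a set)" using T by auto
  then show ?thesis unfolding dense_seq_def by (rule someI[of "\<lambda>d. closure (range d) = UNIV"])
qed

lemma continuous_g: "t \<in> space M \<Longrightarrow> continuous_on UNIV (g t)"
proof -
  assume t: "t \<in> space M"
  have "(l t)-lipschitz_on UNIV (g t)"
    using lipschitz[OF t] l_nonneg[OF t] by (auto simp: lipschitz_on_def dist_real_def dist_norm)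
  then show ?thesis by (rule lipschitz_on_continuous_on)
qed

lemma continuous_penalized: "t \<in> space M \<Longrightarrow> continuous_on UNIV (penalized j t u)"
  unfolding penalized_def
  by (intro continuous_intros continuous_on_compose2[OF continuous_g]) auto

lemma weight_pos: "0 < j \<Longrightarrow> t \<in> space M \<Longrightarrow> 0 < weight j t"
  using l_nonneg by (simp add: weight_def add_pos_nonneg)

lemma measurable_l [measurable]: "l \<in> borel_measurable M" and measurable_g [measurable]: "(\<lambda>t. g t u) \<in> borel_measurable M"
  using integrable_l integrable_g by auto

text \<open>Complete the square in \<open>norm h\<close>.\<close>

lemma penalized_ge:
  assumes "0 < j" and t: "t \<in> space M"
  shows "g t u - l t / (4 * j) \<le> penalized j t u h"
proof -
  let ?s = "norm h"
  have l: "0 \<le> l t" by (rule l_nonneg[OF t])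
  have "0 \<le> l t * (1 - 2 * j * ?s)\<^sup>2 + 4 * j\<^sup>2 * ?s\<^sup>2" using l by simp
  also have "\<dots> = l t - 4 * j * (l t * ?s - j * (1 + l t) * ?s\<^sup>2)"
    by (simp add: power2_eq_square algebra_simps)
  finally have "4 * j * (l t * ?s - weight j t * ?s\<^sup>2) \<le> l t" by (simp add: weight_def)
  then have "l t * ?s - weight j t * ?s\<^sup>2 \<le> l t / (4 * j)" using \<open>0 < j\<close> by (simp add: field_simps)
  moreover have "g t u - g t (u + h) \<le> l t * ?s" using lipschitz[OF t, of u "u + h"] by simp
  ultimately show ?thesis by (simp add: penalized_def)
qed

lemma bdd_penalized: "0 < j \<Longrightarrow> t \<in> space M \<Longrightarrow> bdd_below (range (\<lambda>n. penalized j t u (dense_seq n)))"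
  by (rule bdd_belowI2) (rule penalized_ge)

lemma envelope_le_penalized:
  assumes "0 < j" and t: "t \<in> space M"
  shows "envelope j t u \<le> penalized j t u h"
proof -
  show ?thesis
  proof (rule continuous_ge_on_closure[of "range dense_seq" "penalized j t u"])
    show "continuous_on (closure (range dense_seq)) (penalized j t u)"
      unfolding dense_seq by (rule continuous_penalized[OF t])
    show "h \<in> closure (range dense_seq)" unfolding dense_seq by simp
    fix h' assume "h' \<in> range dense_seq"
    then obtain n where "h' = dense_seq n" by auto
    then show "envelope j t u \<le> penalized j t u h'"
      unfolding envelope_def by (simp only: cINF_lower[OF bdd_penalized[OF assms] UNIV_I])
  qed
qed

lemma envelope_ge: "0 < j \<Longrightarrow> t \<in> space M \<Longrightarrow> g t u - l t / (4 * j) \<le> envelope j t u"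
  unfolding envelope_def by (rule cINF_greatest) (use penalized_ge in auto)

lemma envelope_le: "0 < j \<Longrightarrow> t \<in> space M \<Longrightarrow> envelope j t u \<le> g t u"
  using envelope_le_penalized[of j t u 0] by (simp add: penalized_def)

lemma envelope_lipschitz:
  assumes "0 < j" and t: "t \<in> space M"
  shows "\<bar>envelope j t u - envelope j t u'\<bar> \<le> l t * norm (u - u')"
proof -
  have main: "envelope j t u - l t * norm (u - u') \<le> envelope j t u'" for u u'
    unfolding envelope_def[of j t u']
  proof (rule cINF_greatest)
    fix n
    have "envelope j t u \<le> penalized j t u (dense_seq n)" by (rule envelope_le_penalized[OF assms])
    moreover have "\<bar>g t (u + dense_seq n) - g t (u' + dense_seq n)\<bar> \<le> l t * norm (u - u')"
      using lipschitz[OF t, of "u + dense_seq n" "u' + dense_seq n"] by simp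
    ultimately show "envelope j t u - l t * norm (u - u') \<le> penalized j t u' (dense_seq n)"
      by (simp add: penalized_def)
  qed simp
  show ?thesis using main[of u u'] main[of u' u] by (simp add: norm_minus_commute)
qed

lemma measurable_penalized [measurable]: "(\<lambda>t. penalized j t u h) \<in> borel_measurable M"
  unfolding penalized_def weight_def by measurable

lemma measurable_envelope [measurable]: "0 < j \<Longrightarrow> (\<lambda>t. envelope j t u) \<in> borel_measurable M"
  unfolding envelope_def using bdd_penalized by (intro borel_measurable_cINF) auto

lemma integrable_envelope: "0 < j \<Longrightarrow> integrable M (\<lambda>t. envelope j t u)"
proof (rule Bochner_Integration.integrable_bound[of M "\<lambda>t. \<bar>g t u\<bar> + l t / (4 * j)"])
  assume "0 < j"
  show "AE t in M. norm (envelope j t u) \<le> norm (\<bar>g t u\<bar> + l t / (4 * j))"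
  proof (rule AE_I2)
    fix t assume t: "t \<in> space M"
    have "0 \<le> l t / (4 * j)" using l_nonneg[OF t] \<open>0 < j\<close> by simp
    then show "norm (envelope j t u) \<le> norm (\<bar>g t u\<bar> + l t / (4 * j))"
      using envelope_ge[OF \<open>0 < j\<close> t, of u] envelope_le[OF \<open>0 < j\<close> t, of u] by (simp add: abs_le_iff) linarith
  qed
qed (use integrable_g integrable_l in auto)

text \<open>Cluster points of the first elements of the dense sequence that are almost minimal.\<close>

lemma measurable_minimizer:
  assumes j: "0 < j"
  shows "\<exists>h\<in>borel_measurable M. \<forall>t\<in>space M. penalized j t u (h t) = envelope j t u"
proof -
  define n where "n k t = (LEAST n. penalized j t u (dense_seq n) \<le> envelope j t u + 1 / Suc k)" for k t
  have n: "penalized j t u (dense_seq (n k t)) \<le> envelope j t u + 1 / Suc k" if t: "t \<in> space M" for k t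
  proof -
    have "\<exists>n\<in>UNIV. penalized j t u (dense_seq n) < envelope j t u + 1 / Suc k"
    proof -
      have "envelope j t u < envelope j t u + 1 / Suc k" by simp
      then show ?thesis
        unfolding envelope_def[of j t u] by (subst (asm) cINF_less_iff[OF UNIV_not_empty bdd_penalized[OF j t]])
    qed
    then obtain i where "penalized j t u (dense_seq i) \<le> envelope j t u + 1 / Suc k" by (auto intro: less_imp_le)
    then show ?thesis unfolding n_def by (rule LeastI)
  qed
  have n_meas: "n k \<in> M \<rightarrow>\<^sub>M count_space UNIV" for k
    unfolding n_def using j by measurable
  define y where "y k t = dense_seq (n k t)" for k t
  have y: "y k \<in> borel_measurable M" for k
    unfolding y_def using measurable_compose[OF n_meas, of "dense_seq" borel] by simp
  have bound: "norm (y k t) \<le> 1 + 1 / j" if t: "t \<in> space M" for k t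
  proof (cases "norm (y k t) \<le> 1")
    case True then show ?thesis using j by (simp add: add_increasing2)
  next
    case False
    let ?s = "norm (y k t)"
    have l: "0 \<le> l t" by (rule l_nonneg[OF t])
    have "penalized j t u (y k t) \<le> g t u + 1"
    proof -
      have "1 / real (Suc k) \<le> 1" by simp
      then show ?thesis using n[OF t, of k] envelope_le[OF j t, of u] unfolding y_def by linarith
    qed
    moreover have "g t u - g t (u + y k t) \<le> l t * ?s" using lipschitz[OF t, of u "u + y k t"] by simp
    ultimately have "weight j t * ?s\<^sup>2 \<le> l t * ?s + 1" by (simp add: penalized_def)
    also have "\<dots> \<le> (1 + l t) * ?s" using False by (simp add: algebra_simps)
    finally have "(1 + l t) * ?s * (j * ?s) \<le> (1 + l t) * ?s * 1"
      by (simp add: weight_def power2_eq_square algebra_simps)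
    moreover have "0 < (1 + l t) * ?s" using False l by (intro mult_pos_pos) auto
    ultimately have "j * ?s \<le> 1" by (rule mult_left_le_imp_le)
    then have "?s \<le> 1 / j" using j by (simp add: field_simps)
    then show ?thesis by simp
  qed
  obtain h where h: "h \<in> borel_measurable M" "\<And>t. t \<in> space M \<Longrightarrow> h t \<in> cluster_points (\<lambda>k. y k t)"
    using measurable_cluster_selection[of y M "\<lambda>_. 1 + 1 / j", OF y bound] by blast
  show ?thesis
  proof (intro bexI[OF _ h(1)] ballI antisym)
    fix t assume t: "t \<in> space M"
    then show "envelope j t u \<le> penalized j t u (h t)" using envelope_le_penalized j by blast
    obtain k where k: "\<And>i. i \<le> k i" "(\<lambda>i. y (k i) t) \<longlonglongrightarrow> h t"
      using h(2)[OF t] by (auto simp: cluster_points_def)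
    have "(\<lambda>i. penalized j t u (y (k i) t)) \<longlonglongrightarrow> penalized j t u (h t)"
      using continuous_on_tendsto_compose[OF continuous_penalized[OF t] k(2)] by simp
    moreover have "(\<lambda>i. envelope j t u + 1 / Suc (k i)) \<longlonglongrightarrow> envelope j t u + 0"
      by (intro tendsto_intros filterlim_compose[OF lim_1_over_n[THEN LIMSEQ_Suc] filterlim_at_top_ge[OF k(1)]])
    ultimately have "penalized j t u (h t) \<le> envelope j t u + 0"
      using n[OF t] by (intro LIMSEQ_le) (auto simp: y_def)
    then show "penalized j t u (h t) \<le> envelope j t u" by simp
  qed
qed

lemma minimizer_norm_le:
  assumes j: "0 < j" and t: "t \<in> space M" and h: "penalized j t u h = envelope j t u"
  shows "weight j t * norm h \<le> l t" "norm h \<le> 1 / j"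
proof -
  have l: "0 \<le> l t" by (rule l_nonneg[OF t])
  have "g t u - g t (u + h) \<le> l t * norm h" using lipschitz[OF t, of u "u + h"] by simp
  moreover have "penalized j t u h \<le> g t u" using envelope_le[OF j t] h by simp
  ultimately have "weight j t * norm h * norm h \<le> l t * norm h"
    by (simp add: penalized_def power2_eq_square)
  then show 1: "weight j t * norm h \<le> l t"
    using l by (cases "h = 0") auto
  have "(1 + l t) * (j * norm h) \<le> (1 + l t) * 1" using 1 l by (simp add: weight_def algebra_simps)
  moreover have "0 < 1 + l t" using l by simp
  ultimately have "j * norm h \<le> 1" by (rule mult_left_le_imp_le)
  then show "norm h \<le> 1 / j" using j by (simp add: field_simps)
qed

text \<open>The function \<open>g t\<close> lies above the downward parabola centred at \<open>u\<close> whose apex is the value of the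
  envelope there, and touches it at the minimizer \<open>u + h\<close>.\<close>

lemma minimizer_proximal_subgradient:
  assumes j: "0 < j" and t: "t \<in> space M" and h: "penalized j t u h = envelope j t u"
  shows "proximal_subgradient (g t) (u + h) (- (2 * weight j t) *\<^sub>R h)"
  unfolding proximal_subgradient_def
proof (intro exI[of _ "weight j t"] allI)
  fix u'
  let ?c = "weight j t" and ?w = "u' - (u + h)"
  have "penalized j t u h \<le> penalized j t u (u' - u)" using envelope_le_penalized[OF j t] h by simp
  then have "g t (u + h) + ?c * (norm h)\<^sup>2 \<le> g t u' + ?c * (norm (u' - u))\<^sup>2" by (simp add: penalized_def)
  moreover have "(norm (u' - u))\<^sup>2 = (norm ?w)\<^sup>2 + 2 * (h \<bullet> ?w) + (norm h)\<^sup>2"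
  proof -
    have w: "u' - u = ?w + h" by simp
    show ?thesis
      unfolding w power2_norm_eq_inner by (simp only: inner_add_left inner_add_right inner_commute[of ?w h])
  qed
  ultimately show "g t (u + h) + (- (2 * ?c) *\<^sub>R h) \<bullet> ?w - ?c * (norm ?w)\<^sup>2 \<le> g t u'"
    by (simp add: algebra_simps)
qed

text \<open>The integral of the envelopes, tilted by \<open>V\<close>, has a minimizer \<open>m\<close> near \<open>U\<close>, because it
  approximates the tilted integral of \<open>g\<close> uniformly. Let \<open>m + h t\<close> attain the envelope at \<open>m\<close>. As a function of
  \<open>u\<close>, the envelope lies below the parabola with apex \<open>m + h t\<close> and touches it at \<open>u = m\<close>. Hence \<open>m\<close> also
  minimizes the tilted integral of the parabolas locally, and this function is smooth: its
  stationarity says that the gradients \<open>v t\<close> of the parabolas integrate to almost \<open>V\<close>.\<close>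

lemma approximate_subgradient_selection:
  assumes "0 < r" "0 \<le> e" "0 < d"
    and min: "\<And>u. norm (u - U) \<le> r \<Longrightarrow>
       (LINT t|M. g t U) + V \<bullet> (u - U) - e * norm (u - U) \<le> (LINT t|M. g t u)"
  shows "\<exists>y v. v \<in> borel_measurable M \<and>
     (\<forall>t\<in>space M. norm (y t - U) \<le> d \<and> norm (v t) \<le> 2 * l t \<and> proximal_subgradient (g t) (y t) (v t)) \<and>
     norm ((LINT t|M. v t) - V) \<le> e + d"
proof -
  define \<rho> where "\<rho> = min (d / 2) (r / 2)"
  have \<rho>: "0 < \<rho>" "\<rho> \<le> r / 2" "2 * \<rho> \<le> d" using assms by (auto simp: \<rho>_def)
  let ?L = "LINT t|M. l t"
  have L: "0 \<le> ?L" using l_nonneg by (intro Bochner_Integration.integral_nonneg_AE AE_I2)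
  \<comment> \<open>the first summand keeps \<open>m\<close> within \<open>\<rho>\<close> of \<open>U\<close>, the second one keeps \<open>h t\<close> below \<open>d / 2\<close>\<close>
  define j where "j = ?L / (4 * \<rho>\<^sup>2) + 2 / d"
  have j: "0 < j" "1 / j \<le> d / 2" "?L / (4 * j) \<le> \<rho>\<^sup>2"
  proof -
    have "0 \<le> ?L / (4 * \<rho>\<^sup>2)" using L by simp
    then have ge: "2 / d \<le> j" and ge2: "?L / (4 * \<rho>\<^sup>2) \<le> j" using \<open>0 < d\<close> by (auto simp: j_def)
    then show "0 < j" using \<open>0 < d\<close> by (meson divide_pos_pos less_le_trans zero_less_numeral)
    then show "1 / j \<le> d / 2" using ge \<open>0 < d\<close> by (simp add: field_simps)
    show "?L / (4 * j) \<le> \<rho>\<^sup>2" using ge2 \<open>0 < j\<close> \<rho> by (simp add: field_simps)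
  qed
  define E where "E u = (LINT t|M. envelope j t u)" for u
  \<comment> \<open>the square makes \<open>U\<close> a strict minimizer and thereby localizes \<open>m\<close>\<close>
  define Q where "Q u = E u - V \<bullet> u + e * norm (u - U) + (norm (u - U))\<^sup>2" for u
  have El: "\<bar>E u - E u'\<bar> \<le> ?L * norm (u - u')" for u u'
  proof -
    have "\<bar>E u - E u'\<bar> = \<bar>LINT t|M. envelope j t u - envelope j t u'\<bar>"
      unfolding E_def using integrable_envelope[OF j(1)] by simp
    also have "\<dots> \<le> (LINT t|M. \<bar>envelope j t u - envelope j t u'\<bar>)" by (rule integral_abs_bound)
    also have "\<dots> \<le> (LINT t|M. l t * norm (u - u'))"
      using integrable_envelope[OF j(1)] integrable_l envelope_lipschitz[OF j(1)]
      by (intro integral_mono) auto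
    finally show ?thesis by simp
  qed
  have "?L-lipschitz_on UNIV E" using El L by (auto simp: lipschitz_on_def dist_real_def dist_norm)
  then have "continuous_on UNIV E" by (rule lipschitz_on_continuous_on)
  then have "continuous_on (cball U r) Q" unfolding Q_def
    by (intro continuous_intros) (auto intro: continuous_on_subset)
  then obtain m where m: "m \<in> cball U r" "\<And>u. u \<in> cball U r \<Longrightarrow> Q m \<le> Q u"
    using continuous_attains_inf[of "cball U r" Q] \<open>0 < r\<close> by auto
  have mU: "norm (m - U) \<le> \<rho>"
  proof -
    have mr: "norm (m - U) \<le> r" using m by (simp add: dist_norm norm_minus_commute)
    have "Q m \<le> Q U" using m \<open>0 < r\<close> by simp
    moreover have "E U \<le> (LINT t|M. g t U)"
      unfolding E_def by (rule integral_mono[OF integrable_envelope[OF j(1)] integrable_g envelope_le[OF j(1)]])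
    moreover have "(LINT t|M. g t m) - ?L / (4 * j) \<le> E m"
    proof -
      have "(LINT t|M. g t m - l t / (4 * j)) \<le> E m"
        unfolding E_def using integrable_envelope[OF j(1)] integrable_g integrable_l envelope_ge[OF j(1)]
        by (intro integral_mono) auto
      then show ?thesis using integrable_g integrable_l by simp
    qed
    ultimately have "(norm (m - U))\<^sup>2 \<le> ?L / (4 * j)"
      using min[OF mr] by (simp add: Q_def inner_diff_right)
    also have "\<dots> \<le> \<rho>\<^sup>2" by (rule j)
    finally have sq: "(norm (m - U))\<^sup>2 \<le> \<rho>\<^sup>2" .
    show ?thesis by (rule power2_le_imp_le[OF sq less_imp_le[OF \<rho>(1)]])
  qed
  obtain h where h: "h \<in> borel_measurable M" "\<And>t. t \<in> space M \<Longrightarrow> penalized j t m (h t) = envelope j t m"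
    using measurable_minimizer[OF j(1)] by blast
  define v where "v t = - (2 * weight j t) *\<^sub>R h t" for t
  have v_meas: "v \<in> borel_measurable M" unfolding v_def weight_def using h(1) by measurable
  have v_le: "norm (v t) \<le> 2 * l t" if t: "t \<in> space M" for t
    using minimizer_norm_le(1)[OF j(1) t h(2)[OF t]] weight_pos[OF j(1) t] by (simp add: v_def)
  have iv: "integrable M v"
    by (rule Bochner_Integration.integrable_bound[of M "\<lambda>t. 2 * l t"])
      (use v_meas integrable_l v_le l_nonneg in \<open>auto intro!: AE_I2\<close>)
  have ic: "integrable M (weight j)" unfolding weight_def using integrable_l by auto
  let ?c = "LINT t|M. weight j t"
  have Ediff: "E u - E m \<le> (LINT t|M. v t) \<bullet> (u - m) + ?c * (norm (u - m))\<^sup>2" for u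
  proof -
    have "E u - E m = (LINT t|M. envelope j t u - envelope j t m)"
      unfolding E_def using integrable_envelope[OF j(1)] by simp
    also have "\<dots> \<le> (LINT t|M. v t \<bullet> (u - m) + weight j t * (norm (u - m))\<^sup>2)"
    proof (intro integral_mono)
      fix t assume t: "t \<in> space M"
      let ?w = "u - m"
      have "envelope j t u \<le> penalized j t u (h t - ?w)" by (rule envelope_le_penalized[OF j(1) t])
      moreover have "envelope j t m = penalized j t m (h t)" using h(2)[OF t] by simp
      moreover have "u + (h t - ?w) = m + h t" by simp
      ultimately have "envelope j t u - envelope j t m \<le> weight j t * ((norm (h t - ?w))\<^sup>2 - (norm (h t))\<^sup>2)"
        by (simp add: penalized_def algebra_simps)
      also have "(norm (h t - ?w))\<^sup>2 - (norm (h t))\<^sup>2 = (norm ?w)\<^sup>2 - 2 * (h t \<bullet> ?w)"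
        by (simp only: power2_norm_eq_inner) (simp add: inner_diff_left inner_diff_right inner_commute)
      finally show "envelope j t u - envelope j t m \<le> v t \<bullet> ?w + weight j t * (norm ?w)\<^sup>2"
        by (simp add: v_def algebra_simps)
    qed (use integrable_envelope[OF j(1)] iv ic in auto)
    also have "\<dots> = (LINT t|M. v t) \<bullet> (u - m) + ?c * (norm (u - m))\<^sup>2"
      using iv ic by simp
    finally show ?thesis .
  qed
  have "norm (V - (LINT t|M. v t)) \<le> e + 2 * \<rho>"
  proof (rule norm_le_if_local_bound)
    show "0 < r / 2" "0 \<le> e + 2 * \<rho>" using assms \<rho> by auto
    fix w :: 'a assume w: "norm w \<le> r / 2"
    have nn: "norm (m + w - U) \<le> norm (m - U) + norm w"
      using norm_triangle_ineq[of "m - U" w] by (simp add: algebra_simps)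
    have "norm (m + w - U) \<le> r" using nn mU w \<rho> by linarith
    then have "Q m \<le> Q (m + w)" by (intro m) (simp add: dist_norm norm_minus_commute)
    then have "0 \<le> (E (m + w) - E m) - V \<bullet> w + e * (norm (m + w - U) - norm (m - U)) + ((norm (m + w - U))\<^sup>2 - (norm (m - U))\<^sup>2)"
      by (simp add: Q_def inner_add_right algebra_simps)
    also have "\<dots> \<le> ((LINT t|M. v t) \<bullet> w + ?c * (norm w)\<^sup>2) - V \<bullet> w + e * norm w + (2 * \<rho> * norm w + (norm w)\<^sup>2)"
    proof -
      have "E (m + w) - E m \<le> (LINT t|M. v t) \<bullet> w + ?c * (norm w)\<^sup>2" using Ediff[of "m + w"] by simp
      moreover have "e * (norm (m + w - U) - norm (m - U)) \<le> e * norm w"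
        using nn \<open>0 \<le> e\<close> by (intro mult_left_mono) auto
      moreover have "(norm (m + w - U))\<^sup>2 - (norm (m - U))\<^sup>2 \<le> 2 * \<rho> * norm w + (norm w)\<^sup>2"
      proof -
        have "(norm (m + w - U))\<^sup>2 \<le> (norm (m - U) + norm w)\<^sup>2" using nn by (intro power_mono) auto
        moreover have "norm (m - U) * norm w \<le> \<rho> * norm w" using mU by (intro mult_right_mono) auto
        ultimately show ?thesis by (simp add: power2_eq_square algebra_simps)
      qed
      ultimately show ?thesis by linarith
    qed
    finally show "(V - (LINT t|M. v t)) \<bullet> w \<le> (e + 2 * \<rho>) * norm w + (?c + 1) * (norm w)\<^sup>2"
      by (simp add: algebra_simps)
  qed
  then have "norm ((LINT t|M. v t) - V) \<le> e + d" using \<rho> by (simp add: norm_minus_commute)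
  moreover have "norm (m + h t - U) \<le> d" if t: "t \<in> space M" for t
  proof -
    have "norm (m + h t - U) \<le> norm (m - U) + norm (h t)"
      using norm_triangle_ineq[of "m - U" "h t"] by (simp add: algebra_simps)
    then show ?thesis using mU \<rho> minimizer_norm_le(2)[OF j(1) t h(2)[OF t]] j(2) by linarith
  qed
  ultimately show ?thesis
    using v_meas v_le minimizer_proximal_subgradient[OF j(1) _ h(2)]
    by (intro exI[of _ "\<lambda>t. m + h t"] exI[of _ v]) (auto simp: v_def)
qed

theorem limiting_subgradient_of_integral:
  assumes U: "U \<longlonglongrightarrow> u0" and V: "V \<longlonglongrightarrow> v0" and e: "e \<longlonglongrightarrow> 0" "\<And>k. 0 \<le> e k"
    and min: "\<And>k. \<exists>r>0. \<forall>u. norm (u - U k) \<le> r \<longrightarrow>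
       (LINT t|M. g t (U k)) + V k \<bullet> (u - U k) - e k * norm (u - U k) \<le> (LINT t|M. g t u)"
  shows "\<exists>f. integrable M f \<and> (LINT t|M. f t) = v0 \<and> (\<forall>t\<in>space M. f t \<in> proximal_limits (g t) u0)"
proof -
  have "\<exists>y v. v \<in> borel_measurable M \<and>
     (\<forall>t\<in>space M. norm (y t - U k) \<le> 1 / Suc k \<and> norm (v t) \<le> 2 * l t \<and> proximal_subgradient (g t) (y t) (v t)) \<and>
     norm ((LINT t|M. v t) - V k) \<le> e k + 1 / Suc k" for k
  proof -
    obtain r where r: "0 < r" "\<forall>u. norm (u - U k) \<le> r \<longrightarrow>
       (LINT t|M. g t (U k)) + V k \<bullet> (u - U k) - e k * norm (u - U k) \<le> (LINT t|M. g t u)"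
      using min by blast
    show ?thesis by (rule approximate_subgradient_selection[OF r(1) e(2)]) (use r(2) in auto)
  qed
  then obtain y v where v: "\<And>k. v k \<in> borel_measurable M"
    and yv: "\<And>k t. t \<in> space M \<Longrightarrow> norm (y k t - U k) \<le> 1 / Suc k"
      "\<And>k t. t \<in> space M \<Longrightarrow> norm (v k t) \<le> 2 * l t"
      "\<And>k t. t \<in> space M \<Longrightarrow> proximal_subgradient (g t) (y k t) (v k t)"
    and int: "\<And>k. norm ((LINT t|M. v k t) - V k) \<le> e k + 1 / Suc k"
    by metis
  have inv: "(\<lambda>k. 1 / real (Suc k)) \<longlonglongrightarrow> 0" by (rule lim_1_over_n[THEN LIMSEQ_Suc])
  have "(\<lambda>k. (LINT t|M. v k t) - V k) \<longlonglongrightarrow> 0"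
  proof (rule Lim_null_comparison)
    show "(\<lambda>k. e k + 1 / real (Suc k)) \<longlonglongrightarrow> 0" using tendsto_add[OF e(1) inv] by simp
  qed (use int in auto)
  from tendsto_add[OF this V] have lim: "(\<lambda>k. LINT t|M. v k t) \<longlonglongrightarrow> v0" by simp
  obtain f where f: "integrable M f" "(LINT t|M. f t) = v0"
    and fc: "\<And>t. t \<in> space M \<Longrightarrow> f t \<in> cluster_points (\<lambda>k. v k t)"
    using fatou_euclidean[of v "\<lambda>t. 2 * l t" v0, OF v _ yv(2) lim] integrable_l by auto
  show ?thesis
  proof (intro exI[of _ f] conjI ballI f)
    fix t assume t: "t \<in> space M"
    then obtain k where k: "\<And>i. i \<le> k i" "(\<lambda>i. v (k i) t) \<longlonglongrightarrow> f t"
      using fc by (auto simp: cluster_points_def)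
    have "(\<lambda>k. y k t - U k) \<longlonglongrightarrow> 0"
      by (rule Lim_null_comparison[OF _ inv]) (use yv(1)[OF t] in auto)
    from tendsto_add[OF this U] have "(\<lambda>k. y k t) \<longlonglongrightarrow> u0" by simp
    then have "(\<lambda>i. y (k i) t) \<longlonglongrightarrow> u0"
      by (rule filterlim_compose) (rule filterlim_at_top_ge[OF k(1)])
    then show "f t \<in> proximal_limits (g t) u0"
      unfolding proximal_limits_def
      by (intro CollectI exI[of _ "\<lambda>i. y (k i) t"] exI[of _ "\<lambda>i. v (k i) t"] conjI allI yv(3)[OF t] k(2))
  qed
qed

end

section \<open>Normal cones, coderivatives and Lipschitz-like behaviour\<close>

lemma regular_normal_cone_iff:
  "v \<in> regular_normal_cone x C \<longleftrightarrow>
     x \<in> C \<and> (\<forall>e>0. \<exists>d>0. \<forall>u\<in>C. norm (u - x) < d \<longrightarrow> v \<bullet> (u - x) \<le> e * norm (u - x))"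
proof (cases "x \<in> C")
  case x: True
  let ?q = "\<lambda>u. ereal (v \<bullet> (u - x) / norm (u - x))"
  have "Limsup (at x within C) ?q \<le> 0 \<longleftrightarrow>
    (\<forall>e>0. \<exists>d>0. \<forall>u\<in>C. norm (u - x) < d \<longrightarrow> v \<bullet> (u - x) \<le> e * norm (u - x))" (is "?L \<longleftrightarrow> ?R")
  proof
    assume ?L
    show ?R
    proof (intro allI impI)
      fix e :: real assume "0 < e"
      then have "Limsup (at x within C) ?q < ereal e" using \<open>?L\<close> by (simp add: le_less_trans)
      from Limsup_lessD[OF this] obtain d where d: "0 < d"
        "\<And>u. u \<in> C \<Longrightarrow> u \<noteq> x \<Longrightarrow> dist u x < d \<Longrightarrow> ?q u < ereal e"
        by (auto simp: eventually_at)
      have "v \<bullet> (u - x) \<le> e * norm (u - x)" if "u \<in> C" "norm (u - x) < d" for u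
        using d(2)[OF that(1)] that(2) by (cases "u = x") (auto simp: dist_norm field_simps)
      then show "\<exists>d>0. \<forall>u\<in>C. norm (u - x) < d \<longrightarrow> v \<bullet> (u - x) \<le> e * norm (u - x)"
        using d(1) by blast
    qed
  next
    assume R: ?R
    show ?L
      unfolding Limsup_le_iff
    proof (intro allI impI)
      fix y :: ereal assume "0 < y"
      then obtain e :: real where e: "0 < ereal e" "ereal e < y" using ereal_dense2 by blast
      then obtain d where d: "0 < d" "\<And>u. u \<in> C \<Longrightarrow> norm (u - x) < d \<Longrightarrow> v \<bullet> (u - x) \<le> e * norm (u - x)"
        using R by force
      have "?q u < y" if "u \<in> C" "u \<noteq> x" "dist u x < d" for u
      proof -
        have "v \<bullet> (u - x) / norm (u - x) \<le> e"
          using d(2)[of u] that by (simp add: dist_norm field_simps)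
        then have "?q u \<le> ereal e" by simp
        then show ?thesis using e(2) by (rule le_less_trans)
      qed
      then show "\<forall>\<^sub>F u in at x within C. ?q u < y"
        using d(1) by (auto simp: eventually_at)
    qed
  qed
  then show ?thesis using x by (simp add: regular_normal_cone_def)
qed (simp add: regular_normal_cone_def)

lemma proximal_normal_imp_regular:
  assumes "x \<in> C" "0 < r"
    and q: "\<And>u. u \<in> C \<Longrightarrow> norm (u - x) < r \<Longrightarrow> v \<bullet> (u - x) \<le> K * (norm (u - x))\<^sup>2"
  shows "v \<in> regular_normal_cone x C"
  unfolding regular_normal_cone_iff
proof (intro conjI allI impI \<open>x \<in> C\<close>)
  fix e :: real assume "0 < e"
  define d where "d = min r (e / (\<bar>K\<bar> + 1))"
  have d: "0 < d" "d \<le> r" using \<open>0 < r\<close> \<open>0 < e\<close> by (auto simp: d_def)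
  have "d \<le> e / (\<bar>K\<bar> + 1)" by (simp add: d_def)
  then have dK: "d * (\<bar>K\<bar> + 1) \<le> e" by (simp add: pos_le_divide_eq)
  have "v \<bullet> (u - x) \<le> e * norm (u - x)" if u: "u \<in> C" "norm (u - x) < d" for u
  proof -
    let ?n = "norm (u - x)"
    have "v \<bullet> (u - x) \<le> K * ?n\<^sup>2" using q u d by simp
    also have "K * ?n\<^sup>2 \<le> (\<bar>K\<bar> + 1) * ?n\<^sup>2" by (intro mult_right_mono) auto
    also have "\<dots> = ((\<bar>K\<bar> + 1) * ?n) * ?n" by (simp add: power2_eq_square)
    also have "\<dots> \<le> e * ?n"
    proof (intro mult_right_mono)
      have "(\<bar>K\<bar> + 1) * ?n \<le> (\<bar>K\<bar> + 1) * d" using u by (intro mult_left_mono) auto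
      then show "(\<bar>K\<bar> + 1) * ?n \<le> e" using dK by (simp add: mult.commute)
    qed simp
    finally show ?thesis .
  qed
  then show "\<exists>d>0. \<forall>u\<in>C. norm (u - x) < d \<longrightarrow> v \<bullet> (u - x) \<le> e * norm (u - x)" using d by blast
qed

lemma regular_normal_cone_scale:
  assumes "v \<in> regular_normal_cone x C" "0 < c"
  shows "c *\<^sub>R v \<in> regular_normal_cone x C"
  unfolding regular_normal_cone_iff
proof (intro conjI allI impI)
  show "x \<in> C" using assms(1) by (simp add: regular_normal_cone_iff)
  fix e :: real assume "0 < e"
  then have "0 < e / c" using assms by simp
  then obtain d where d: "0 < d" "\<And>u. u \<in> C \<Longrightarrow> norm (u - x) < d \<Longrightarrow> v \<bullet> (u - x) \<le> e / c * norm (u - x)"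
    using assms(1) unfolding regular_normal_cone_iff by blast
  have "(c *\<^sub>R v) \<bullet> (u - x) \<le> e * norm (u - x)" if "u \<in> C" "norm (u - x) < d" for u
    using d(2)[OF that] \<open>0 < c\<close> by (simp add: field_simps)
  then show "\<exists>d>0. \<forall>u\<in>C. norm (u - x) < d \<longrightarrow> (c *\<^sub>R v) \<bullet> (u - x) \<le> e * norm (u - x)" using d by blast
qed

lemma normal_coneI:
  assumes "\<And>k. vs k \<in> regular_normal_cone (xs k) C" "xs \<longlonglongrightarrow> x" "vs \<longlonglongrightarrow> v"
  shows "v \<in> normal_cone x C"
  using assms unfolding normal_cone_def by blast

lemma normal_coneE:
  assumes "v \<in> normal_cone x C"
  obtains xs vs where "\<And>k. vs k \<in> regular_normal_cone (xs k) C" "xs \<longlonglongrightarrow> x" "vs \<longlonglongrightarrow> v"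
  using assms unfolding normal_cone_def by blast

text \<open>The case \<open>c = 0\<close> is separate, since a point cannot be rescaled to the unit ball then.\<close>

lemma in_set_plus_ball_iff:
  fixes z :: "'a::real_normed_vector"
  assumes "0 \<le> c"
  shows "z \<in> A + (\<lambda>b. c *\<^sub>R b) ` cball 0 1 \<longleftrightarrow> (\<exists>a\<in>A. norm (z - a) \<le> c)"
proof
  assume "z \<in> A + (\<lambda>b. c *\<^sub>R b) ` cball 0 1"
  then obtain a b where "a \<in> A" "norm b \<le> 1" "z = a + c *\<^sub>R b" by (auto elim!: set_plus_elim)
  then show "\<exists>a\<in>A. norm (z - a) \<le> c" using assms by (intro bexI[of _ a]) (auto simp: mult_left_le)
next
  assume "\<exists>a\<in>A. norm (z - a) \<le> c"
  then obtain a where a: "a \<in> A" "norm (z - a) \<le> c" by blast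
  show "z \<in> A + (\<lambda>b. c *\<^sub>R b) ` cball 0 1"
  proof (cases "c = 0")
    case True
    then have "z = a + c *\<^sub>R 0" using a by simp
    moreover have "c *\<^sub>R (0::'a) \<in> (\<lambda>b. c *\<^sub>R b) ` cball 0 1" by (intro imageI) simp
    ultimately show ?thesis using a by (metis set_plus_intro)
  next
    case False
    have "z = a + c *\<^sub>R ((z - a) /\<^sub>R c)" using False by simp
    moreover have "c *\<^sub>R ((z - a) /\<^sub>R c) \<in> (\<lambda>b. c *\<^sub>R b) ` cball 0 1"
    proof (intro imageI)
      have "norm ((z - a) /\<^sub>R c) = norm (z - a) / c" using assms by (simp add: divide_inverse mult.commute)
      also have "\<dots> \<le> 1" using a False assms by simp
      finally show "(z - a) /\<^sub>R c \<in> cball 0 1" by simp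
    qed
    ultimately show ?thesis using a by (metis set_plus_intro)
  qed
qed

lemma lipschitz_like_iff:
  "lipschitz_like F x z \<longleftrightarrow>
     (\<exists>l\<ge>0. \<exists>U V. open U \<and> x \<in> U \<and> open V \<and> z \<in> V \<and>
        (\<forall>u\<in>U. \<forall>v\<in>U. \<forall>y\<in>F u \<inter> V. \<exists>y'\<in>F v. norm (y - y') \<le> l * norm (u - v)))"
proof -
  have eq: "(F u \<inter> V \<subseteq> F v + (\<lambda>b. (l * norm (u - v)) *\<^sub>R b) ` cball 0 1) =
    (\<forall>y\<in>F u \<inter> V. \<exists>y'\<in>F v. norm (y - y') \<le> l * norm (u - v))" if "0 \<le> l" for l u v V
  proof -
    have "0 \<le> l * norm (u - v)" using that by simp
    from in_set_plus_ball_iff[OF this] show ?thesis unfolding subset_iff by blast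
  qed
  show ?thesis
    unfolding lipschitz_like_def
  proof (rule arg_cong[where f = Ex], rule ext, rule conj_cong[OF refl])
    fix l :: real assume "0 \<le> l"
    show "(\<exists>U V. open U \<and> x \<in> U \<and> open V \<and> z \<in> V \<and>
        (\<forall>u\<in>U. \<forall>v\<in>U. F u \<inter> V \<subseteq> F v + (\<lambda>b. (l * norm (u - v)) *\<^sub>R b) ` cball 0 1)) =
      (\<exists>U V. open U \<and> x \<in> U \<and> open V \<and> z \<in> V \<and>
        (\<forall>u\<in>U. \<forall>v\<in>U. \<forall>y\<in>F u \<inter> V. \<exists>y'\<in>F v. norm (y - y') \<le> l * norm (u - v)))"
      unfolding eq[OF \<open>0 \<le> l\<close>] ..
  qed
qed

text \<open>Moving the base point by \<open>s *\<^sub>R p\<close>, where \<open>(p, q)\<close> is a regular normal, is answered within the graph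
  by a move of size at most \<open>l * norm (s *\<^sub>R p)\<close>. The normal inequality for this pair gives
  \<open>norm p \<le> l * norm q\<close> for all regular normals near the reference point, and this passes to limits.\<close>

lemma coderivative_zero_if_lipschitz_like:
  assumes F: "lipschitz_like F x0 z0" and v: "v \<in> coderivative F x0 z0 0"
  shows "v = 0"
proof -
  obtain l U V where l: "0 \<le> l" and U: "open U" "x0 \<in> U" and V: "open V" "z0 \<in> V"
    and lip0: "\<forall>u\<in>U. \<forall>v\<in>U. \<forall>y\<in>F u \<inter> V. \<exists>y'\<in>F v. norm (y - y') \<le> l * norm (u - v)"
    using F unfolding lipschitz_like_iff by (elim exE conjE)
  have lip: "\<exists>y'\<in>F v. norm (y - y') \<le> l * norm (u - v)" if "u \<in> U" "v \<in> U" "y \<in> F u \<inter> V" for u v y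
    using lip0 that by blast
  have "(v, 0) \<in> normal_cone (x0, z0) (gph F)" using v by (simp add: coderivative_def)
  then obtain xs vs where N: "\<And>k. vs k \<in> regular_normal_cone (xs k) (gph F)"
    and lim: "xs \<longlonglongrightarrow> (x0, z0)" "vs \<longlonglongrightarrow> (v, 0)" by (rule normal_coneE) blast
  have bound: "norm (fst (vs k)) \<le> l * norm (snd (vs k))" if xU: "fst (xs k) \<in> U" "snd (xs k) \<in> V" for k
  proof (cases "fst (vs k) = 0")
    case True then show ?thesis using l by simp
  next
    case False
    define x y p q where "x = fst (xs k)" "y = snd (xs k)" "p = fst (vs k)" "q = snd (vs k)"
    have eq: "xs k = (x, y)" "vs k = (p, q)" by (simp_all add: x_y_p_q_def)
    have p0: "0 < norm p" using False by (simp add: x_y_p_q_def)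
    have xy: "y \<in> F x" "x \<in> U" "y \<in> V"
    proof -
      have "xs k \<in> gph F" using N[of k] by (simp add: regular_normal_cone_iff)
      then show "y \<in> F x" unfolding eq by (simp add: gph_def)
    qed (use xU in \<open>simp_all add: x_y_p_q_def\<close>)
    have "norm p \<le> l * norm q + e" if "0 < e" for e
    proof -
      let ?e = "e / (1 + l)"
      have e: "0 < ?e" using that l by simp
      then obtain d where d: "0 < d" "\<And>u. u \<in> gph F \<Longrightarrow> norm (u - (x, y)) < d \<Longrightarrow>
          (p, q) \<bullet> (u - (x, y)) \<le> ?e * norm (u - (x, y))"
        using N[of k] unfolding eq regular_normal_cone_iff by blast
      obtain r where r: "0 < r" "ball x r \<subseteq> U" using U xy by (meson open_contains_ball)
      define s where "s = min (r / 2) (d / (2 * (1 + l))) / norm p"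
      have s: "0 < s" using r d l p0 by (simp add: s_def)
      have sp: "s * norm p \<le> r / 2" "s * norm p \<le> d / (2 * (1 + l))" 
      proof -
        have "s * norm p = min (r / 2) (d / (2 * (1 + l)))" using p0 by (simp add: s_def)
        then show "s * norm p \<le> r / 2" "s * norm p \<le> d / (2 * (1 + l))" by (simp_all only: min.cobounded1 min.cobounded2)
      qed
      let ?u = "x + s *\<^sub>R p"
      have "?u \<in> U" using r sp s by (intro subsetD[OF r(2)]) (simp add: dist_norm)
      then obtain y' where y': "y' \<in> F ?u" "norm (y - y') \<le> l * norm (x - ?u)"
        using lip[OF xy(2), of ?u y] xy by auto
      then have ny: "norm (y' - y) \<le> l * (s * norm p)" using s by (simp add: norm_minus_commute)
      have diff: "(?u, y') - (x, y) = (s *\<^sub>R p, y' - y)" by simp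
      have n: "norm ((?u, y') - (x, y)) \<le> (1 + l) * (s * norm p)"
      proof -
        have "norm ((?u, y') - (x, y)) \<le> norm (s *\<^sub>R p) + norm (y' - y)"
          unfolding diff by (rule norm_Pair_le)
        then show ?thesis using ny s by (simp add: algebra_simps)
      qed
      have "(1 + l) * (s * norm p) \<le> d / 2"
        using sp(2) l by (simp add: field_simps)
      then have "norm ((?u, y') - (x, y)) < d" using n d(1) by linarith
      then have "(p, q) \<bullet> ((?u, y') - (x, y)) \<le> ?e * norm ((?u, y') - (x, y))"
        using y' by (intro d) (auto simp: gph_def)
      also have "\<dots> \<le> ?e * ((1 + l) * (s * norm p))" using n e by (intro mult_left_mono) auto
      also have "\<dots> = e * (s * norm p)" using l by (simp add: field_simps)
      finally have "s * (p \<bullet> p) + q \<bullet> (y' - y) \<le> e * (s * norm p)" unfolding diff by simp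
      moreover have "- (norm q * (l * (s * norm p))) \<le> q \<bullet> (y' - y)"
      proof -
        have "\<bar>q \<bullet> (y' - y)\<bar> \<le> norm q * norm (y' - y)" by (rule Cauchy_Schwarz_ineq2)
        also have "\<dots> \<le> norm q * (l * (s * norm p))" using ny by (intro mult_left_mono) auto
        finally show ?thesis by linarith
      qed
      ultimately have "(s * norm p) * norm p \<le> (s * norm p) * (l * norm q + e)"
        by (simp add: power2_norm_eq_inner[symmetric] power2_eq_square algebra_simps)
      then show ?thesis using s p0 by simp
    qed
    then have "norm p \<le> l * norm q" by (rule field_le_epsilon)
    then show ?thesis by (simp add: x_y_p_q_def)
  qed
  have "\<forall>\<^sub>F k in sequentially. fst (xs k) \<in> U"
    using tendsto_fst[OF lim(1)] U by (intro topological_tendstoD) auto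
  moreover have "\<forall>\<^sub>F k in sequentially. snd (xs k) \<in> V"
    using tendsto_snd[OF lim(1)] V by (intro topological_tendstoD) auto
  ultimately have "\<forall>\<^sub>F k in sequentially. norm (fst (vs k)) \<le> l * norm (snd (vs k))"
    by eventually_elim (rule bound)
  moreover have "(\<lambda>k. norm (fst (vs k))) \<longlonglongrightarrow> norm v"
    using tendsto_norm[OF tendsto_fst[OF lim(2)]] by simp
  moreover have "(\<lambda>k. l * norm (snd (vs k))) \<longlonglongrightarrow> l * norm (0::'b)"
    using tendsto_mult_left[OF tendsto_norm[OF tendsto_snd[OF lim(2)]], of l] by simp
  ultimately have "norm v \<le> l * norm (0::'b)" by (intro tendsto_le[of sequentially]) auto
  then show ?thesis by simp
qed

text \<open>The square root lies below its tangents.\<close>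

lemma norm_le_tangent:
  fixes a w :: "'a::real_inner"
  assumes "a \<noteq> 0"
  shows "norm (a + w) \<le> norm a + (a /\<^sub>R norm a) \<bullet> w + (norm w)\<^sup>2 / (2 * norm a)"
proof -
  let ?s = "norm a"
  have s: "0 < ?s" using assms by simp
  have "0 \<le> (norm (a + w) - ?s)\<^sup>2" by simp
  then have "2 * ?s * norm (a + w) \<le> (norm (a + w))\<^sup>2 + ?s\<^sup>2" by (simp add: power2_eq_square algebra_simps)
  also have "(norm (a + w))\<^sup>2 = ?s\<^sup>2 + 2 * (a \<bullet> w) + (norm w)\<^sup>2"
    by (simp add: power2_norm_eq_inner inner_add_left inner_add_right inner_commute)
  finally have "norm (a + w) \<le> (?s\<^sup>2 + ?s\<^sup>2 + 2 * (a \<bullet> w) + (norm w)\<^sup>2) / (2 * ?s)"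
    using s by (simp add: field_simps)
  also have "\<dots> = ?s + (a /\<^sub>R ?s) \<bullet> w + (norm w)\<^sup>2 / (2 * ?s)"
    using s by (simp add: field_simps power2_eq_square)
  finally show ?thesis .
qed

text \<open>Mordukhovich's criterion. If it fails, there are \<open>z \<in> F x\<close> with distance greater than
  \<open>K * \<epsilon>\<close> to \<open>F x'\<close>, where \<open>\<epsilon> = norm (x - x')\<close>. Minimize \<open>norm (p - x') + c * (norm (q - z))\<^sup>2\<close> over the points
  \<open>(p, q)\<close> of the graph near the reference point. The value at \<open>(x, z)\<close> is \<open>\<epsilon>\<close>, and \<open>c = 1 / (K\<^sup>2 * \<epsilon>)\<close> is chosen
  such that the minimizer \<open>(a, b)\<close> satisfies \<open>norm (b - z) \<le> K * \<epsilon>\<close>. Therefore \<open>a \<noteq> x'\<close>, the function is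
  smooth at \<open>(a, b)\<close>, and its negative gradient is a regular normal whose first component has norm
  \<open>1\<close> and whose second component has norm at most \<open>2 / K\<close>. In the limit the coderivative at \<open>0\<close> contains
  a unit vector.\<close>

lemma lipschitz_like_if_coderivative_zero:
  fixes F :: "'a::euclidean_space \<Rightarrow> 'b::euclidean_space set"
  assumes z0: "z0 \<in> F x0" and "0 < r" and cl: "closed (gph F \<inter> cball (x0, z0) r)"
    and D: "\<And>v. v \<in> coderivative F x0 z0 0 \<Longrightarrow> v = 0"
  shows "lipschitz_like F x0 z0"
proof (rule ccontr)
  assume nl: "\<not> lipschitz_like F x0 z0"
  have "\<exists>x z v q. (v, q) \<in> regular_normal_cone (x, z) (gph F) \<and> norm v = 1 \<and> norm q \<le> 2 / Suc k \<and>
      norm (x - x0) \<le> 3 / Suc k \<and> norm (z - z0) \<le> 3 / Suc k" for k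
  proof -
    define K where "K = real (Suc k)"
    have K: "1 \<le> K" by (simp add: K_def)
    \<comment> \<open>\<open>r / (8 * K)\<close> keeps the minimizer inside the ball, \<open>1 / K\<^sup>2\<close> makes \<open>K * \<epsilon>\<close> small\<close>
    define d where "d = min (r / (8 * K)) (1 / K\<^sup>2)"
    have d: "0 < d" "8 * K * d \<le> r" "K * d \<le> 1 / K" "d \<le> 1 / K"
    proof -
      show "0 < d" using K \<open>0 < r\<close> by (simp add: d_def)
      have "d \<le> r / (8 * K)" "d \<le> 1 / K\<^sup>2" by (auto simp: d_def)
      then show "8 * K * d \<le> r" "K * d \<le> 1 / K" using K by (auto simp: field_simps power2_eq_square)
      have "d \<le> K * d" using K \<open>0 < d\<close> by (simp add: mult_ge1_I)
      then show "d \<le> 1 / K" using \<open>K * d \<le> 1 / K\<close> by linarith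
    qed
    have dK: "d \<le> K * d" using K d by (simp add: mult_ge1_I)
    obtain x x' z where x: "x \<in> ball x0 d" "x' \<in> ball x0 d" and z: "z \<in> F x" "z \<in> ball z0 d"
      and far: "\<And>y'. y' \<in> F x' \<Longrightarrow> K * norm (x - x') < norm (z - y')"
    proof -
      have "\<exists>x\<in>ball x0 d. \<exists>x'\<in>ball x0 d. \<exists>z\<in>F x \<inter> ball z0 d. \<forall>y'\<in>F x'. \<not> norm (z - y') \<le> K * norm (x - x')"
      proof (rule ccontr)
        assume "\<not> ?thesis"
        then have "lipschitz_like F x0 z0" unfolding lipschitz_like_iff
          using K d by (intro exI[of _ K] conjI exI[of _ "ball x0 d"] exI[of _ "ball z0 d"]) auto
        then show False using nl by blast
      qed
      then show ?thesis using that by (meson IntE not_le)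
    qed
    define \<epsilon> where "\<epsilon> = norm (x - x')"
    have \<epsilon>: "0 < \<epsilon>" using far[of z] z by (auto simp: \<epsilon>_def)
    have nx: "norm (x - x0) < d" "norm (x' - x0) < d" "norm (z - z0) < d"
      using x z by (auto simp: dist_norm norm_minus_commute)
    have \<epsilon>2: "\<epsilon> \<le> 2 * d"
      using norm_triangle_ineq4[of "x - x0" "x' - x0"] nx by (simp add: \<epsilon>_def)
    define c where "c = 1 / (K\<^sup>2 * \<epsilon>)"
    have c: "0 < c" using K \<epsilon> by (simp add: c_def)
    let ?C = "gph F \<inter> cball (x0, z0) r"
    define f where "f p = norm (fst p - x') + c * (norm (snd p - z))\<^sup>2" for p
    have "compact ?C" using cl by (metis compact_cball closed_Int_compact inf.right_idem inf_commute inf_left_commute)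
    moreover have xzC: "(x, z) \<in> ?C"
    proof -
      have "norm ((x, z) - (x0, z0)) \<le> norm (x - x0) + norm (z - z0)" using norm_Pair_le[of "x - x0" "z - z0"] by simp
      also have "\<dots> \<le> 2 * d" using nx by simp
      also have "\<dots> \<le> 8 * K * d" using dK d(1) by linarith
      also have "\<dots> \<le> r" by (rule d)
      finally show ?thesis using z by (simp add: gph_def dist_norm norm_minus_commute[of "(x0, z0)"] del: diff_Pair)
    qed
    moreover have "continuous_on ?C f" unfolding f_def by (intro continuous_intros)
    ultimately obtain m where m: "m \<in> ?C" "\<And>p. p \<in> ?C \<Longrightarrow> f m \<le> f p"
      using continuous_attains_inf[of ?C f] by blast
    define a b where "a = fst m" "b = snd m"
    have mab: "m = (a, b)" by (simp add: a_b_def)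
    have fm: "norm (a - x') + c * (norm (b - z))\<^sup>2 \<le> \<epsilon>"
      using m(2)[OF xzC] by (simp add: f_def mab \<epsilon>_def)
    have ax: "norm (a - x') \<le> \<epsilon>" using fm c by (smt (verit) mult_nonneg_nonneg zero_le_power2)
    have bz: "norm (b - z) \<le> K * \<epsilon>"
    proof -
      have "c * (norm (b - z))\<^sup>2 \<le> \<epsilon>" using fm norm_ge_zero[of "a - x'"] by linarith
      then have "(norm (b - z))\<^sup>2 \<le> (K * \<epsilon>)\<^sup>2" using K \<epsilon> by (simp add: c_def field_simps power2_eq_square)
      then show ?thesis by (rule power2_le_imp_le) (use K \<epsilon> in simp)
    qed
    have ne: "a \<noteq> x'"
    proof
      assume "a = x'"
      then have "b \<in> F x'" using m(1) by (simp add: mab gph_def)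
      from far[OF this] bz show False by (simp add: \<epsilon>_def norm_minus_commute)
    qed
    have a0: "norm (a - x0) \<le> 3 * d"
      using norm_triangle_ineq[of "a - x'" "x' - x0"] ax nx \<epsilon>2 by simp
    have b0: "norm (b - z0) \<le> 3 * (K * d)"
    proof -
      have "norm (b - z0) \<le> norm (b - z) + norm (z - z0)" using norm_triangle_ineq[of "b - z" "z - z0"] by simp
      also have "\<dots> \<le> K * (2 * d) + d" using bz nx mult_left_mono[OF \<epsilon>2, of K] K by linarith
      finally show ?thesis using dK by linarith
    qed
    have int: "norm (m - (x0, z0)) \<le> 6 * (K * d)"
      using norm_Pair_le[of "a - x0" "b - z0"] a0 b0 dK by (simp add: mab)
    let ?e = "(a - x') /\<^sub>R norm (a - x')"
    let ?v = "(- ?e, - (2 * c) *\<^sub>R (b - z))"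
    have "?v \<in> regular_normal_cone m (gph F)"
    proof (rule proximal_normal_imp_regular)
      show "m \<in> gph F" using m by simp
      show "0 < K * d" using K d by simp
      fix u assume u: "u \<in> gph F" "norm (u - m) < K * d"
      have "norm (u - (x0, z0)) \<le> norm (u - m) + norm (m - (x0, z0))"
        using dist_triangle[of u "(x0, z0)" m] unfolding dist_norm .
      moreover have "0 < K * d" using K d by simp
      ultimately have "norm (u - (x0, z0)) \<le> r" using u(2) int d(2) by linarith
      then have "u \<in> ?C" using u(1) by (simp add: dist_norm norm_minus_commute)
      from m(2)[OF this] have le: "f m \<le> f u" .
      define p q where "p = fst u - a" "q = snd u - b"
      have up: "u - m = (p, q)" by (simp add: p_q_def mab prod_eq_iff)
      have sq: "(norm (u - m))\<^sup>2 = (norm p)\<^sup>2 + (norm q)\<^sup>2" unfolding up by (simp add: norm_Pair)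
      have "f u = norm ((a - x') + p) + c * (norm ((b - z) + q))\<^sup>2"
        by (simp add: f_def p_q_def)
      also have "\<dots> \<le> (norm (a - x') + ?e \<bullet> p + (norm p)\<^sup>2 / (2 * norm (a - x'))) + c * ((norm (b - z))\<^sup>2 + 2 * ((b - z) \<bullet> q) + (norm q)\<^sup>2)"
      proof (intro add_mono mult_left_mono)
        show "norm ((a - x') + p) \<le> norm (a - x') + ?e \<bullet> p + (norm p)\<^sup>2 / (2 * norm (a - x'))"
          using ne by (intro norm_le_tangent) simp
        show "(norm ((b - z) + q))\<^sup>2 \<le> (norm (b - z))\<^sup>2 + 2 * ((b - z) \<bullet> q) + (norm q)\<^sup>2"
          unfolding power2_norm_eq_inner inner_add_left inner_add_right by (simp add: inner_commute)
      qed (use c in auto)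
      finally have "0 \<le> ?e \<bullet> p + (norm p)\<^sup>2 / (2 * norm (a - x')) + c * (2 * ((b - z) \<bullet> q) + (norm q)\<^sup>2)"
        using le by (simp add: f_def mab algebra_simps)
      then have "?v \<bullet> (u - m) \<le> (norm p)\<^sup>2 / (2 * norm (a - x')) + c * (norm q)\<^sup>2"
        unfolding up by (simp add: algebra_simps)
      also have "\<dots> \<le> (1 / (2 * norm (a - x')) + c) * (norm (u - m))\<^sup>2"
        unfolding sq using c by (simp add: algebra_simps)
      finally show "?v \<bullet> (u - m) \<le> (1 / (2 * norm (a - x')) + c) * (norm (u - m))\<^sup>2" .
    qed
    moreover have "norm (- ?e) = 1" using ne by simp
    moreover have "norm (- (2 * c) *\<^sub>R (b - z)) \<le> 2 / Suc k"
    proof -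
      have "norm (- (2 * c) *\<^sub>R (b - z)) = 2 * c * norm (b - z)" using c by simp
      also have "\<dots> \<le> 2 * c * (K * \<epsilon>)" using bz c by (intro mult_left_mono) auto
      also have "\<dots> = 2 / K" using K \<epsilon> by (simp add: c_def field_simps power2_eq_square)
      finally show ?thesis by (simp add: K_def)
    qed
    moreover have "norm (a - x0) \<le> 3 / Suc k" using a0 d(4) by (simp add: K_def)
    moreover have "norm (b - z0) \<le> 3 / Suc k" using b0 d(3) by (simp add: K_def)
    ultimately show ?thesis unfolding mab by blast
  qed
  then obtain x z v q where N: "\<And>k. (v k, q k) \<in> regular_normal_cone (x k, z k) (gph F)"
    and v: "\<And>k. norm (v k) = 1" and q: "\<And>k. norm (q k) \<le> 2 / Suc k"
    and xz: "\<And>k. norm (x k - x0) \<le> 3 / Suc k" "\<And>k. norm (z k - z0) \<le> 3 / Suc k" by metis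
  have inv: "(\<lambda>k. c / real (Suc k)) \<longlonglongrightarrow> 0" for c :: real
    using tendsto_mult_left[OF lim_1_over_n[THEN LIMSEQ_Suc], of c] by simp
  have "(\<lambda>k. x k - x0) \<longlonglongrightarrow> 0" "(\<lambda>k. z k - z0) \<longlonglongrightarrow> 0" and q0: "q \<longlonglongrightarrow> 0"
    by (rule Lim_null_comparison[OF always_eventually[OF allI[OF xz(1)]] inv]
        Lim_null_comparison[OF always_eventually[OF allI[OF xz(2)]] inv]
        Lim_null_comparison[OF always_eventually[OF allI[OF q]] inv])+
  then have lim: "x \<longlonglongrightarrow> x0" "z \<longlonglongrightarrow> z0" by (simp_all add: LIM_zero_iff)
  have "bounded (range v)" using v by (auto simp: bounded_iff intro!: exI[of _ 1])
  then obtain w s where s: "strict_mono s" "(v \<circ> s) \<longlonglongrightarrow> w"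
    using bounded_imp_convergent_subsequence by blast
  have "(w, 0) \<in> normal_cone (x0, z0) (gph F)"
  proof (rule normal_coneI)
    show "(v (s k), q (s k)) \<in> regular_normal_cone (x (s k), z (s k)) (gph F)" for k by (rule N)
    show "(\<lambda>k. (x (s k), z (s k))) \<longlonglongrightarrow> (x0, z0)" "(\<lambda>k. (v (s k), q (s k))) \<longlonglongrightarrow> (w, 0)"
      using LIMSEQ_subseq_LIMSEQ[OF lim(1) s(1)] LIMSEQ_subseq_LIMSEQ[OF lim(2) s(1)]
        LIMSEQ_subseq_LIMSEQ[OF q0 s(1)] s(2) by (auto intro!: tendsto_Pair simp: o_def)
  qed
  then have "w = 0" by (intro D) (simp add: coderivative_def)
  moreover have "(\<lambda>k. norm ((v \<circ> s) k)) \<longlonglongrightarrow> norm w" by (rule tendsto_norm[OF s(2)])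
  then have "norm w = 1" using v by (simp add: LIMSEQ_const_iff)
  ultimately show False by simp
qed

lemma regular_normal_cone_swap:
  assumes "(a, b) \<in> regular_normal_cone (x, y) C"
  shows "(b, a) \<in> regular_normal_cone (y, x) (prod.swap ` C)"
proof -
  have n: "norm ((p, q) - (y, x)) = norm ((q, p) - (x, y))" for p q
    by (simp add: norm_Pair add.commute)
  show ?thesis
    unfolding regular_normal_cone_iff
  proof (intro conjI allI impI)
    show "(y, x) \<in> prod.swap ` C" using assms by (force simp: regular_normal_cone_iff)
    fix e :: real assume "0 < e"
    then obtain d where d: "0 < d" "\<And>u. u \<in> C \<Longrightarrow> norm (u - (x, y)) < d \<Longrightarrow> (a, b) \<bullet> (u - (x, y)) \<le> e * norm (u - (x, y))"
      using assms unfolding regular_normal_cone_iff by blast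
    show "\<exists>d>0. \<forall>u\<in>prod.swap ` C. norm (u - (y, x)) < d \<longrightarrow> (b, a) \<bullet> (u - (y, x)) \<le> e * norm (u - (y, x))"
    proof (intro exI[of _ d] conjI ballI impI d(1))
      fix u assume "u \<in> prod.swap ` C" and n': "norm (u - (y, x)) < d"
      then obtain p q where u: "u = (q, p)" "(p, q) \<in> C" by force
      show "(b, a) \<bullet> (u - (y, x)) \<le> e * norm (u - (y, x))"
        using d(2)[OF u(2)] n' unfolding u(1) n by simp
    qed
  qed
qed

lemma coderivative_inverse:
  assumes "v \<in> coderivative (\<lambda>z. {x. z \<in> F x}) z0 x0 0"
  shows "0 \<in> coderivative F x0 z0 (- v)"
proof -
  have "(v, 0) \<in> normal_cone (z0, x0) (gph (\<lambda>z. {x. z \<in> F x}))" using assms by (simp add: coderivative_def)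
  then obtain xs vs where N: "\<And>k. vs k \<in> regular_normal_cone (xs k) (gph (\<lambda>z. {x. z \<in> F x}))"
    and lim: "xs \<longlonglongrightarrow> (z0, x0)" "vs \<longlonglongrightarrow> (v, 0)" by (rule normal_coneE) blast
  have swap: "prod.swap ` gph (\<lambda>z. {x. z \<in> F x}) = gph F" by (force simp: gph_def)
  have "(0, v) \<in> normal_cone (x0, z0) (gph F)"
  proof (rule normal_coneI)
    show "(snd (vs k), fst (vs k)) \<in> regular_normal_cone (snd (xs k), fst (xs k)) (gph F)" for k
      using regular_normal_cone_swap[of "fst (vs k)" "snd (vs k)" "fst (xs k)" "snd (xs k)"] N[of k]
      unfolding swap[symmetric] prod.collapse by blast
    show "(\<lambda>k. (snd (xs k), fst (xs k))) \<longlonglongrightarrow> (x0, z0)" "(\<lambda>k. (snd (vs k), fst (vs k))) \<longlonglongrightarrow> (0, v)"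
      using tendsto_fst[OF lim(1)] tendsto_snd[OF lim(1)] tendsto_fst[OF lim(2)] tendsto_snd[OF lim(2)]
      by (auto intro!: tendsto_Pair)
  qed
  then show ?thesis by (simp add: coderivative_def)
qed

text \<open>For points \<open>y \<in> F u\<close> close to \<open>v\<close> the estimate is the Lipschitz-like property of the inverse. A
  point \<open>y\<close> at distance at least \<open>r\<close> contributes a right-hand side of at least \<open>(l + 1) * r\<close>, and the
  distance from \<open>u\<close> to the preimage of \<open>v\<close> is at most this, by comparison with the reference point.\<close>

lemma metrically_regular_if_inverse_lipschitz_like:
  fixes F :: "'a::euclidean_space \<Rightarrow> 'b::euclidean_space set"
  assumes L: "lipschitz_like (\<lambda>z. {x. z \<in> F x}) z0 x0" and z0: "z0 \<in> F x0"
  shows "metrically_regular F x0 z0"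
proof -
  obtain l V U where l: "0 \<le> l" and V: "open V" "z0 \<in> V" and U: "open U" "x0 \<in> U"
    and lip0: "\<forall>z\<in>V. \<forall>z'\<in>V. \<forall>x\<in>{x. z \<in> F x} \<inter> U. \<exists>x'\<in>{x. z' \<in> F x}. norm (x - x') \<le> l * norm (z - z')"
    using L unfolding lipschitz_like_iff by (elim exE conjE)
  have lip: "\<And>z z' x. z \<in> V \<Longrightarrow> z' \<in> V \<Longrightarrow> z \<in> F x \<Longrightarrow> x \<in> U \<Longrightarrow> \<exists>x'. z' \<in> F x' \<and> norm (x - x') \<le> l * norm (z - z')"
    using lip0 by blast
  obtain r where r: "0 < r" "ball z0 (2 * r) \<subseteq> V"
  proof -
    obtain e where "0 < e" "ball z0 e \<subseteq> V" using V by (meson open_contains_ball)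
    then show ?thesis using that[of "e / 2"] by simp
  qed
  have le: "dist_to_set u A \<le> ereal c" if "a \<in> A" "norm (u - a) \<le> c" for u a :: 'a and A c
    unfolding dist_to_set_def using that by (intro INF_lower2[of a]) (auto simp: dist_norm)
  show ?thesis
    unfolding metrically_regular_def
  proof (intro exI[of _ "l + 1"] conjI exI[of _ "U \<inter> ball x0 (r / 2)"] exI[of _ "ball z0 (r / 2)"] ballI)
    show "0 \<le> l + 1" "open (U \<inter> ball x0 (r / 2))" "x0 \<in> U \<inter> ball x0 (r / 2)" "open (ball z0 (r / 2))"
      "z0 \<in> ball z0 (r / 2)" using l U r by auto
    fix u v assume u: "u \<in> U \<inter> ball x0 (r / 2)" and v: "v \<in> ball z0 (r / 2)"
    have vV: "v \<in> V" using v r by auto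
    have far: "dist_to_set u {u'. v \<in> F u'} \<le> ereal (l + 1) * ereal r"
    proof -
      obtain x' where x': "v \<in> F x'" "norm (x0 - x') \<le> l * norm (z0 - v)"
        using lip[OF V(2) vV z0 U(2)] by blast
      have "norm (u - x') \<le> norm (u - x0) + norm (x0 - x')" using norm_triangle_ineq[of "u - x0" "x0 - x'"] by simp
      also have "\<dots> \<le> r / 2 + l * (r / 2)"
      proof (intro add_mono)
        show "norm (u - x0) \<le> r / 2" using u by (simp add: dist_norm norm_minus_commute)
        have "norm (z0 - v) \<le> r / 2" using v by (simp add: dist_norm)
        then show "norm (x0 - x') \<le> l * (r / 2)" using x'(2) l by (meson mult_left_mono order_trans)
      qed
      also have "\<dots> \<le> (l + 1) * r"
      proof -
        have "0 \<le> l * r" using l r by simp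
        then show ?thesis using r by (simp add: algebra_simps)
      qed
      finally have "dist_to_set u {u'. v \<in> F u'} \<le> ereal ((l + 1) * r)" using x' by (intro le) auto
      then show ?thesis by simp
    qed
    have each: "dist_to_set u {u'. v \<in> F u'} \<le> ereal (l + 1) * ereal (dist v y)" if y: "y \<in> F u" for y
    proof (cases "dist v y < r")
      case True
      have "dist z0 y < 2 * r" using dist_triangle[of z0 y v] True v r by simp
      then have "y \<in> V" using r by auto
      then obtain x' where x': "v \<in> F x'" "norm (u - x') \<le> l * norm (y - v)"
        using lip[OF _ vV y] u by blast
      have "norm (u - x') \<le> (l + 1) * dist v y"
      proof -
        have "l * norm (y - v) \<le> (l + 1) * norm (y - v)" by (intro mult_right_mono) auto
        with x'(2) show ?thesis by (simp add: dist_norm norm_minus_commute)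
      qed
      then have "dist_to_set u {u'. v \<in> F u'} \<le> ereal ((l + 1) * dist v y)" using x' by (intro le) auto
      then show ?thesis by simp
    next
      case False
      have "ereal (l + 1) * ereal r \<le> ereal (l + 1) * ereal (dist v y)"
        using False l by (simp add: mult_left_mono)
      then show ?thesis using far by (rule order_trans[rotated])
    qed
    have pos: "0 < ereal (l + 1)" "ereal (l + 1) < \<infinity>" using l by auto
    have "dist_to_set u {u'. v \<in> F u'} / ereal (l + 1) \<le> dist_to_set v (F u)"
      unfolding dist_to_set_def[of v]
    proof (rule INF_greatest)
      fix y assume "y \<in> F u"
      from each[OF this] show "dist_to_set u {u'. v \<in> F u'} / ereal (l + 1) \<le> ereal (dist v y)"
        using pos by (simp add: ereal_divide_le_pos mult.commute)
    qed
    then show "dist_to_set u {u'. v \<in> F u'} \<le> ereal (l + 1) * dist_to_set v (F u)"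
      using pos by (simp add: ereal_divide_le_pos mult.commute)
  qed
qed

lemma regular_normal_cone_local:
  assumes v: "v \<in> regular_normal_cone x C" and W: "open W" "x \<in> W" and eq: "C \<inter> W = D \<inter> W"
  shows "v \<in> regular_normal_cone x D"
  unfolding regular_normal_cone_iff
proof (intro conjI allI impI)
  show "x \<in> D" using v W eq by (auto simp: regular_normal_cone_iff)
  fix e :: real assume "0 < e"
  then obtain d where d: "0 < d" "\<And>u. u \<in> C \<Longrightarrow> norm (u - x) < d \<Longrightarrow> v \<bullet> (u - x) \<le> e * norm (u - x)"
    using v unfolding regular_normal_cone_iff by blast
  obtain r where r: "0 < r" "ball x r \<subseteq> W" using W by (meson open_contains_ball)
  show "\<exists>d>0. \<forall>u\<in>D. norm (u - x) < d \<longrightarrow> v \<bullet> (u - x) \<le> e * norm (u - x)"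
  proof (intro exI[of _ "min d r"] conjI ballI impI)
    fix u assume u: "u \<in> D" "norm (u - x) < min d r"
    then have "u \<in> W" by (intro subsetD[OF r(2)]) (simp add: dist_norm norm_minus_commute)
    then have "u \<in> C" using u eq by blast
    then show "v \<bullet> (u - x) \<le> e * norm (u - x)" using d u by simp
  qed (use d r in simp)
qed

text \<open>A quadratic minorant of \<open>g\<close> that touches at \<open>y\<close> with slope \<open>v\<close> bounds the epigraph of \<open>f\<close> from below
  near \<open>(y, f y)\<close>, and so \<open>(v, - 1)\<close> is a proximal normal to the epigraph there. Continuity makes these
  points converge to \<open>(u0, f u0)\<close>.\<close>

lemma proximal_limits_subset_subdifferential:
  fixes f g :: "'a::euclidean_space \<Rightarrow> real"
  assumes v: "v \<in> proximal_limits g u0" and "0 < \<eta>"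
    and eq: "\<And>u. u \<in> cball u0 \<eta> \<Longrightarrow> f u = g u" and cont: "isCont g u0"
  shows "v \<in> subdifferential f u0"
proof -
  obtain ys vs where prox: "\<And>k :: nat. proximal_subgradient g (ys k) (vs k)"
    and lim: "ys \<longlonglongrightarrow> u0" "vs \<longlonglongrightarrow> v" using v unfolding proximal_limits_def by blast
  have "\<forall>\<^sub>F k in sequentially. dist (ys k) u0 < \<eta>" using lim(1) \<open>0 < \<eta>\<close> by (rule tendstoD)
  then obtain N where N: "\<And>k. N \<le> k \<Longrightarrow> dist (ys k) u0 < \<eta>" by (auto simp: eventually_sequentially)
  define y where "y k = ys (k + N)" for k
  define p where "p k = vs (k + N)" for k
  have y: "dist (y k) u0 < \<eta>" for k using N by (simp add: y_def)
  have ylim: "y \<longlonglongrightarrow> u0" and plim: "p \<longlonglongrightarrow> v"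
    unfolding y_def p_def using lim by (auto intro: LIMSEQ_ignore_initial_segment)
  have fg: "f u = g u" if "dist u u0 \<le> \<eta>" for u using that by (intro eq) (simp add: dist_commute)
  have "(v, - 1) \<in> normal_cone (u0, f u0) (epigraph UNIV f)"
  proof (rule normal_coneI)
    show "(p k, - 1) \<in> regular_normal_cone (y k, f (y k)) (epigraph UNIV f)" for k
    proof -
      obtain C where C: "\<And>u. g (y k) + p k \<bullet> (u - y k) - C * (norm (u - y k))\<^sup>2 \<le> g u"
        using prox[of "k + N"] unfolding proximal_subgradient_def y_def p_def by blast
      show ?thesis
      proof (rule proximal_normal_imp_regular)
        show "(y k, f (y k)) \<in> epigraph UNIV f" by (simp add: epigraph_def)
        show "0 < \<eta> - dist (y k) u0" using y by simp
        fix a assume a: "a \<in> epigraph UNIV f" "norm (a - (y k, f (y k))) < \<eta> - dist (y k) u0"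
        obtain u s where us: "a = (u, s)" by (cases a)
        have s: "f u \<le> s" using a us by (simp add: epigraph_def)
        have le: "norm (u - y k) \<le> norm (a - (y k, f (y k)))"
          unfolding us using norm_fst_le[of "u - y k" "s - f (y k)"] by simp
        have "dist u u0 \<le> dist u (y k) + dist (y k) u0" by (rule dist_triangle)
        then have "dist u u0 \<le> \<eta>" using le a(2) by (simp add: dist_norm)
        then have fu: "f u = g u" by (rule fg)
        have fy: "f (y k) = g (y k)" using y[of k] by (intro fg) simp
        have "(p k, - 1) \<bullet> (a - (y k, f (y k))) = p k \<bullet> (u - y k) - (s - f (y k))"
          by (simp add: us)
        also have "\<dots> \<le> C * (norm (u - y k))\<^sup>2" using C[of u] s fu fy by simp
        also have "\<dots> \<le> \<bar>C\<bar> * (norm (u - y k))\<^sup>2" by (intro mult_right_mono) auto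
        also have "\<dots> \<le> \<bar>C\<bar> * (norm (a - (y k, f (y k))))\<^sup>2"
          using le by (intro mult_left_mono power_mono) auto
        finally show "(p k, - 1) \<bullet> (a - (y k, f (y k))) \<le> \<bar>C\<bar> * (norm (a - (y k, f (y k))))\<^sup>2" .
      qed
    qed
    have "(\<lambda>k. g (y k)) \<longlonglongrightarrow> g u0" using isCont_tendsto_compose[OF cont ylim] .
    moreover have "f (y k) = g (y k)" for k using y[of k] by (intro fg) simp
    moreover have "f u0 = g u0" using \<open>0 < \<eta>\<close> by (intro fg) simp
    ultimately have "(\<lambda>k. f (y k)) \<longlonglongrightarrow> f u0" by simp
    then show "(\<lambda>k. (y k, f (y k))) \<longlonglongrightarrow> (u0, f u0)" using ylim by (intro tendsto_Pair)
    show "(\<lambda>k. (p k, - 1)) \<longlonglongrightarrow> (v, - 1 :: real)" using plim by (intro tendsto_Pair tendsto_const)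
  qed
  then show ?thesis by (simp add: subdifferential_def)
qed

lemma subdifferential_zero:
  fixes u :: "'a::euclidean_space"
  assumes "v \<in> subdifferential (\<lambda>_. 0) u"
  shows "v = 0"
proof -
  have "(v, - 1) \<in> normal_cone (u, 0) (epigraph UNIV (\<lambda>_. 0))" using assms by (simp add: subdifferential_def)
  then obtain xs vs where N: "\<And>k. vs k \<in> regular_normal_cone (xs k) (epigraph UNIV (\<lambda>_ :: 'a. 0 :: real))"
    and lim: "vs \<longlonglongrightarrow> (v, - 1)" unfolding normal_cone_def by blast
  have "fst (vs k) = 0" for k
  proof -
    obtain x s where eq1: "xs k = (x, s)" by (cases "xs k")
    obtain p a where eq2: "vs k = (p, a)" by (cases "vs k")
    note eq = eq1 eq2
    have s: "0 \<le> s" using N[of k] unfolding eq by (simp add: regular_normal_cone_iff epigraph_def)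
    have "norm p \<le> 0 + e" if e: "0 < e" for e
    proof -
      obtain d where d: "0 < d" "\<And>u. u \<in> epigraph UNIV (\<lambda>_. 0) \<Longrightarrow> norm (u - (x, s)) < d \<Longrightarrow> (p, a) \<bullet> (u - (x, s)) \<le> e * norm (u - (x, s))"
        using N[of k] e unfolding eq regular_normal_cone_iff by blast
      have "norm p \<le> e"
      proof (rule norm_le_if_local_bound[of "d / 2"])
        fix w :: 'a assume "norm w \<le> d / 2"
        then show "p \<bullet> w \<le> e * norm w + 0 * (norm w)\<^sup>2"
          using d(2)[of "(x + w, s)"] d(1) s by (simp add: epigraph_def norm_Pair)
      qed (use d e in auto)
      then show ?thesis by simp
    qed
    then have "norm p \<le> 0" by (rule field_le_epsilon)
    then show ?thesis by (simp add: eq)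
  qed
  moreover have "(\<lambda>k. fst (vs k)) \<longlonglongrightarrow> v" using tendsto_fst[OF lim] by simp
  ultimately show ?thesis by (simp add: LIMSEQ_const_iff)
qed

lemma subdifferential_integral_zero:
  assumes "v \<in> subdifferential_integral M \<Phi> 0 u"
  shows "v = 0"
proof -
  obtain f where f: "v = integral\<^sup>L M f" "AE t in M. f t \<in> subdifferential (scalarization 0 (\<Phi> t)) u"
    using assms unfolding subdifferential_integral_def aumann_integral_def by blast
  have scal: "scalarization 0 (\<Phi> t) = (\<lambda>_. 0)" for t by (simp add: scalarization_def fun_eq_iff)
  have "AE t in M. f t = 0" using f(2) unfolding scal by eventually_elim (rule subdifferential_zero)
  then show ?thesis unfolding f(1) by (rule integral_eq_zero_AE)
qed

section \<open>Normals to preimages under Lipschitz maps\<close>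

text \<open>The penalized problem minimizes \<open>A + j * R\<close> over \<open>K\<close>, where \<open>R\<close> is the squared residual of the
  constraints \<open>snd u = a\<close>, \<open>E u = - b\<close> for a point \<open>(a, b)\<close> of the graph of \<open>G\<close>. At a limit of minimizers
  the residual vanishes, so the limit is feasible, and then the normal inequality for \<open>v\<close> forces it to
  be the base point. For large \<open>j\<close> a minimizer is interior, and it is stationary in each of its two
  variables. The function \<open>E\<close> is not differentiable, but in the square of \<open>E u + b\<close> its increment enters
  linearly, with the coefficient \<open>2 * j *\<^sub>R (E u + b)\<close>, up to a term of second order; this is the source of
  the multiplier \<open>w\<close>.\<close>

lemma normal_to_composite_preimage:
  fixes E :: "'a::euclidean_space \<times> 'b::euclidean_space \<Rightarrow> 'c::euclidean_space"
    and G :: "'b \<Rightarrow> 'c set"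
  assumes L: "0 \<le> L" and E: "\<And>u u'. norm (E u - E u') \<le> L * norm (u - u')"
    and G: "closed (gph G)"
    and v: "v \<in> regular_normal_cone u0 {u. - E u \<in> G (snd u)}" and "0 < \<delta>"
  shows "\<exists>u q w \<zeta>. norm (u - u0) < \<delta> \<and> norm (q - (snd u0, - E u0)) < \<delta> \<and>
    (\<zeta>, - w) \<in> regular_normal_cone q (gph G) \<and>
    (\<exists>r>0. \<forall>u'. norm (u' - u) \<le> r \<longrightarrow>
       w \<bullet> E u + (v - (0, \<zeta>)) \<bullet> (u' - u) - \<delta> * norm (u' - u) \<le> w \<bullet> E u')"
proof -
  let ?\<Omega> = "{u. - E u \<in> G (snd u)}"
  define \<epsilon> where "\<epsilon> = \<delta> / 4"
  have \<epsilon>: "0 < \<epsilon>" using \<open>0 < \<delta>\<close> by (simp add: \<epsilon>_def)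
  obtain d where d: "0 < d" "\<And>u. u \<in> ?\<Omega> \<Longrightarrow> norm (u - u0) < d \<Longrightarrow> v \<bullet> (u - u0) \<le> \<epsilon> * norm (u - u0)"
    using v \<epsilon> unfolding regular_normal_cone_iff by blast
  have u0: "u0 \<in> ?\<Omega>" using v by (simp add: regular_normal_cone_iff)
  define r0 where "r0 = d / 2"
  have r0: "0 < r0" "r0 < d" using d by (auto simp: r0_def)
  define q0 where "q0 = (snd u0, - E u0)"
  have q0: "q0 \<in> gph G" using u0 by (simp add: q0_def gph_def)
  define K where "K = cball u0 r0 \<times> (gph G \<inter> cball q0 1)"
  have K: "compact K" unfolding K_def
    by (intro compact_Times compact_cball closed_Int_compact[OF G])
  have p0K: "(u0, q0) \<in> K" using r0 q0 by (simp add: K_def)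
  define A where "A p = - (v \<bullet> (fst p - u0)) + \<epsilon> * norm (fst p - u0) + (norm (fst p - u0))\<^sup>2 + (norm (snd p - q0))\<^sup>2"
    for p :: "('a \<times> 'b) \<times> ('b \<times> 'c)"
  define R where "R p = (norm (snd (fst p) - fst (snd p)))\<^sup>2 + (norm (E (fst p) + snd (snd p)))\<^sup>2"
    for p :: "('a \<times> 'b) \<times> ('b \<times> 'c)"
  have Econt: "continuous_on UNIV E"
  proof -
    have "L-lipschitz_on UNIV E" using E L by (auto simp: lipschitz_on_def dist_norm)
    then show ?thesis by (rule lipschitz_on_continuous_on)
  qed
  have contA: "continuous_on UNIV A" unfolding A_def by (intro continuous_intros)
  have contR: "continuous_on UNIV R" unfolding R_def
    by (intro continuous_intros continuous_on_compose2[OF Econt]) auto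
  have zero: "A (u0, q0) = 0" "R (u0, q0) = 0" by (simp_all add: A_def R_def q0_def)
  have "\<exists>p\<in>K. \<forall>p'\<in>K. A p + real (Suc n) * R p \<le> A p' + real (Suc n) * R p'" for n
    using K p0K contA contR
    by (intro continuous_attains_inf) (auto intro!: continuous_intros intro: continuous_on_subset)
  then obtain m where m: "\<And>n. m n \<in> K" "\<And>n p. p \<in> K \<Longrightarrow> A (m n) + real (Suc n) * R (m n) \<le> A p + real (Suc n) * R p"
    by metis
  obtain p s where p: "p \<in> K" and s: "strict_mono s" and ms: "(m \<circ> s) \<longlonglongrightarrow> p"
    using K m(1) unfolding compact_eq_seq_compact_metric seq_compact_def by blast
  have R0: "0 \<le> R p" for p by (simp add: R_def)
  have le0: "A (m n) + real (Suc n) * R (m n) \<le> 0" for n using m(2)[OF p0K, of n] zero by simp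
  have Ab: "- (norm v * r0) \<le> A p" if "p \<in> K" for p
  proof -
    have "v \<bullet> (fst p - u0) \<le> norm v * norm (fst p - u0)" by (rule norm_cauchy_schwarz)
    also have "\<dots> \<le> norm v * r0"
      using that by (intro mult_left_mono) (auto simp: K_def dist_norm norm_minus_commute)
    finally have "- (norm v * r0) \<le> - (v \<bullet> (fst p - u0))" by simp
    moreover have "0 \<le> \<epsilon> * norm (fst p - u0) + (norm (fst p - u0))\<^sup>2 + (norm (snd p - q0))\<^sup>2" using \<epsilon> by simp
    ultimately show ?thesis unfolding A_def by linarith
  qed
  have Rm: "R (m n) \<le> norm v * r0 / real (Suc n)" for n
  proof -
    have "real (Suc n) * R (m n) \<le> norm v * r0" using le0[of n] Ab[OF m(1)[of n]] by linarith
    then show ?thesis by (simp add: field_simps)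
  qed
  have mslim: "(\<lambda>n. m (s n)) \<longlonglongrightarrow> p" using ms by (simp add: o_def)
  have Alim: "(\<lambda>n. A (m (s n))) \<longlonglongrightarrow> A p" and Rlim: "(\<lambda>n. R (m (s n))) \<longlonglongrightarrow> R p"
    using continuous_on_tendsto_compose[OF contA mslim] continuous_on_tendsto_compose[OF contR mslim] by auto
  have "R p \<le> 0"
  proof (rule LIMSEQ_le[OF Rlim])
    have "(\<lambda>n. norm v * r0 / real (Suc n)) \<longlonglongrightarrow> 0"
      using tendsto_mult_left[OF lim_1_over_n[THEN LIMSEQ_Suc], of "norm v * r0"] by simp
    from LIMSEQ_subseq_LIMSEQ[OF this s] show "(\<lambda>n. norm v * r0 / real (Suc (s n))) \<longlonglongrightarrow> 0" by (simp add: o_def)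
  qed (use Rm in blast)
  then have "R p = 0" using R0[of p] by simp
  then have feas: "snd (fst p) = fst (snd p)" "snd (snd p) = - E (fst p)"
    unfolding R_def sum_power2_eq_zero_iff by (auto simp: eq_neg_iff_add_eq_0 add.commute)
  have "A p \<le> 0"
  proof (rule LIMSEQ_le_const2[OF Alim])
    have "A (m (s n)) \<le> 0" for n
      using le0[of "s n"] R0[of "m (s n)"] by (smt (verit) mult_nonneg_nonneg of_nat_0_le_iff)
    then show "\<exists>N. \<forall>n\<ge>N. A (m (s n)) \<le> 0" by blast
  qed
  moreover have "v \<bullet> (fst p - u0) \<le> \<epsilon> * norm (fst p - u0)"
  proof (rule d(2))
    have "snd p \<in> gph G" using p by (auto simp: K_def)
    then show "fst p \<in> ?\<Omega>" using feas by (auto simp: gph_def case_prod_beta)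
    show "norm (fst p - u0) < d" using p r0 by (auto simp: K_def dist_norm norm_minus_commute)
  qed
  ultimately have "(norm (fst p - u0))\<^sup>2 + (norm (snd p - q0))\<^sup>2 \<le> 0" unfolding A_def by linarith
  then have "fst p = u0" "snd p = q0" by (auto simp: sum_power2_le_zero_iff)
  then have p_eq: "p = (u0, q0)" by (simp add: prod_eq_iff)
  \<comment> \<open>\<open>\<delta> / (8 * (L + 2))\<close> makes the first-order errors from the anchor terms at most \<open>\<delta> / 4\<close>\<close>
  define \<eta> where "\<eta> = Min {\<delta> / 2, \<delta> / (8 * (L + 2)), r0 / 2, 1 / 2}"
  have \<eta>_le: "\<eta> \<le> \<delta> / 2" "\<eta> \<le> \<delta> / (8 * (L + 2))" "\<eta> \<le> r0 / 2" "\<eta> \<le> 1 / 2"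
    unfolding \<eta>_def by (rule Min_le; simp)+
  have "0 < \<delta> / (8 * (L + 2))" using \<open>0 < \<delta>\<close> L by (intro divide_pos_pos) auto
  then have "0 < \<eta>" using \<open>0 < \<delta>\<close> r0 unfolding \<eta>_def by (subst Min_gr_iff) auto
  then have \<eta>: "0 < \<eta>" "\<eta> < \<delta>" "\<eta> \<le> \<delta> / (8 * (L + 2))" "\<eta> \<le> r0 / 2" "\<eta> \<le> 1 / 2"
    using \<eta>_le \<open>0 < \<delta>\<close> by linarith+
  obtain n where n: "dist (m n) (u0, q0) < \<eta>"
  proof -
    have "\<forall>\<^sub>F n in sequentially. dist (m (s n)) (u0, q0) < \<eta>"
      using mslim \<eta>(1) unfolding p_eq by (rule tendstoD)
    then show ?thesis using that by (auto simp: eventually_sequentially)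
  qed
  define j where "j = real (Suc n)"
  have j: "0 < j" by (simp add: j_def)
  define u where "u = fst (m n)"
  define a where "a = fst (snd (m n))"
  define b where "b = snd (snd (m n))"
  have mn: "m n = (u, (a, b))" by (simp add: u_def a_def b_def)
  have nu: "norm (u - u0) < \<eta>" and nq: "norm ((a, b) - q0) < \<eta>"
    using n dist_fst_le[of "m n" "(u0, q0)"] dist_snd_le[of "m n" "(u0, q0)"] by (auto simp: mn dist_norm)
  have na: "norm (a - snd u0) < \<eta>" and nb: "norm (b + E u0) < \<eta>"
    using nq norm_fst_le[of "a - snd u0" "b + E u0"] norm_snd_le[of "b + E u0" "a - snd u0"] by (auto simp: q0_def)
  have abG: "(a, b) \<in> gph G" using m(1)[of n] by (simp add: mn K_def)
  have min: "A (u, (a, b)) + j * R (u, (a, b)) \<le> A p' + j * R p'" if "p' \<in> K" for p'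
    using m(2)[OF that, of n] by (simp add: mn j_def)
  \<comment> \<open>the terms without \<open>j\<close> are the gradients of the anchor \<open>(norm (snd p - q0))\<^sup>2\<close>\<close>
  define w where "w = (2 * j) *\<^sub>R (E u + b) + 2 *\<^sub>R (b + E u0)"
  define \<zeta> where "\<zeta> = (2 * j) *\<^sub>R (snd u - a) - 2 *\<^sub>R (a - snd u0)"
  have sq: "(norm (x + h))\<^sup>2 = (norm x)\<^sup>2 + 2 * (x \<bullet> h) + (norm h)\<^sup>2" for x h :: "'z::real_inner"
    by (simp add: power2_norm_eq_inner inner_add_left inner_add_right inner_commute)
  have "(\<zeta>, - w) \<in> regular_normal_cone (a, b) (gph G)"
  proof (rule proximal_normal_imp_regular)
    fix q' assume q': "q' \<in> gph G" "norm (q' - (a, b)) < 1 / 2"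
    define h k where "h = fst q' - a" "k = snd q' - b"
    have q'_eq: "q' = (a + h, b + k)" by (simp add: h_k_def prod_eq_iff)
    have "norm (q' - q0) \<le> norm (q' - (a, b)) + norm ((a, b) - q0)"
      using dist_triangle[of q' q0 "(a, b)"] unfolding dist_norm .
    then have "norm (q' - q0) \<le> 1" using q' nq \<eta> by linarith
    then have "q' \<in> cball q0 1" by (simp only: mem_cball dist_norm norm_minus_commute[of q0])
    moreover have "u \<in> cball u0 r0" using nu \<eta> r0 by (simp add: dist_norm norm_minus_commute)
    ultimately have "(u, q') \<in> K" using q' by (simp add: K_def)
    from min[OF this]
    have "(norm (a - snd u0))\<^sup>2 + (norm (b + E u0))\<^sup>2 + j * ((norm (snd u - a))\<^sup>2 + (norm (E u + b))\<^sup>2)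
       \<le> (norm ((a - snd u0) + h))\<^sup>2 + (norm ((b + E u0) + k))\<^sup>2 + j * ((norm ((snd u - a) + - h))\<^sup>2 + (norm ((E u + b) + k))\<^sup>2)"
      unfolding A_def R_def q'_eq q0_def by (simp add: norm_Pair algebra_simps)
    then have "0 \<le> 2 * ((a - snd u0) \<bullet> h) + (norm h)\<^sup>2 + (2 * ((b + E u0) \<bullet> k) + (norm k)\<^sup>2) +
        j * (- (2 * ((snd u - a) \<bullet> h)) + (norm h)\<^sup>2 + (2 * ((E u + b) \<bullet> k) + (norm k)\<^sup>2))"
      unfolding sq by (simp add: algebra_simps)
    then have "\<zeta> \<bullet> h - w \<bullet> k \<le> (1 + j) * ((norm h)\<^sup>2 + (norm k)\<^sup>2)"
      unfolding \<zeta>_def w_def by (simp add: inner_diff_left inner_add_left algebra_simps)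
    then show "(\<zeta>, - w) \<bullet> (q' - (a, b)) \<le> (1 + j) * (norm (q' - (a, b)))\<^sup>2"
      by (simp add: q'_eq norm_Pair)
  qed (use abG in auto)
  moreover have "\<exists>r>0. \<forall>u'. norm (u' - u) \<le> r \<longrightarrow>
       w \<bullet> E u + (v - (0, \<zeta>)) \<bullet> (u' - u) - \<delta> * norm (u' - u) \<le> w \<bullet> E u'"
  proof -
    define C where "C = 1 + j + j * L\<^sup>2"
    have C: "0 < C" using j by (simp add: C_def add_pos_nonneg)
    show ?thesis
    proof (intro exI[of _ "min (r0 / 2) (\<delta> / (4 * C))"] conjI allI impI)
      show "0 < min (r0 / 2) (\<delta> / (4 * C))" using r0 \<open>0 < \<delta>\<close> C by simp
      fix u' assume u': "norm (u' - u) \<le> min (r0 / 2) (\<delta> / (4 * C))"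
      define k where "k = u' - u"
      define D where "D = E u' - E u"
      have D: "norm D \<le> L * norm k" unfolding D_def k_def by (rule E)
      have kn: "norm k \<le> r0 / 2" "C * norm k \<le> \<delta> / 4" using u' C by (auto simp: k_def field_simps)
      have "norm (u' - u0) \<le> norm k + norm (u - u0)"
        using dist_triangle[of u' u0 u] unfolding dist_norm k_def .
      then have "norm (u' - u0) \<le> r0" using kn nu \<eta> by linarith
      moreover have "(a, b) \<in> cball q0 1" using nq \<eta> by (simp only: mem_cball dist_norm norm_minus_commute[of q0])
      ultimately have "(u', (a, b)) \<in> K" using abG by (simp add: K_def dist_norm norm_minus_commute)
      from min[OF this]
      have "- (v \<bullet> (u - u0)) + \<epsilon> * norm (u - u0) + (norm (u - u0))\<^sup>2 + j * ((norm (snd u - a))\<^sup>2 + (norm (E u + b))\<^sup>2)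
        \<le> - (v \<bullet> (u' - u0)) + \<epsilon> * norm (u' - u0) + (norm (u' - u0))\<^sup>2 + j * ((norm (snd u' - a))\<^sup>2 + (norm (E u' + b))\<^sup>2)"
        unfolding A_def R_def by (simp add: algebra_simps)
      moreover have "(norm (u' - u0))\<^sup>2 = (norm (u - u0))\<^sup>2 + 2 * ((u - u0) \<bullet> k) + (norm k)\<^sup>2"
        using sq[of "u - u0" k] by (simp add: k_def)
      moreover have "(norm (snd u' - a))\<^sup>2 = (norm (snd u - a))\<^sup>2 + 2 * ((snd u - a) \<bullet> snd k) + (norm (snd k))\<^sup>2"
        using sq[of "snd u - a" "snd k"] by (simp add: k_def)
      moreover have "(norm (E u' + b))\<^sup>2 = (norm (E u + b))\<^sup>2 + 2 * ((E u + b) \<bullet> D) + (norm D)\<^sup>2"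
        using sq[of "E u + b" D] by (simp add: D_def add.commute)
      moreover have "v \<bullet> (u' - u0) = v \<bullet> (u - u0) + v \<bullet> k"
        by (simp add: k_def inner_diff_right)
      ultimately have "0 \<le> - (v \<bullet> k) + \<epsilon> * (norm (u' - u0) - norm (u - u0)) + (2 * ((u - u0) \<bullet> k) + (norm k)\<^sup>2) +
         j * (2 * ((snd u - a) \<bullet> snd k) + (norm (snd k))\<^sup>2 + (2 * ((E u + b) \<bullet> D) + (norm D)\<^sup>2))"
        by (simp only: distrib_left right_diff_distrib)
      also have "\<dots> = - (v \<bullet> k) + \<zeta> \<bullet> snd k + w \<bullet> D + \<epsilon> * (norm (u' - u0) - norm (u - u0)) + 2 * ((u - u0) \<bullet> k)
         + 2 * ((a - snd u0) \<bullet> snd k) - 2 * ((b + E u0) \<bullet> D) + ((norm k)\<^sup>2 + j * (norm (snd k))\<^sup>2 + j * (norm D)\<^sup>2)"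
        unfolding \<zeta>_def w_def by (simp add: inner_diff_left inner_add_left algebra_simps)
      also have "\<dots> \<le> - (v \<bullet> k) + \<zeta> \<bullet> snd k + w \<bullet> D + \<epsilon> * norm k + 2 * (\<eta> * norm k)
         + 2 * (\<eta> * norm k) + 2 * (\<eta> * (L * norm k)) + C * (norm k)\<^sup>2"
      proof -
        have "norm (u' - u0) - norm (u - u0) \<le> norm k"
          using norm_triangle_ineq[of "u - u0" k] by (simp add: k_def)
        then have 1: "\<epsilon> * (norm (u' - u0) - norm (u - u0)) \<le> \<epsilon> * norm k" using \<epsilon> by (intro mult_left_mono) auto
        have snd_le: "norm (snd k) \<le> norm k" by (metis norm_snd_le prod.collapse)
        have in_le: "x \<bullet> y \<le> \<eta> * c" if "norm x < \<eta>" "norm y \<le> c" for x y :: "'z::real_inner" and c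
        proof -
          have "x \<bullet> y \<le> norm x * norm y" by (rule norm_cauchy_schwarz)
          also have "\<dots> \<le> \<eta> * c" using that \<eta> by (intro mult_mono) auto
          finally show ?thesis .
        qed
        have 2: "(u - u0) \<bullet> k \<le> \<eta> * norm k" using nu by (rule in_le) simp
        have 3: "(a - snd u0) \<bullet> snd k \<le> \<eta> * norm k" using na snd_le by (rule in_le)
        have 4: "- ((b + E u0) \<bullet> D) \<le> \<eta> * (L * norm k)"
          using in_le[of "- (b + E u0)" D "L * norm k"] nb D by (simp only: norm_minus_cancel inner_minus_left)
        have "(norm (snd k))\<^sup>2 \<le> (norm k)\<^sup>2" "(norm D)\<^sup>2 \<le> (L * norm k)\<^sup>2" using snd_le D by (auto intro!: power_mono)
        then have "j * (norm (snd k))\<^sup>2 \<le> j * (norm k)\<^sup>2" "j * (norm D)\<^sup>2 \<le> j * (L * norm k)\<^sup>2"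
          using j by (auto intro!: mult_left_mono)
        then have 5: "(norm k)\<^sup>2 + j * (norm (snd k))\<^sup>2 + j * (norm D)\<^sup>2 \<le> C * (norm k)\<^sup>2"
          by (simp add: C_def power_mult_distrib algebra_simps)
        show ?thesis using 1 2 3 4 5 by linarith
      qed
      also have "\<dots> \<le> - (v \<bullet> k) + \<zeta> \<bullet> snd k + w \<bullet> D + \<delta> * norm k"
      proof -
        have "C * (norm k)\<^sup>2 \<le> \<delta> / 4 * norm k"
          using mult_right_mono[OF kn(2), of "norm k"] by (simp add: power2_eq_square mult.assoc)
        moreover have "2 * (\<eta> * norm k) + 2 * (\<eta> * norm k) + 2 * (\<eta> * (L * norm k)) \<le> \<delta> / 4 * norm k"
        proof -
          have "8 * (L + 2) * \<eta> \<le> \<delta>" using \<eta>(3) L by (simp add: field_simps)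
          then have "(2 * \<eta> + 2 * \<eta> + 2 * \<eta> * L) * norm k \<le> (\<delta> / 4) * norm k"
            by (intro mult_right_mono) (auto simp: algebra_simps)
          then show ?thesis by (simp add: algebra_simps)
        qed
        moreover have "0 \<le> \<delta> / 4 * norm k" using \<open>0 < \<delta>\<close> by simp
        ultimately show ?thesis unfolding \<epsilon>_def by (simp add: algebra_simps)
      qed
      finally have "0 \<le> - (v \<bullet> k) + \<zeta> \<bullet> snd k + w \<bullet> D + \<delta> * norm k" .
      moreover have "(v - (0, \<zeta>)) \<bullet> k = v \<bullet> k - \<zeta> \<bullet> snd k"
        by (simp add: inner_diff_left inner_prod_def)
      ultimately show "w \<bullet> E u + (v - (0, \<zeta>)) \<bullet> (u' - u) - \<delta> * norm (u' - u) \<le> w \<bullet> E u'"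
        unfolding k_def[symmetric] D_def by (simp add: inner_diff_right)
    qed
  qed
  ultimately show ?thesis using nu nq \<eta>(2) unfolding q0_def
    by (intro exI[of _ u] exI[of _ "(a, b)"] exI[of _ w] exI[of _ \<zeta>]) auto
qed

section \<open>Integrals of Lipschitz selections and the solution map\<close>

locale lipschitz_selection = finite_measure M for M :: "'t measure" +
  fixes \<phi> :: "'t \<Rightarrow> 'a::euclidean_space \<Rightarrow> 'b::euclidean_space" and l :: "'t \<Rightarrow> real"
  assumes integrable_\<phi>: "\<And>u. integrable M (\<lambda>t. \<phi> t u)"
    and integrable_l: "integrable M l"
    and l_nonneg: "\<And>t. t \<in> space M \<Longrightarrow> 0 \<le> l t"
    and lipschitz: "\<And>t u u'. t \<in> space M \<Longrightarrow> norm (\<phi> t u - \<phi> t u') \<le> l t * norm (u - u')"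
begin

definition mean :: "'a \<Rightarrow> 'b" where "mean u = (LINT t|M. \<phi> t u)"

definition modulus :: real where "modulus = (LINT t|M. l t)"

lemma modulus_nonneg: "0 \<le> modulus"
  unfolding modulus_def using l_nonneg by (intro Bochner_Integration.integral_nonneg_AE AE_I2)

lemma mean_lipschitz: "norm (mean u - mean u') \<le> modulus * norm (u - u')"
proof -
  have "norm (mean u - mean u') = norm (LINT t|M. \<phi> t u - \<phi> t u')"
    unfolding mean_def using integrable_\<phi> by simp
  also have "\<dots> \<le> (LINT t|M. norm (\<phi> t u - \<phi> t u'))" by (rule integral_norm_bound)
  also have "\<dots> \<le> (LINT t|M. l t * norm (u - u'))"
    using integrable_\<phi> integrable_l lipschitz by (intro integral_mono) auto
  finally show ?thesis by (simp add: modulus_def)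
qed

lemma continuous_mean: "continuous_on UNIV mean"
proof -
  have "modulus-lipschitz_on UNIV mean"
    using mean_lipschitz modulus_nonneg by (auto simp: lipschitz_on_def dist_norm)
  then show ?thesis by (rule lipschitz_on_continuous_on)
qed

lemma isCont_scalarized:
  assumes "t \<in> space M"
  shows "isCont (\<lambda>u. w \<bullet> \<phi> t u) u0"
proof -
  have "(l t)-lipschitz_on UNIV (\<phi> t)"
    using lipschitz[OF assms] l_nonneg[OF assms] by (auto simp: lipschitz_on_def dist_norm)
  then have "continuous_on UNIV (\<phi> t)" by (rule lipschitz_on_continuous_on)
  then show ?thesis by (intro continuous_intros) (simp add: continuous_on_eq_continuous_at)
qed

text \<open>Replacing \<open>W k\<close> by its limit costs \<open>norm (W k - w0) * modulus\<close> in the tolerance.\<close>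

lemma limiting_subgradient_of_mean:
  assumes U: "U \<longlonglongrightarrow> u0" and V: "V \<longlonglongrightarrow> v0" and W: "W \<longlonglongrightarrow> w0"
    and e: "e \<longlonglongrightarrow> 0" "\<And>k. 0 \<le> e k"
    and min: "\<And>k. \<exists>r>0. \<forall>u. norm (u - U k) \<le> r \<longrightarrow>
       W k \<bullet> mean (U k) + V k \<bullet> (u - U k) - e k * norm (u - U k) \<le> W k \<bullet> mean u"
  shows "\<exists>f. integrable M f \<and> (LINT t|M. f t) = v0 \<and>
     (\<forall>t\<in>space M. f t \<in> proximal_limits (\<lambda>u. w0 \<bullet> \<phi> t u) u0)"
proof -
  interpret scal: lipschitz_integrand M "\<lambda>t u. w0 \<bullet> \<phi> t u" "\<lambda>t. norm w0 * l t"
  proof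
    show "integrable M (\<lambda>t. w0 \<bullet> \<phi> t u)" for u using integrable_\<phi> by simp
    show "\<bar>w0 \<bullet> \<phi> t u - w0 \<bullet> \<phi> t u'\<bar> \<le> norm w0 * l t * norm (u - u')" if t: "t \<in> space M" for t u u'
    proof -
      have "\<bar>w0 \<bullet> (\<phi> t u - \<phi> t u')\<bar> \<le> norm w0 * norm (\<phi> t u - \<phi> t u')" by (rule Cauchy_Schwarz_ineq2)
      also have "\<dots> \<le> norm w0 * (l t * norm (u - u'))" using lipschitz[OF t] by (intro mult_left_mono) auto
      finally show ?thesis by (simp add: inner_diff_right mult.assoc)
    qed
  qed (use integrable_l l_nonneg in auto)
  have int: "(LINT t|M. w0 \<bullet> \<phi> t u) = w0 \<bullet> mean u" for u
    unfolding mean_def using integrable_\<phi> by simp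
  define e' where "e' k = e k + norm (W k - w0) * modulus" for k
  show ?thesis
  proof (rule scal.limiting_subgradient_of_integral[OF U V])
    have "(\<lambda>k. e k + norm (W k - w0) * modulus) \<longlonglongrightarrow> 0 + norm (w0 - w0) * modulus"
      by (intro tendsto_intros W e(1))
    then show "e' \<longlonglongrightarrow> 0" by (simp add: e'_def[abs_def])
    show "0 \<le> e' k" for k using e(2) modulus_nonneg by (simp add: e'_def)
    fix k
    obtain r where r: "0 < r" "\<And>u. norm (u - U k) \<le> r \<Longrightarrow>
       W k \<bullet> mean (U k) + V k \<bullet> (u - U k) - e k * norm (u - U k) \<le> W k \<bullet> mean u"
      using min by blast
    show "\<exists>r>0. \<forall>u. norm (u - U k) \<le> r \<longrightarrow>
       (LINT t|M. w0 \<bullet> \<phi> t (U k)) + V k \<bullet> (u - U k) - e' k * norm (u - U k) \<le> (LINT t|M. w0 \<bullet> \<phi> t u)"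
    proof (intro exI[of _ r] conjI allI impI r(1))
      fix u assume "norm (u - U k) \<le> r"
      from r(2)[OF this] have 1: "W k \<bullet> mean (U k) + V k \<bullet> (u - U k) - e k * norm (u - U k) \<le> W k \<bullet> mean u" .
      have "(W k - w0) \<bullet> (mean u - mean (U k)) \<le> norm (W k - w0) * norm (mean u - mean (U k))"
        by (rule norm_cauchy_schwarz)
      also have "\<dots> \<le> norm (W k - w0) * (modulus * norm (u - U k))"
        using mean_lipschitz by (intro mult_left_mono) auto
      finally show "(LINT t|M. w0 \<bullet> \<phi> t (U k)) + V k \<bullet> (u - U k) - e' k * norm (u - U k) \<le> (LINT t|M. w0 \<bullet> \<phi> t u)"
        unfolding int e'_def using 1 by (simp add: inner_diff_left inner_diff_right algebra_simps)
    qed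
  qed
qed

end

text \<open>Over \<open>T\<close>, the graph of the selection is a section of the graph of \<open>F\<close>.\<close>

lemma selection_measurable:
  fixes F :: "'t \<Rightarrow> 'a::euclidean_space \<Rightarrow> 'b::euclidean_space set"
  assumes M: "complete_measure M" "finite_measure M" and F: "normal_integrand M F"
    and T: "T \<in> sets M" and single: "\<And>t. t \<in> T \<Longrightarrow> is_singleton (F t u)"
  shows "(\<lambda>t. if t \<in> T then the_elem (F t u) else 0) \<in> borel_measurable M"
proof (rule measurable_if_graph_measurable[OF M])
  let ?G = "{(t, u, y). t \<in> space M \<and> y \<in> F t u}"
  have G: "?G \<in> sets (M \<Otimes>\<^sub>M borel)" using F by (simp add: normal_integrand_def)
  have "(\<lambda>p. (fst p, (u, snd p))) \<in> M \<Otimes>\<^sub>M (borel :: 'b measure) \<rightarrow>\<^sub>M M \<Otimes>\<^sub>M (borel :: ('a \<times> 'b) measure)"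
  proof (rule measurable_Pair)
    show "(\<lambda>p. (u, snd p)) \<in> M \<Otimes>\<^sub>M (borel :: 'b measure) \<rightarrow>\<^sub>M borel"
      by (rule measurable_compose[OF measurable_snd]) (intro borel_measurable_continuous_onI continuous_intros)
  qed simp
  from measurable_sets[OF this G]
  have 1: "(\<lambda>p. (fst p, (u, snd p))) -` ?G \<inter> space (M \<Otimes>\<^sub>M (borel :: 'b measure)) \<in> sets (M \<Otimes>\<^sub>M borel)" .
  have 2: "T \<times> (UNIV :: 'b set) \<in> sets (M \<Otimes>\<^sub>M borel)" and 3: "(space M - T) \<times> {0 :: 'b} \<in> sets (M \<Otimes>\<^sub>M borel)"
    using T by (auto intro!: pair_measureI)
  have eq: "{(t, y). t \<in> space M \<and> y = (if t \<in> T then the_elem (F t u) else 0)} =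
    ((\<lambda>p. (fst p, (u, snd p))) -` ?G \<inter> space (M \<Otimes>\<^sub>M (borel :: 'b measure))) \<inter> (T \<times> UNIV) \<union> (space M - T) \<times> {0}"
  proof -
    have elem: "y = the_elem (F t u) \<longleftrightarrow> y \<in> F t u" if t: "t \<in> T" for t y
    proof -
      obtain x where "F t u = {x}" using single[OF t] unfolding is_singleton_def by blast
      then show ?thesis by simp
    qed
    have TM: "t \<in> space M" if "t \<in> T" for t using that sets.sets_into_space[OF T] by blast
    show ?thesis
    proof (rule set_eqI, clarify)
      fix t y
      show "((t, y) \<in> {(t, y). t \<in> space M \<and> y = (if t \<in> T then the_elem (F t u) else 0)}) \<longleftrightarrow>
        ((t, y) \<in> ((\<lambda>p. (fst p, (u, snd p))) -` ?G \<inter> space (M \<Otimes>\<^sub>M (borel :: 'b measure))) \<inter> (T \<times> UNIV) \<union> (space M - T) \<times> {0})"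
        using elem[of t y] TM[of t] by (cases "t \<in> T") (simp_all add: space_pair_measure)
    qed
  qed
  show "{(t, y). t \<in> space M \<and> y = (if t \<in> T then the_elem (F t u) else 0)} \<in> sets (M \<Otimes>\<^sub>M borel)"
    unfolding eq by (rule sets.Un[OF sets.Int[OF 1 2] 3])
qed

text \<open>Composing with the projection to the ball extends the selection to the whole space with the same
  Lipschitz constants, so that its integral is defined and Lipschitz everywhere.\<close>

lemma lipschitz_selection_exists:
  fixes F :: "'t \<Rightarrow> 'a::euclidean_space \<Rightarrow> 'b::euclidean_space set"
  assumes M: "complete_measure M" "finite_measure M" and F: "normal_integrand M F"
    and lip: "single_valued_integrably_lipschitz M F u0" and ne: "expected_map M F u0 \<noteq> {}"
  shows "\<exists>\<phi> l \<eta>. lipschitz_selection M \<phi> l \<and> 0 < \<eta> \<and> (AE t in M. \<forall>u\<in>cball u0 \<eta>. F t u = {\<phi> t u})"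
proof -
  obtain \<eta> l T where \<eta>: "0 < \<eta>" and l: "integrable M l" and T: "T \<in> sets M" "emeasure M (space M - T) = 0"
    and on_T: "\<forall>t\<in>T. (\<forall>u\<in>cball u0 \<eta>. is_singleton (F t u)) \<and>
      (\<forall>u\<in>cball u0 \<eta>. \<forall>u'\<in>cball u0 \<eta>. norm (the_elem (F t u) - the_elem (F t u')) \<le> l t * norm (u - u'))"
    using lip unfolding single_valued_integrably_lipschitz_def by (elim exE bexE conjE)
  have single: "is_singleton (F t u)" if "t \<in> T" "u \<in> cball u0 \<eta>" for t u
    using bspec[OF on_T that(1)] that by simp
  have lipF: "norm (the_elem (F t u) - the_elem (F t u')) \<le> l t * norm (u - u')"
    if "t \<in> T" "u \<in> cball u0 \<eta>" "u' \<in> cball u0 \<eta>" for t u u'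
    using bspec[OF on_T that(1)] that by simp
  define P where "P = closest_point (cball u0 \<eta>)"
  have ball: "closed (cball u0 \<eta>)" "convex (cball u0 \<eta>)" "cball u0 \<eta> \<noteq> {}" using \<eta> by auto
  have P: "P u \<in> cball u0 \<eta>" for u unfolding P_def using ball by (intro closest_point_in_set)
  have P_id: "P u = u" if "u \<in> cball u0 \<eta>" for u unfolding P_def using that by (rule closest_point_self)
  have P_lip: "norm (P u - P u') \<le> norm (u - u')" for u u'
    using closest_point_lipschitz[OF ball(2,1,3)] unfolding P_def dist_norm by blast
  define \<phi> where "\<phi> t u = (if t \<in> T then the_elem (F t (P u)) else 0)" for t u
  have AE_T: "AE t in M. t \<in> T"
  proof -
    have "space M - T \<in> null_sets M" using T by (intro null_setsI) auto
    then have "AE t in M. t \<notin> space M - T" by (rule AE_not_in)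
    then show ?thesis using AE_space by eventually_elim blast
  qed
  have \<phi>_F: "F t u = {\<phi> t u}" if "t \<in> T" "u \<in> cball u0 \<eta>" for t u
  proof -
    have "is_singleton (F t u)" using that by (rule single)
    then obtain x where "F t u = {x}" unfolding is_singleton_def by (elim exE)
    moreover have "\<phi> t u = the_elem (F t u)" unfolding \<phi>_def P_id[OF that(2)] using that(1) by simp
    ultimately show ?thesis by simp
  qed
  have \<phi>_meas: "(\<lambda>t. \<phi> t u) \<in> borel_measurable M" for u
    unfolding \<phi>_def using single P by (intro selection_measurable[OF M F T(1)]) auto
  have \<phi>_lip: "norm (\<phi> t u - \<phi> t u') \<le> \<bar>l t\<bar> * norm (u - u')" for t u u'
  proof (cases "t \<in> T")
    case True
    have "norm (\<phi> t u - \<phi> t u') \<le> l t * norm (P u - P u')"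
      using lipF[OF True P P] True by (simp add: \<phi>_def)
    also have "\<dots> \<le> \<bar>l t\<bar> * norm (P u - P u')" by (intro mult_right_mono) auto
    also have "\<dots> \<le> \<bar>l t\<bar> * norm (u - u')" using P_lip by (intro mult_left_mono) auto
    finally show ?thesis .
  qed (simp add: \<phi>_def)
  have i0: "integrable M (\<lambda>t. \<phi> t u0)"
  proof -
    obtain f where f: "integrable M f" "AE t in M. f t \<in> F t u0"
      using ne unfolding expected_map_def aumann_integral_def by blast
    have "AE t in M. f t = \<phi> t u0"
      using f(2) AE_T by eventually_elim (use \<phi>_F \<eta> in auto)
    then show ?thesis using f(1) \<phi>_meas integrable_cong_AE[of f M "\<lambda>t. \<phi> t u0"] by auto
  qed
  have "integrable M (\<lambda>t. \<phi> t u)" for u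
  proof (rule Bochner_Integration.integrable_bound)
    show "integrable M (\<lambda>t. norm (\<phi> t u0) + \<bar>l t\<bar> * norm (u - u0))" using i0 l by auto
    show "AE t in M. norm (\<phi> t u) \<le> norm (norm (\<phi> t u0) + \<bar>l t\<bar> * norm (u - u0))"
    proof (rule AE_I2)
      fix t
      have "norm (\<phi> t u) \<le> norm (\<phi> t u0) + norm (\<phi> t u - \<phi> t u0)" by (rule norm_triangle_sub)
      also have "\<dots> \<le> norm (\<phi> t u0) + \<bar>l t\<bar> * norm (u - u0)" using \<phi>_lip by simp
      finally show "norm (\<phi> t u) \<le> norm (norm (\<phi> t u0) + \<bar>l t\<bar> * norm (u - u0))" by simp
    qed
  qed (rule \<phi>_meas)
  then have "lipschitz_selection M \<phi> (\<lambda>t. \<bar>l t\<bar>)"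
    using M(2) l \<phi>_lip by (intro lipschitz_selection.intro lipschitz_selection_axioms.intro) auto
  moreover have "AE t in M. \<forall>u\<in>cball u0 \<eta>. F t u = {\<phi> t u}"
    using AE_T by eventually_elim (use \<phi>_F in blast)
  ultimately show ?thesis using \<eta> by blast
qed

context
  fixes M :: "'t measure" and \<Phi> :: "'t \<Rightarrow> 'a::euclidean_space \<times> 'b::euclidean_space \<Rightarrow> 'c::euclidean_space set"
    and \<phi> l \<eta> u0 and G :: "'b \<Rightarrow> 'c set"
  assumes sel: "lipschitz_selection M \<phi> l" and \<eta>: "0 < \<eta>"
    and rep: "AE t in M. \<forall>u\<in>cball u0 \<eta>. \<Phi> t u = {\<phi> t u}"
    and G: "closed (gph G)"
begin

interpretation lipschitz_selection M \<phi> l by (rule sel)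

lemma expected_map_eq:
  assumes u: "u \<in> cball u0 \<eta>"
  shows "expected_map M \<Phi> u = {mean u}"
proof -
  have "(\<exists>f. y = integral\<^sup>L M f \<and> integrable M f \<and> (AE t in M. f t \<in> \<Phi> t u)) \<longleftrightarrow> y = mean u" for y
  proof
    assume "\<exists>f. y = integral\<^sup>L M f \<and> integrable M f \<and> (AE t in M. f t \<in> \<Phi> t u)"
    then obtain f where f: "y = integral\<^sup>L M f" "integrable M f" "AE t in M. f t \<in> \<Phi> t u" by blast
    have "AE t in M. f t = \<phi> t u" using f(3) rep by eventually_elim (use u in auto)
    then show "y = mean u" unfolding f(1) mean_def using f(2) integrable_\<phi> by (intro integral_cong_AE) auto
  next
    assume "y = mean u"
    moreover have "AE t in M. \<phi> t u \<in> \<Phi> t u" using rep by eventually_elim (use u in auto)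
    ultimately show "\<exists>f. y = integral\<^sup>L M f \<and> integrable M f \<and> (AE t in M. f t \<in> \<Phi> t u)"
      using integrable_\<phi> by (intro exI[of _ "\<lambda>t. \<phi> t u"]) (simp add: mean_def)
  qed
  then show ?thesis unfolding expected_map_def aumann_integral_def by (auto simp: set_eq_iff)
qed

lemma gph_solution_map:
  "gph (solution_map M \<Phi> G) \<inter> cball u0 \<eta> = {u. - mean u \<in> G (snd u)} \<inter> cball u0 \<eta>"
proof -
  have "0 \<in> {y} + A \<longleftrightarrow> - y \<in> A" for y :: 'c and A
  proof
    assume "0 \<in> {y} + A"
    then obtain a where "a \<in> A" "0 = y + a" by (auto elim!: set_plus_elim)
    then show "- y \<in> A" by (metis minus_unique)
  next
    assume "- y \<in> A"
    then have "y + - y \<in> {y} + A" by (intro set_plus_intro) auto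
    then show "0 \<in> {y} + A" by simp
  qed
  then have "u \<in> gph (solution_map M \<Phi> G) \<longleftrightarrow> - mean u \<in> G (snd u)" if "u \<in> cball u0 \<eta>" for u
    using expected_map_eq[OF that] by (cases u) (simp add: gph_def solution_map_def)
  then show ?thesis by blast
qed

lemma closed_gph_solution_map: "closed (gph (solution_map M \<Phi> G) \<inter> cball u0 \<eta>)"
proof -
  have "closed ((\<lambda>u. (snd u, - mean u)) -` gph G)"
    by (intro closed_vimage[OF G] continuous_intros continuous_mean)
  moreover have "(\<lambda>u. (snd u, - mean u)) -` gph G = {u. - mean u \<in> G (snd u)}" by (auto simp: gph_def)
  ultimately show ?thesis unfolding gph_solution_map by (intro closed_Int) auto
qed

text \<open>The common limit step for bounded and for normalized multipliers.\<close>

lemma normal_limit: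
  assumes U: "U \<longlonglongrightarrow> u0" and Q: "Q \<longlonglongrightarrow> (snd u0, - mean u0)" and V: "V \<longlonglongrightarrow> v0" and W: "W \<longlonglongrightarrow> w0"
    and Z: "Z \<longlonglongrightarrow> z0" and e: "e \<longlonglongrightarrow> 0" "\<And>k. 0 \<le> e k"
    and N: "\<And>k. (Z k, - W k) \<in> regular_normal_cone (Q k) (gph G)"
    and min: "\<And>k. \<exists>r>0. \<forall>u. norm (u - U k) \<le> r \<longrightarrow>
       W k \<bullet> mean (U k) + (V k - (0, Z k)) \<bullet> (u - U k) - e k * norm (u - U k) \<le> W k \<bullet> mean u"
  shows "v0 - (0, z0) \<in> subdifferential_integral M \<Phi> w0 u0"
    and "z0 \<in> coderivative G (snd u0) (- mean u0) w0"
proof -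
  have "(\<lambda>k. V k - (0, Z k)) \<longlonglongrightarrow> v0 - (0, z0)"
    by (intro tendsto_diff tendsto_Pair V Z tendsto_const)
  from limiting_subgradient_of_mean[OF U this W e min]
  obtain f where f: "integrable M f" "(LINT t|M. f t) = v0 - (0, z0)"
    and lim: "\<And>t. t \<in> space M \<Longrightarrow> f t \<in> proximal_limits (\<lambda>u. w0 \<bullet> \<phi> t u) u0" by blast
  have "AE t in M. f t \<in> subdifferential (scalarization w0 (\<Phi> t)) u0"
    using rep AE_space
  proof eventually_elim
    case (elim t)
    show ?case
    proof (rule proximal_limits_subset_subdifferential[OF lim \<eta> _ isCont_scalarized])
      show "scalarization w0 (\<Phi> t) u = w0 \<bullet> \<phi> t u" if "u \<in> cball u0 \<eta>" for u
        using elim that by (simp add: scalarization_def)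
    qed (use elim in auto)
  qed
  then show "v0 - (0, z0) \<in> subdifferential_integral M \<Phi> w0 u0"
    unfolding subdifferential_integral_def aumann_integral_def using f by (metis (mono_tags, lifting) mem_Collect_eq)
  have "(z0, - w0) \<in> normal_cone (snd u0, - mean u0) (gph G)"
    by (rule normal_coneI[OF N Q]) (intro tendsto_Pair tendsto_minus Z W)
  then show "z0 \<in> coderivative G (snd u0) (- mean u0) w0" by (simp add: coderivative_def)
qed

text \<open>Scaling by \<open>c k = 1 / (1 + norm (W k))\<close> treats bounded and unbounded multipliers together. Along a
  subsequence the scaled data converge, say \<open>c k\<close> to \<open>c0\<close>. If \<open>c0 = 0\<close>, the scaled multipliers tend to
  a unit vector while the scaled normals tend to \<open>0\<close>; the limit \<open>- (0, z0)\<close> then violates the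
  qualification condition. Otherwise the scaling can be undone in the limit.\<close>

lemma normal_to_solution_graph:
  assumes qual: "\<And>w. 0 \<in> fst ` subdifferential_integral M \<Phi> w u0 \<Longrightarrow> w = 0"
    and v: "v \<in> normal_cone u0 (gph (solution_map M \<Phi> G))"
  shows "\<exists>w z. v - (0, z) \<in> subdifferential_integral M \<Phi> w u0 \<and> z \<in> coderivative G (snd u0) (- mean u0) w"
proof -
  let ?S = "gph (solution_map M \<Phi> G)" and ?\<Omega> = "{u. - mean u \<in> G (snd u)}"
  let ?L = modulus
  obtain xs0 vs0 where N0: "\<And>k. vs0 k \<in> regular_normal_cone (xs0 k) ?S"
    and lim0: "xs0 \<longlonglongrightarrow> u0" "vs0 \<longlonglongrightarrow> v" using v unfolding normal_cone_def by blast
  have "\<forall>\<^sub>F k in sequentially. dist (xs0 k) u0 < \<eta>" using lim0(1) \<eta> by (rule tendstoD)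
  then obtain K where K: "\<And>k. K \<le> k \<Longrightarrow> dist (xs0 k) u0 < \<eta>" by (auto simp: eventually_sequentially)
  define xs where "xs k = xs0 (k + K)" for k
  define vs where "vs k = vs0 (k + K)" for k
  have lim: "xs \<longlonglongrightarrow> u0" "vs \<longlonglongrightarrow> v"
    unfolding xs_def vs_def using lim0 by (auto intro: LIMSEQ_ignore_initial_segment)
  have N: "vs k \<in> regular_normal_cone (xs k) ?\<Omega>" for k
  proof (rule regular_normal_cone_local)
    show "vs k \<in> regular_normal_cone (xs k) ?S" using N0 by (simp add: xs_def vs_def)
    show "open (ball u0 \<eta>)" "xs k \<in> ball u0 \<eta>" using K[of "k + K"] by (auto simp: xs_def dist_commute)
    show "?S \<inter> ball u0 \<eta> = ?\<Omega> \<inter> ball u0 \<eta>" using gph_solution_map ball_subset_cball[of u0 \<eta>] by blast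
  qed
  have "\<exists>u q w \<zeta>. norm (u - xs k) < 1 / Suc k \<and> norm (q - (snd (xs k), - mean (xs k))) < 1 / Suc k \<and>
    (\<zeta>, - w) \<in> regular_normal_cone q (gph G) \<and>
    (\<exists>r>0. \<forall>u'. norm (u' - u) \<le> r \<longrightarrow>
       w \<bullet> mean u + (vs k - (0, \<zeta>)) \<bullet> (u' - u) - 1 / Suc k * norm (u' - u) \<le> w \<bullet> mean u')" for k
    by (rule normal_to_composite_preimage[OF modulus_nonneg mean_lipschitz G N]) simp
  then obtain U Q W Z where UQ: "\<And>k. norm (U k - xs k) < 1 / Suc k"
      "\<And>k. norm (Q k - (snd (xs k), - mean (xs k))) < 1 / Suc k"
    and NZ: "\<And>k. (Z k, - W k) \<in> regular_normal_cone (Q k) (gph G)"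
    and min: "\<And>k. \<exists>r>0. \<forall>u'. norm (u' - U k) \<le> r \<longrightarrow>
       W k \<bullet> mean (U k) + (vs k - (0, Z k)) \<bullet> (u' - U k) - 1 / Suc k * norm (u' - U k) \<le> W k \<bullet> mean u'"
    by metis
  have inv: "(\<lambda>k. 1 / real (Suc k)) \<longlonglongrightarrow> 0" by (rule lim_1_over_n[THEN LIMSEQ_Suc])
  have U: "U \<longlonglongrightarrow> u0"
  proof -
    have "(\<lambda>k. U k - xs k) \<longlonglongrightarrow> 0"
      by (rule Lim_null_comparison[OF _ inv]) (use UQ(1) in \<open>auto intro!: always_eventually less_imp_le\<close>)
    from tendsto_add[OF this lim(1)] show ?thesis by simp
  qed
  have Q: "Q \<longlonglongrightarrow> (snd u0, - mean u0)"
  proof -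
    have "(\<lambda>k. Q k - (snd (xs k), - mean (xs k))) \<longlonglongrightarrow> 0"
      by (rule Lim_null_comparison[OF _ inv]) (use UQ(2) in \<open>auto intro!: always_eventually less_imp_le\<close>)
    moreover have "(\<lambda>k. (snd (xs k), - mean (xs k))) \<longlonglongrightarrow> (snd u0, - mean u0)"
      using continuous_on_tendsto_compose[OF continuous_mean lim(1)]
      by (intro tendsto_Pair tendsto_snd lim(1) tendsto_minus) auto
    ultimately show ?thesis using tendsto_add by fastforce
  qed
  have Zb: "norm (Z k) \<le> norm (vs k) + norm (W k) * ?L + 1 / Suc k" for k
  proof -
    obtain r where r: "0 < r" "\<And>u'. norm (u' - U k) \<le> r \<Longrightarrow>
       W k \<bullet> mean (U k) + (vs k - (0, Z k)) \<bullet> (u' - U k) - 1 / Suc k * norm (u' - U k) \<le> W k \<bullet> mean u'"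
      using min by blast
    have "norm (vs k - (0, Z k)) \<le> norm (W k) * ?L + 1 / Suc k"
    proof (rule norm_le_if_local_bound[OF r(1)])
      show "0 \<le> norm (W k) * ?L + 1 / Suc k" using modulus_nonneg by simp
      fix h :: "'a \<times> 'b" assume h: "norm h \<le> r"
      have "(vs k - (0, Z k)) \<bullet> h \<le> W k \<bullet> (mean (U k + h) - mean (U k)) + 1 / Suc k * norm h"
        using r(2)[of "U k + h"] h by (simp add: inner_diff_right)
      also have "W k \<bullet> (mean (U k + h) - mean (U k)) \<le> norm (W k) * norm (mean (U k + h) - mean (U k))"
        by (rule norm_cauchy_schwarz)
      also have "\<dots> \<le> norm (W k) * (?L * norm h)"
        using mean_lipschitz[of "U k + h" "U k"] by (intro mult_left_mono) auto
      finally show "(vs k - (0, Z k)) \<bullet> h \<le> (norm (W k) * ?L + 1 / Suc k) * norm h + 0 * (norm h)\<^sup>2"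
        by (simp add: algebra_simps)
    qed
    moreover have "norm (Z k) = norm ((0, Z k) :: 'a \<times> 'b)" by (simp add: norm_Pair)
    moreover have "norm ((0, Z k) :: 'a \<times> 'b) \<le> norm (vs k) + norm (vs k - (0, Z k))"
      using norm_triangle_ineq4[of "vs k" "vs k - (0, Z k)"] by simp
    ultimately show ?thesis by linarith
  qed
  have "bounded (range vs)" using lim(2) convergent_imp_bounded by blast
  then obtain B where B: "\<And>k. norm (vs k) \<le> B" by (auto simp: bounded_iff)
  define c where "c k = 1 / (1 + norm (W k))" for k
  have pos: "0 < 1 + norm (W k)" for k by (simp add: add_pos_nonneg)
  have c: "0 < c k" "c k \<le> 1" "c k * norm (W k) = 1 - c k" for k
    using pos[of k] by (simp_all add: c_def field_simps)
  have zb: "norm (c k *\<^sub>R Z k) \<le> B + ?L + 1" for k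
  proof -
    have "norm (c k *\<^sub>R Z k) = c k * norm (Z k)" using c(1)[of k] by simp
    also have "\<dots> \<le> c k * (norm (vs k) + norm (W k) * ?L + 1 / Suc k)"
      using Zb c(1)[of k] by (intro mult_left_mono) auto
    also have "\<dots> = c k * norm (vs k) + (1 - c k) * ?L + c k * (1 / Suc k)"
      unfolding c(3)[symmetric] by (simp only: distrib_left mult.assoc)
    also have "\<dots> \<le> 1 * B + 1 * ?L + 1 * 1"
      using c(1,2)[of k] B[of k] modulus_nonneg by (intro add_mono mult_mono) auto
    finally show ?thesis by simp
  qed
  have "norm (c k, c k *\<^sub>R W k, c k *\<^sub>R Z k) \<le> 1 + (1 + (B + ?L + 1))" for k
  proof -
    have "norm (c k *\<^sub>R W k) \<le> 1" "norm (c k) \<le> 1" using c[of k] by simp_all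
    then show ?thesis
      using norm_Pair_le[of "c k" "(c k *\<^sub>R W k, c k *\<^sub>R Z k)"] norm_Pair_le[of "c k *\<^sub>R W k" "c k *\<^sub>R Z k"] zb[of k]
      by linarith
  qed
  then have "bounded (range (\<lambda>k. (c k, c k *\<^sub>R W k, c k *\<^sub>R Z k)))" by (auto simp: bounded_iff)
  then obtain y s where s: "strict_mono s" "((\<lambda>k. (c k, c k *\<^sub>R W k, c k *\<^sub>R Z k)) \<circ> s) \<longlonglongrightarrow> y"
    using bounded_imp_convergent_subsequence by blast
  define c0 w0 z0 where "c0 = fst y" "w0 = fst (snd y)" "z0 = snd (snd y)"
  have cs: "(\<lambda>n. c (s n)) \<longlonglongrightarrow> c0" and ws: "(\<lambda>n. c (s n) *\<^sub>R W (s n)) \<longlonglongrightarrow> w0"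
    and zs: "(\<lambda>n. c (s n) *\<^sub>R Z (s n)) \<longlonglongrightarrow> z0"
    using tendsto_fst[OF s(2)] tendsto_fst[OF tendsto_snd[OF s(2)]] tendsto_snd[OF tendsto_snd[OF s(2)]]
    by (auto simp: o_def c0_w0_z0_def)
  note sf = filterlim_subseq[OF s(1)]
  note subseq_lims = filterlim_compose[OF U sf] filterlim_compose[OF Q sf]
  have Vs: "(\<lambda>n. vs (s n)) \<longlonglongrightarrow> v" by (rule filterlim_compose[OF lim(2) sf])
  have inv_s: "(\<lambda>n. 1 / real (Suc (s n))) \<longlonglongrightarrow> 0" by (rule filterlim_compose[OF inv sf])
  have "c0 \<noteq> 0"
  proof
    assume "c0 = 0"
    have "c0 *\<^sub>R v - (0, z0) \<in> subdifferential_integral M \<Phi> w0 u0"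
    proof (rule normal_limit(1)[OF subseq_lims tendsto_scaleR[OF cs Vs] ws zs inv_s])
      show "(c (s n) *\<^sub>R Z (s n), - (c (s n) *\<^sub>R W (s n))) \<in> regular_normal_cone (Q (s n)) (gph G)" for n
        using regular_normal_cone_scale[OF NZ[of "s n"] c(1)[of "s n"]] by simp
      fix n
      let ?k = "s n" and ?c = "c (s n)"
      obtain r where r: "0 < r" "\<And>u'. norm (u' - U ?k) \<le> r \<Longrightarrow>
         W ?k \<bullet> mean (U ?k) + (vs ?k - (0, Z ?k)) \<bullet> (u' - U ?k) - 1 / Suc ?k * norm (u' - U ?k) \<le> W ?k \<bullet> mean u'"
        using min by blast
      show "\<exists>r>0. \<forall>u. norm (u - U ?k) \<le> r \<longrightarrow>
         (?c *\<^sub>R W ?k) \<bullet> mean (U ?k) + (?c *\<^sub>R vs ?k - (0, ?c *\<^sub>R Z ?k)) \<bullet> (u - U ?k) - 1 / Suc ?k * norm (u - U ?k)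
           \<le> (?c *\<^sub>R W ?k) \<bullet> mean u"
      proof (intro exI[of _ r] conjI allI impI r(1))
        fix u assume u: "norm (u - U ?k) \<le> r"
        have "?c * (W ?k \<bullet> mean (U ?k) + (vs ?k - (0, Z ?k)) \<bullet> (u - U ?k) - 1 / Suc ?k * norm (u - U ?k)) \<le> ?c * (W ?k \<bullet> mean u)"
          using r(2)[OF u] c(1)[of "s n"] by (intro mult_left_mono) auto
        moreover have "?c * (1 / Suc ?k * norm (u - U ?k)) \<le> 1 * (1 / Suc ?k * norm (u - U ?k))"
          using c(2) by (intro mult_right_mono) auto
        moreover have "?c *\<^sub>R vs ?k - (0, ?c *\<^sub>R Z ?k) = ?c *\<^sub>R (vs ?k - (0, Z ?k))"
          by (simp add: scaleR_diff_right)
        ultimately show "(?c *\<^sub>R W ?k) \<bullet> mean (U ?k) + (?c *\<^sub>R vs ?k - (0, ?c *\<^sub>R Z ?k)) \<bullet> (u - U ?k)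
            - 1 / Suc ?k * norm (u - U ?k) \<le> (?c *\<^sub>R W ?k) \<bullet> mean u"
          by (simp only: inner_scaleR_left distrib_left right_diff_distrib mult_1)
      qed
    qed auto
    then have "fst (c0 *\<^sub>R v - (0, z0)) \<in> fst ` subdifferential_integral M \<Phi> w0 u0" by (rule imageI)
    then have "w0 = 0" using \<open>c0 = 0\<close> by (intro qual) simp
    moreover have "norm (c k *\<^sub>R W k) = 1 - c k" for k using c[of k] by simp
    then have "(\<lambda>n. 1 - c (s n)) \<longlonglongrightarrow> norm w0" using tendsto_norm[OF ws] by (simp only:)
    then have "norm w0 = 1 - c0" using tendsto_diff[OF tendsto_const cs] LIMSEQ_unique by blast
    ultimately show False using \<open>c0 = 0\<close> by simp
  qed
  have unscale: "(\<lambda>n. X (s n)) \<longlonglongrightarrow> inverse c0 *\<^sub>R x" if "(\<lambda>n. c (s n) *\<^sub>R X (s n)) \<longlonglongrightarrow> x"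
    for X :: "nat \<Rightarrow> 'z::real_normed_vector" and x
  proof -
    have "inverse (c (s n)) *\<^sub>R (c (s n) *\<^sub>R X (s n)) = X (s n)" for n using c(1)[of "s n"] by simp
    then show ?thesis using tendsto_scaleR[OF tendsto_inverse[OF cs \<open>c0 \<noteq> 0\<close>] that] by (simp only:)
  qed
  note nl = normal_limit[OF subseq_lims Vs unscale[OF ws] unscale[OF zs] inv_s _ NZ min]
  show ?thesis using nl by (intro exI[of _ "inverse c0 *\<^sub>R w0"] exI[of _ "inverse c0 *\<^sub>R z0"]) simp
qed

end

theorem theorem5p3:
  fixes M :: "'t measure"
    and \<Phi> :: "'t \<Rightarrow> (real ^ 'n) \<times> (real ^ 'q) \<Rightarrow> (real ^ 'm) set"
    and G :: "real ^ 'q \<Rightarrow> (real ^ 'm) set"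
    and S :: "real ^ 'n \<Rightarrow> (real ^ 'q) set"
    and xbar :: "real ^ 'n" and zbar :: "real ^ 'q" and ybar :: "real ^ 'm"
  assumes complete: "complete_measure M"
    and finite: "finite_measure M"
    and integrand: "normal_integrand M \<Phi>"
    and G_closed: "closed (gph G)"
    and S_eq: "S = solution_map M \<Phi> G"
    and in_gph: "(xbar, zbar) \<in> gph S"
    and lipschitz: "single_valued_integrably_lipschitz M \<Phi> (xbar, zbar)"
    and ybar_eq: "ybar = the_elem (expected_map M \<Phi> (xbar, zbar))"
    and qualification:
      "\<And>w. 0 \<in> fst ` subdifferential_integral M \<Phi> w (xbar, zbar) \<Longrightarrow> w = 0"
  shows "(\<forall>zs. \<forall>xs \<in> coderivative S xbar zbar zs.
            \<exists>w. (xs, - zs) \<in> subdifferential_integral M \<Phi> w (xbar, zbar)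
                              + {0} \<times> coderivative G zbar (- ybar) w)
    \<and> ((\<forall>w. 0 \<in> snd ` subdifferential_integral M \<Phi> w (xbar, zbar)
                  + coderivative G zbar (- ybar) w \<longrightarrow> w = 0)
         \<longrightarrow> lipschitz_like S xbar zbar)
    \<and> (lipschitz_like G zbar (- ybar) \<longrightarrow> metrically_regular S xbar zbar)"
proof -
  let ?u0 = "(xbar, zbar)"
  have "zbar \<in> solution_map M \<Phi> G xbar" using in_gph by (simp add: S_eq gph_def)
  then have ne: "expected_map M \<Phi> ?u0 \<noteq> {}" by (auto simp: solution_map_def elim!: set_plus_elim)
  obtain \<phi> l \<eta> where sel: "lipschitz_selection M \<phi> l" and \<eta>: "0 < \<eta>"
    and rep: "AE t in M. \<forall>u\<in>cball ?u0 \<eta>. \<Phi> t u = {\<phi> t u}"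
    using lipschitz_selection_exists[OF complete finite integrand lipschitz ne] by blast
  interpret lipschitz_selection M \<phi> l by (rule sel)
  have y: "mean ?u0 = ybar"
    using expected_map_eq[OF sel \<eta> rep G_closed, of ?u0] \<eta> by (simp add: ybar_eq)
  let ?I = "\<lambda>w. subdifferential_integral M \<Phi> w ?u0"
  let ?D = "\<lambda>w. coderivative G zbar (- ybar) w"
  have main: "\<exists>w z. (xs, - zs) - (0, z) \<in> ?I w \<and> z \<in> ?D w" if "xs \<in> coderivative S xbar zbar zs" for xs zs
    using normal_to_solution_graph[OF sel \<eta> rep G_closed qualification, of "(xs, - zs)"] that
    by (simp add: coderivative_def S_eq y)
  have closed_S: "closed (gph S \<inter> cball ?u0 \<eta>)"
    unfolding S_eq by (rule closed_gph_solution_map[OF sel \<eta> rep G_closed])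
  have zS: "zbar \<in> S xbar" using in_gph by (simp add: gph_def)
  show ?thesis
  proof (intro conjI allI ballI impI)
    fix zs xs assume "xs \<in> coderivative S xbar zbar zs"
    then obtain w z where wz: "(xs, - zs) - (0, z) \<in> ?I w" "z \<in> ?D w" using main by blast
    have "((xs, - zs) - (0, z)) + (0, z) \<in> ?I w + {0} \<times> ?D w"
      using wz by (intro set_plus_intro) auto
    then show "\<exists>w. (xs, - zs) \<in> ?I w + {0} \<times> ?D w" by auto
  next
    assume triv: "\<forall>w. 0 \<in> snd ` ?I w + ?D w \<longrightarrow> w = 0"
    show "lipschitz_like S xbar zbar"
    proof (rule lipschitz_like_if_coderivative_zero[OF zS \<eta> closed_S])
      fix v assume "v \<in> coderivative S xbar zbar 0"
      then obtain w z where wz: "(v, - 0) - (0, z) \<in> ?I w" "z \<in> ?D w" using main by blast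
      have "snd ((v, - 0) - (0, z)) + z \<in> snd ` ?I w + ?D w"
        using wz by (intro set_plus_intro imageI)
      then have "w = 0" using triv by simp
      then have "(v, - 0) - (0, z) = 0" using wz(1) subdifferential_integral_zero by blast
      then show "v = 0" by (simp add: prod_eq_iff)
    qed
  next
    assume GL: "lipschitz_like G zbar (- ybar)"
    have "lipschitz_like (\<lambda>z. {x. z \<in> S x}) zbar xbar"
    proof (rule lipschitz_like_if_coderivative_zero)
      show "xbar \<in> {x. zbar \<in> S x}" using zS by simp
      have "gph (\<lambda>z. {x. z \<in> S x}) \<inter> cball (zbar, xbar) \<eta> = prod.swap ` (gph S \<inter> cball ?u0 \<eta>)"
        by (force simp: gph_def dist_Pair_Pair add.commute)
      moreover have "compact (gph S \<inter> cball ?u0 \<eta>)"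
        using closed_S bounded_subset[OF bounded_cball, of _ ?u0 \<eta>] by (simp add: compact_eq_bounded_closed)
      then have "compact (prod.swap ` (gph S \<inter> cball ?u0 \<eta>))"
        by (intro compact_continuous_image) (auto intro!: continuous_intros simp: prod.swap_def)
      ultimately show "closed (gph (\<lambda>z. {x. z \<in> S x}) \<inter> cball (zbar, xbar) \<eta>)"
        by (simp add: compact_imp_closed)
    next
      fix v assume "v \<in> coderivative (\<lambda>z. {x. z \<in> S x}) zbar xbar 0"
      then have "0 \<in> coderivative S xbar zbar (- v)" by (rule coderivative_inverse)
      then obtain w z where wz: "(0, - (- v)) - (0, z) \<in> ?I w" "z \<in> ?D w" using main by blast
      have "fst ((0, - (- v)) - (0, z)) \<in> fst ` ?I w" using wz(1) by (rule imageI)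
      then have w: "w = 0" by (intro qualification) simp
      then have "(0, - (- v)) - (0, z) = (0 :: (real ^ 'n) \<times> (real ^ 'q))"
        using wz(1) subdifferential_integral_zero by blast
      then have "v = z" by (simp add: prod_eq_iff)
      moreover have "z = 0" using wz(2) coderivative_zero_if_lipschitz_like[OF GL] unfolding w by blast
      ultimately show "v = 0" by simp
    qed (rule \<eta>)
    then show "metrically_regular S xbar zbar"
      using zS by (rule metrically_regular_if_inverse_lipschitz_like)
  qed
qed

end
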